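(* Consider the $(n_0,n_1,\ldots,n_N)$ multihop channel. For $i=1,\ldots,N$ let $d_i(r)$ be the diversity-multiplexing tradeoff (DMT) of the point-to-point Rayleigh MIMO channel between layer $i-1$ and layer $i$, and set $$\bar d(r) := \min_{i=1,\ldots,N} d_i(r).$$ Then for any relaying strategy $\mathcal{T}$, the DMT $d^{\mathcal{T}}(r)$ of the end-to-end channel satisfies $d^{\mathcal T}(r)\le \bar d(r)$. In particular, with $d_{\max}:=\bar d(0)$ and $r_{\max}:=\sup\{r : \bar d(r)>0\}$, we have $$d_{\max}=\min_{i=1,\ldots,N} n_{i-1}n_i \qquad\text{and}\qquad r_{\max}=\min_{i=0,\ldots,N} n_i .$$
   Context: Multihop channel: layers $0,1,\ldots,N$ (source = layer $0$, destination = layer $N$, relays in layers $1,\ldots,N-1$), with $n_i$ antennas in total in layer $i$. Terminals in layer $i$ receive only the signal from layer $i-1$: $\mathbf y_i=\mathbf H_i\mathbf x_{i-1}+\mathbf z_i$, $i=1,\ldots,N$, where $\mathbf H_i\in\mathbb C^{n_i\times n_{i-1}}$ are mutually independent with i.i.d. $\mathcal{CN}(0,1)$ entries, constant during the (long) coherence interval, and $\mathbf z_i$ is white Gaussian noise with i.i.d. $\mathcal{CN}(0,1)$ entries. Power constraint: $\mathbb E\|\mathbf x_i\|^2\le \mathsf{SNR}$ for every $i$. Receivers know the channel; there is no transmitter channel knowledge. A relaying strategy $\mathcal T$ is any choice of processing by which each layer forms its transmitted signal $\mathbf x_i$ from its received signal, subject to the power constraint. Its outage probability at rate $R$ is $P^{\mathcal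 T}_{\rm out}(R)=\mathsf P\{I_{\mathcal T}(\mathbf x_0;\mathbf y_N\mid \mathbf H_1,\ldots,\mathbf H_N)<R\}$, and the outage probability of the $i$-th sub-channel is $\mathsf P\{I(\mathbf x_{i-1};\mathbf y_i\mid\mathbf H_i)<R\}$. DMT: a channel with outage probability $P_{\rm out}(\mathsf{SNR},R)$ has DMT $d(r)=-\lim_{\mathsf{SNR}\to\infty}\log P_{\rm out}(\mathsf{SNR},R)/\log\mathsf{SNR}$, where $R=r\log\mathsf{SNR}$ for $r>0$, and $R>0$ is a fixed rate (so $R/\log\mathsf{SNR}\to0$) for $r=0$. Known fact that may be used: the DMT of an $n_t\times n_r$ i.i.d. Rayleigh MIMO channel is the piecewise-linear function connecting the points $(k,(n_t-k)(n_r-k))$, $k=0,1,\ldots,\min(n_t,n_r)$ (and it is $0$ for larger $r$). *)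

theory Defs
  imports "HOL-Probability.Probability"
begin

text \<open>A complex \<open>n \<times> m\<close> matrix is a function on pairs of indices, extensional on
  \<open>{..<n} \<times> {..<m}\<close>, so that all dimensions can be natural-number parameters.\<close>

type_synonym cmat = "nat \<times> nat \<Rightarrow> complex"

definition mat_space :: "nat \<Rightarrow> nat \<Rightarrow> cmat measure" where
  "mat_space n m = PiM ({..<n} \<times> {..<m}) (\<lambda>_. borel)"

definition frob_sq :: "nat \<Rightarrow> nat \<Rightarrow> cmat \<Rightarrow> real" where
  "frob_sq n m x = (\<Sum>p\<in>{..<n} \<times> {..<m}. (cmod (x p))\<^sup>2)"

definition complex_gaussian :: "complex measure" where
  "complex_gaussian = density lborel (\<lambda>z. ennreal (exp (- (cmod z)\<^sup>2) / pi))"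

definition gaussian_mat :: "nat \<Rightarrow> nat \<Rightarrow> cmat measure" where
  "gaussian_mat n m = PiM ({..<n} \<times> {..<m}) (\<lambda>_. complex_gaussian)"

text \<open>Law of the output \<open>H x + z\<close> of \<open>L\<close> uses of the channel with fixed matrix \<open>H\<close>, whose
  block input is the \<open>nt \<times> L\<close> matrix \<open>x\<close> (one column per channel use).\<close>

definition awgn :: "nat \<Rightarrow> nat \<Rightarrow> nat \<Rightarrow> cmat \<Rightarrow> cmat \<Rightarrow> cmat measure" where
  "awgn nt nr L H x =
     distr (gaussian_mat nr L) (mat_space nr L)
       (\<lambda>z. \<lambda>(a, t)\<in>{..<nr} \<times> {..<L}. (\<Sum>b<nt. H (a, b) * x (b, t)) + z (a, t))"

text \<open>Mutual information (in bits) between an input with law \<open>P\<close> and the corresponding output of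
  the Markov kernel \<open>K\<close>.\<close>

definition joint_law :: "'a measure \<Rightarrow> 'b measure \<Rightarrow> 'a measure \<Rightarrow> ('a \<Rightarrow> 'b measure) \<Rightarrow> ('a \<times> 'b) measure" where
  "joint_law A B P K = P \<bind> (\<lambda>x. distr (K x) (A \<Otimes>\<^sub>M B) (Pair x))"

definition io_information :: "'a measure \<Rightarrow> 'b measure \<Rightarrow> 'a measure \<Rightarrow> ('a \<Rightarrow> 'b measure) \<Rightarrow> real" where
  "io_information A B P K = prob_space.mutual_information (joint_law A B P K) 2 A B fst snd"


text \<open>Point-to-point Rayleigh channel. The input law does not depend on the channel matrix (no
  transmitter channel knowledge) and is otherwise chosen optimally for the given SNR and rate.\<close>

definition mimo_input :: "nat \<Rightarrow> real \<Rightarrow> cmat measure \<Rightarrow> bool" where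
  "mimo_input nt snr Q \<longleftrightarrow>
     Q \<in> space (prob_algebra (mat_space nt 1)) \<and>
     (\<integral>\<^sup>+x. ennreal (frob_sq nt 1 x) \<partial>Q) \<le> ennreal snr"

definition mimo_outage_of :: "nat \<Rightarrow> nat \<Rightarrow> cmat measure \<Rightarrow> real \<Rightarrow> real" where
  "mimo_outage_of nt nr Q R =
     measure (gaussian_mat nr nt)
       {H \<in> space (gaussian_mat nr nt).
          io_information (mat_space nt 1) (mat_space nr 1) Q (awgn nt nr 1 H) < R}"

definition mimo_outage :: "nat \<Rightarrow> nat \<Rightarrow> real \<Rightarrow> real \<Rightarrow> real" where
  "mimo_outage nt nr snr R = (INF Q\<in>{Q. mimo_input nt snr Q}. mimo_outage_of nt nr Q R)"


text \<open>Diversity-multiplexing tradeoff of a channel with outage probability \<open>P snr R\<close>. The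
  parameter \<open>R0\<close> is the fixed positive rate used at multiplexing gain \<open>0\<close>; the convention
  \<open>- log 0 = \<infinity>\<close> is built into \<open>outage_exponent\<close>.\<close>

definition dmt_rate :: "real \<Rightarrow> real \<Rightarrow> real \<Rightarrow> real" where
  "dmt_rate R0 r snr = (if r = 0 then R0 else r * log 2 snr)"

definition outage_exponent :: "real \<Rightarrow> real \<Rightarrow> ereal" where
  "outage_exponent snr p = (if p = 0 then \<infinity> else ereal (- log 2 p / log 2 snr))"

definition has_dmt :: "(real \<Rightarrow> real \<Rightarrow> real) \<Rightarrow> real \<Rightarrow> real \<Rightarrow> ereal \<Rightarrow> bool" where
  "has_dmt P R0 r d \<longleftrightarrow>
     ((\<lambda>snr. outage_exponent snr (P snr (dmt_rate R0 r snr))) \<longlongrightarrow> d) at_top"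

definition dmt :: "(real \<Rightarrow> real \<Rightarrow> real) \<Rightarrow> real \<Rightarrow> real \<Rightarrow> ereal" where
  "dmt P R0 r = Lim at_top (\<lambda>snr. outage_exponent snr (P snr (dmt_rate R0 r snr)))"

text \<open>The piecewise linear function through the points \<open>(k, (nt - k) * (nr - k))\<close> for
  \<open>k \<le> min nt nr\<close>, and \<open>0\<close> to the right of them.\<close>

definition mimo_dmt_curve :: "nat \<Rightarrow> nat \<Rightarrow> real \<Rightarrow> real" where
  "mimo_dmt_curve nt nr r =
     (let c = (\<lambda>k::nat. (real nt - real k) * (real nr - real k)); k = nat \<lfloor>r\<rfloor> in
      if real (min nt nr) \<le> r then 0 else c k + (r - real k) * (c (k + 1) - c k))"


text \<open>The multihop channel: \<open>n i\<close> is the number of antennas of layer \<open>i\<close>, and \<open>h i\<close> is the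
  \<open>n i \<times> n (i - 1)\<close> matrix of hop \<open>i\<close>, for \<open>i = 1, \<dots>, N\<close>.\<close>

definition multihop_fading :: "nat \<Rightarrow> (nat \<Rightarrow> nat) \<Rightarrow> (nat \<Rightarrow> cmat) measure" where
  "multihop_fading N n = PiM {1..N} (\<lambda>i. gaussian_mat (n i) (n (i - 1)))"

text \<open>A strategy works on blocks of \<open>block_len\<close> channel uses within one coherence interval. The
  source draws its block from a law that does not depend on the channel. Layer \<open>i\<close> draws its
  block from a Markov kernel applied to its received block and to the matrices of the hops
  \<open>1, \<dots>, i\<close> only, so nothing is known about the hops ahead.\<close>

record strategy =
  block_len :: nat
  source :: "cmat measure"
  relay :: "nat \<Rightarrow> (nat \<Rightarrow> cmat) \<times> cmat \<Rightarrow> cmat measure"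

abbreviation block_space :: "(nat \<Rightarrow> nat) \<Rightarrow> strategy \<Rightarrow> nat \<Rightarrow> cmat measure" where
  "block_space n T i \<equiv> mat_space (n i) (block_len T)"

text \<open>Given the channel matrices \<open>h\<close> and the source block \<open>x0\<close>: the law of the block transmitted
  by layer \<open>i\<close>.\<close>

primrec transmit_law :: "(nat \<Rightarrow> nat) \<Rightarrow> strategy \<Rightarrow> (nat \<Rightarrow> cmat) \<Rightarrow> nat \<Rightarrow> cmat \<Rightarrow> cmat measure" where
  "transmit_law n T h 0 x0 = return (block_space n T 0) x0"
| "transmit_law n T h (Suc i) x0 =
     transmit_law n T h i x0
       \<bind> awgn (n i) (n (Suc i)) (block_len T) (h (Suc i))
       \<bind> (\<lambda>y. relay T (Suc i) (restrict h {1..Suc i}, y))"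

text \<open>The law of the block received by layer \<open>i \<ge> 1\<close>, under the same conditioning.\<close>

definition receive_law :: "(nat \<Rightarrow> nat) \<Rightarrow> strategy \<Rightarrow> (nat \<Rightarrow> cmat) \<Rightarrow> nat \<Rightarrow> cmat \<Rightarrow> cmat measure" where
  "receive_law n T h i x0 =
     transmit_law n T h (i - 1) x0 \<bind> awgn (n (i - 1)) (n i) (block_len T) (h i)"

text \<open>The power constraint is per channel use and averages over the block and over all the
  randomness in the system, including the fading.\<close>

definition relaying_strategy :: "nat \<Rightarrow> (nat \<Rightarrow> nat) \<Rightarrow> real \<Rightarrow> strategy \<Rightarrow> bool" where
  "relaying_strategy N n snr T \<longleftrightarrow>
     1 \<le> block_len T \<and>
     source T \<in> space (prob_algebra (block_space n T 0)) \<and>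
     (\<forall>i\<in>{1..<N}. relay T i \<in>
        PiM {1..i} (\<lambda>j. mat_space (n j) (n (j - 1))) \<Otimes>\<^sub>M block_space n T i
          \<rightarrow>\<^sub>M prob_algebra (block_space n T i)) \<and>
     (\<forall>i<N. (\<integral>\<^sup>+h. (\<integral>\<^sup>+x. ennreal (frob_sq (n i) (block_len T) x)
                  \<partial>(source T \<bind> transmit_law n T h i)) \<partial>multihop_fading N n)
              \<le> ennreal (real (block_len T) * snr))"

text \<open>Mutual information per channel use between source and destination, given \<open>h\<close>.\<close>

definition end_to_end_information :: "nat \<Rightarrow> (nat \<Rightarrow> nat) \<Rightarrow> strategy \<Rightarrow> (nat \<Rightarrow> cmat) \<Rightarrow> real" where
  "end_to_end_information N n T h =
     io_information (block_space n T 0) (block_space n T N) (source T) (receive_law n T h N)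
       / real (block_len T)"

definition end_to_end_outage :: "nat \<Rightarrow> (nat \<Rightarrow> nat) \<Rightarrow> strategy \<Rightarrow> real \<Rightarrow> real" where
  "end_to_end_outage N n T R =
     measure (multihop_fading N n)
       {h \<in> space (multihop_fading N n). end_to_end_information N n T h < R}"

definition hop_dmt_min :: "nat \<Rightarrow> (nat \<Rightarrow> nat) \<Rightarrow> real \<Rightarrow> real \<Rightarrow> ereal" where
  "hop_dmt_min N n R0 r = (MIN i\<in>{1..N}. dmt (mimo_outage (n (i - 1)) (n i)) R0 r)"

end

theory Submission
  imports Defs "HOL-Real_Asymp.Real_Asymp"
begin

text \<open>Fix a hop \<open>i\<close> and the matrices of all hops. The source, the block sent by layer \<open>i - 1\<close>, the block
  received by layer \<open>i\<close> and the block received by the destination form a Markov chain, so the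
  end-to-end information is at most that of the block channel of hop \<open>i\<close>, which per channel use is
  at most the information of a single use under the average of the column laws. This average law does
  not depend on the matrix of hop \<open>i\<close>, and by Markov's inequality its power is at most \<open>2 snr\<close> with
  probability at least \<open>1/2\<close> over the other hops. By Fubini the end-to-end outage probability at
  \<open>snr\<close> is therefore at least half the outage probability of hop \<open>i\<close> at \<open>2 snr\<close>. The two factors
  \<open>2\<close> vanish on the exponential scale, the second one after lowering the multiplexing gain
  slightly and using left continuity of the tradeoff curve.\<close>

section \<open>The tradeoff curve and outage exponents\<close>

text \<open>The obstacle is a mismatch of inputs. The MIMO outage probability is an infimum over
  single-use laws chosen before the matrix is drawn, while a strategy sends blocks with memory whose
  power is bounded only on average over the fading. Mixing the columns of a block gives one law that
  serves every matrix of hop \<open>i\<close> at once; its power still varies with the earlier hops,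
  hence the doubled snr.

  Concavity of mutual information and subadditivity of entropy are not invoked. For every positive
  sub-density \<open>q\<close> on the hop output, the mean of \<open>log 2 (w / q)\<close> dominates
  the end-to-end information. With \<open>q\<close> a product of single-use output densities this
  mean splits over the columns, and the sum is exactly block length times the information of the
  mixture.

  Information is a Bochner integral, so it is 0 when its integrand is not integrable. Gaussian noise
  in every hop supplies positive bounded densities, and finite power makes the dominating mean a
  genuine integral. If the end-to-end integrand is not integrable, the bound survives because that
  mean is nonnegative.\<close>

lemma mimo_dmt_curve_eq:
  assumes "real k \<le> r" "r < real k + 1" "k < min nt nr"
  shows "mimo_dmt_curve nt nr r =
    (real nt - real k) * (real nr - real k) +
    (r - real k) * ((real nt - real (k+1)) * (real nr - real (k+1)) - (real nt - real k) * (real nr - real k))"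
proof -
  have "\<lfloor>r\<rfloor> = int k" using assms by (intro floor_unique) auto
  then have "nat \<lfloor>r\<rfloor> = k" by simp
  moreover have "\<not> real (min nt nr) \<le> r" using assms by linarith
  ultimately show ?thesis unfolding mimo_dmt_curve_def Let_def by simp
qed

lemma mimo_dmt_curve_eq_0: "real (min nt nr) \<le> r \<Longrightarrow> mimo_dmt_curve nt nr r = 0"
  by (simp add: mimo_dmt_curve_def)

lemma mimo_dmt_curve_at_0: "1 \<le> nt \<Longrightarrow> 1 \<le> nr \<Longrightarrow> mimo_dmt_curve nt nr 0 = real (nt * nr)"
  by (subst mimo_dmt_curve_eq[where k=0]) auto

text \<open>On a linear piece the value is a convex combination of the corner values
  \<open>c0 > 0\<close> and \<open>c1 >= 0\<close>, and the weight of \<open>c0\<close> is positive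
  because \<open>r < k + 1\<close>.\<close>

lemma mimo_dmt_curve_pos:
  assumes "0 \<le> r" "r < real (min nt nr)"
  shows "0 < mimo_dmt_curve nt nr r"
proof -
  define k where "k = nat \<lfloor>r\<rfloor>"
  have k: "real k \<le> r" "r < real k + 1" "k < min nt nr"
    using assms unfolding k_def by linarith+
  define c0 where "c0 = (real nt - real k) * (real nr - real k)"
  define c1 where "c1 = (real nt - real (k+1)) * (real nr - real (k+1))"
  have "0 < c0" unfolding c0_def using k(3) by (intro mult_pos_pos) auto
  moreover have "0 \<le> c1" unfolding c1_def using k(3) by (intro mult_nonneg_nonneg) auto
  moreover have "mimo_dmt_curve nt nr r = (1 - (r - real k)) * c0 + (r - real k) * c1"
    unfolding mimo_dmt_curve_eq[OF k] c0_def[symmetric] c1_def[symmetric] by (simp add: algebra_simps)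
  ultimately show ?thesis using k by (simp add: add_pos_nonneg)
qed

lemma mimo_dmt_curve_pos_iff:
  "0 \<le> r \<Longrightarrow> 0 < mimo_dmt_curve nt nr r \<longleftrightarrow> r < real (min nt nr)"
  using mimo_dmt_curve_pos mimo_dmt_curve_eq_0 by (metis less_irrefl not_less)

text \<open>The outage comparison at \<open>r > 0\<close> is available only for smaller gains, so
  the bound at \<open>r\<close> itself has to be recovered as a limit from the left.\<close>

lemma mimo_dmt_curve_tendsto_left:
  assumes "0 < r"
  shows "(mimo_dmt_curve nt nr \<longlongrightarrow> mimo_dmt_curve nt nr r) (at_left r)"
proof -
  \<comment> \<open>Ceiling minus one rather than floor: at an integer \<open>r\<close> the piece to
    the left of \<open>r\<close> is wanted.\<close>
  define k where "k = nat (\<lceil>r\<rceil> - 1)"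
  have k: "real k < r" "r \<le> real k + 1" using assms unfolding k_def by linarith+
  have ev: "\<forall>\<^sub>F s in at_left r. s \<in> {real k<..<r}"
    using k(1) by (rule eventually_at_left_real)
  show ?thesis
  proof (cases "k < min nt nr")
    case False
    have z: "mimo_dmt_curve nt nr s = 0" if "real k \<le> s" for s
      using False that by (intro mimo_dmt_curve_eq_0) linarith
    have "\<forall>\<^sub>F s in at_left r. 0 = mimo_dmt_curve nt nr s"
      using ev by eventually_elim (use z in auto)
    with z[of r] k show ?thesis by (auto intro: Lim_transform_eventually[OF tendsto_const])
  next
    case True
    define c where "c = (\<lambda>k::nat. (real nt - real k) * (real nr - real k))"
    define l where "l = (\<lambda>s. c k + (s - real k) * (c (k+1) - c k))"
    have eq: "mimo_dmt_curve nt nr s = l s" if "real k \<le> s" "s < real k + 1" for s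
      using mimo_dmt_curve_eq[OF that True] by (simp add: l_def c_def)
    have "mimo_dmt_curve nt nr r = l r"
    proof (cases "r < real k + 1")
      \<comment> \<open>At the corner \<open>r = k + 1\<close> the definition of the curve already
        uses the next piece, or 0 past the last corner. Both agree with the right end of
        \<open>l\<close>.\<close>
      case False
      then have r: "r = real (k + 1)" using k by simp
      have l: "l r = c (k + 1)" by (simp add: l_def r)
      show ?thesis
      proof (cases "k + 1 < min nt nr")
        case True2: True
        show ?thesis using mimo_dmt_curve_eq[of "k+1" r nt nr] True2 l by (simp add: r c_def)
      next
        case False2: False
        then have "k + 1 = min nt nr" using True by linarith
        then show ?thesis using l mimo_dmt_curve_eq_0[of nt nr r]
          by (auto simp: r c_def min_def split: if_splits)
      qed
    qed (use eq k in auto)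
    moreover have "(l \<longlongrightarrow> l r) (at_left r)" unfolding l_def by (intro tendsto_intros)
    moreover have "\<forall>\<^sub>F s in at_left r. l s = mimo_dmt_curve nt nr s"
      using ev by eventually_elim (use eq k in auto)
    ultimately show ?thesis by (auto intro: Lim_transform_eventually)
  qed
qed

text \<open>A zero outage probability has exponent infinity, so a finite limit excludes it
  eventually. From then on the exponent is a real number and the limit can be taken in the
  reals.\<close>

lemma has_dmt_real_exponent:
  assumes "has_dmt P R0 r (ereal c)"
  shows "\<forall>\<^sub>F s in at_top. P s (dmt_rate R0 r s) \<noteq> 0"
    and "((\<lambda>s. - log 2 (P s (dmt_rate R0 r s)) / log 2 s) \<longlongrightarrow> c) at_top"
proof -
  have lim: "((\<lambda>s. outage_exponent s (P s (dmt_rate R0 r s))) \<longlongrightarrow> ereal c) at_top"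
    using assms by (simp add: has_dmt_def)
  then have "\<forall>\<^sub>F s in at_top. outage_exponent s (P s (dmt_rate R0 r s)) < \<infinity>"
    by (rule order_tendstoD) simp
  then show ev: "\<forall>\<^sub>F s in at_top. P s (dmt_rate R0 r s) \<noteq> 0"
    by eventually_elim (auto simp: outage_exponent_def)
  have "((\<lambda>s. ereal (- log 2 (P s (dmt_rate R0 r s)) / log 2 s)) \<longlongrightarrow> ereal c) at_top"
    by (rule Lim_transform_eventually[OF lim]) (use ev in eventually_elim, simp add: outage_exponent_def)
  then show "((\<lambda>s. - log 2 (P s (dmt_rate R0 r s)) / log 2 s) \<longlongrightarrow> c) at_top"
    by (simp only: lim_ereal)
qed

text \<open>Constant factors in the snr and in the probability change the exponent only by terms
  that vanish after division by \<open>log 2 snr\<close>. The gap \<open>r' < r\<close> pays for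
  evaluating the rate of \<open>m\<close> at the doubled snr.\<close>

lemma dmt_le_of_outage_ge:
  fixes P m :: "real \<Rightarrow> real \<Rightarrow> real"
  assumes ge: "\<And>snr R R'. 1 < snr \<Longrightarrow> 0 < R' \<Longrightarrow> R' \<le> R \<Longrightarrow> m (2 * snr) R' \<le> 2 * P snr R"
    and nonneg: "\<And>snr R. 0 < snr \<Longrightarrow> 0 \<le> m snr R"
    and m: "has_dmt m R0 r' (ereal c)" and P: "has_dmt P R0 r d"
    and "0 < R0" and r': "r' = 0 \<and> r = 0 \<or> 0 < r' \<and> r' < r"
  shows "d \<le> ereal c"
proof -
  define p where "p s = m s (dmt_rate R0 r' s)" for s
  define f where "f s = - log 2 (p s) / log 2 s" for s
  have double: "filterlim (\<lambda>s::real. 2 * s) at_top at_top" by real_asymp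
  have "\<forall>\<^sub>F s in at_top. p s \<noteq> 0" "(f \<longlongrightarrow> c) at_top"
    unfolding p_def f_def by (rule has_dmt_real_exponent[OF m])+
  then have p0: "\<forall>\<^sub>F s in at_top. p (2 * s) \<noteq> 0" and f2: "((\<lambda>s. f (2 * s)) \<longlongrightarrow> c) at_top"
    using double by (auto intro: filterlim_compose eventually_compose_filterlim)
  \<comment> \<open>The quotient of logarithms renormalises \<open>f (2 * s)\<close> from
    \<open>log 2 (2 * s)\<close> to \<open>log 2 s\<close>; the summand \<open>1 / log 2 s\<close>
    is the cost of the factor 2 in front of \<open>P\<close>.\<close>
  have "((\<lambda>s. f (2 * s) * (log 2 (2 * s) / log 2 s) + 1 / log 2 s) \<longlongrightarrow> c * 1 + 0) at_top"
    by (intro tendsto_intros f2) real_asymp+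
  \<comment> \<open>Doubling the snr raises the rate of gain \<open>r'\<close> by \<open>r'\<close>,
    which \<open>(r - r') * log 2 s\<close> eventually exceeds. At gain 0 both rates are the fixed
    \<open>R0\<close>.\<close>
  moreover have "\<forall>\<^sub>F s in at_top. dmt_rate R0 r' (2 * s) \<le> dmt_rate R0 r s"
  proof (cases "r = 0")
    case False
    then have "0 < r'" "r' < r" using r' by auto
    have "filterlim (\<lambda>s. (r - r') * log 2 s) at_top at_top" using \<open>r' < r\<close> by real_asymp
    then have "\<forall>\<^sub>F s in at_top. r' \<le> (r - r') * log 2 s"
      by (simp add: filterlim_at_top)
    then show ?thesis using eventually_gt_at_top[of 1]
      by eventually_elim (use \<open>0 < r'\<close> \<open>r' < r\<close> in \<open>auto simp: dmt_rate_def log_mult algebra_simps\<close>)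
  qed (use r' in \<open>auto simp: dmt_rate_def\<close>)
  then have "\<forall>\<^sub>F s in at_top. outage_exponent s (P s (dmt_rate R0 r s))
      \<le> ereal (f (2 * s) * (log 2 (2 * s) / log 2 s) + 1 / log 2 s)"
    using p0 eventually_gt_at_top[of 1]
  proof eventually_elim
    case (elim s)
    have "0 < dmt_rate R0 r' (2 * s)" using \<open>0 < R0\<close> r' elim by (auto simp: dmt_rate_def)
    then have le: "p (2 * s) \<le> 2 * P s (dmt_rate R0 r s)"
      using elim by (auto simp: p_def intro!: ge)
    have pos: "0 < p (2 * s)" using elim nonneg[of "2 * s"] by (auto simp: p_def less_le)
    then have Ppos: "0 < P s (dmt_rate R0 r s)" using le by linarith
    have ls: "0 < log 2 s" "0 < log 2 (2 * s)" using elim by auto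
    have "log 2 (p (2 * s)) \<le> log 2 (2 * P s (dmt_rate R0 r s))" using le pos by simp
    also have "\<dots> = 1 + log 2 (P s (dmt_rate R0 r s))" using Ppos by (simp add: log_mult)
    finally have "- log 2 (P s (dmt_rate R0 r s)) \<le> - log 2 (p (2 * s)) + 1" by simp
    then have "- log 2 (P s (dmt_rate R0 r s)) / log 2 s \<le> (- log 2 (p (2 * s)) + 1) / log 2 s"
      using ls by (intro divide_right_mono) auto
    also have "\<dots> = f (2 * s) * (log 2 (2 * s) / log 2 s) + 1 / log 2 s"
      using ls by (simp add: f_def diff_divide_distrib)
    finally show ?case using Ppos by (simp add: outage_exponent_def)
  qed
  ultimately show ?thesis
    using P unfolding has_dmt_def by (intro tendsto_le[OF _ _ P[unfolded has_dmt_def]]) auto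
qed

lemma ereal_Min:
  "finite A \<Longrightarrow> A \<noteq> {} \<Longrightarrow> (MIN i\<in>A. ereal (f i)) = ereal (MIN i\<in>A. f i)"
  using mono_Min_commute[of ereal "f ` A"] by (simp add: mono_def image_image)

lemma real_Min:
  "finite A \<Longrightarrow> A \<noteq> {} \<Longrightarrow> (MIN i\<in>A. real (f i)) = real (MIN i\<in>A. f i)"
  using mono_Min_commute[of real "f ` A"] by (simp add: mono_def image_image)

section \<open>Mutual information of kernels with positive densities\<close>

lemma joint_law_measurable_kernel:
  assumes K[measurable]: "K \<in> A \<rightarrow>\<^sub>M prob_algebra B"
  shows "(\<lambda>x. distr (K x) (A \<Otimes>\<^sub>M B) (Pair x)) \<in> A \<rightarrow>\<^sub>M prob_algebra (A \<Otimes>\<^sub>M B)"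
  by measurable

lemma joint_law_in_prob_algebra:
  assumes P: "P \<in> space (prob_algebra A)" and K: "K \<in> A \<rightarrow>\<^sub>M prob_algebra B"
  shows "joint_law A B P K \<in> space (prob_algebra (A \<Otimes>\<^sub>M B))"
  unfolding joint_law_def
  using prob_space_bind'[OF P joint_law_measurable_kernel[OF K]]
    sets_bind'[OF P joint_law_measurable_kernel[OF K]]
  by (simp add: space_prob_algebra)

lemma nn_integral_bind_prob:
  assumes P: "P \<in> space (prob_algebra A)" and K: "K \<in> A \<rightarrow>\<^sub>M prob_algebra B"
    and F: "F \<in> borel_measurable B"
  shows "(\<integral>\<^sup>+y. F y \<partial>(P \<bind> K)) = (\<integral>\<^sup>+x. \<integral>\<^sup>+y. F y \<partial>K x \<partial>P)"
proof (rule nn_integral_bind[OF F])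
  have "sets P = sets A" using P by (simp add: space_prob_algebra)
  then show "K \<in> P \<rightarrow>\<^sub>M subprob_algebra B"
    using measurable_prob_algebraD[OF K] by (simp cong: measurable_cong_sets)
qed

lemma nn_integral_joint_law:
  assumes P: "P \<in> space (prob_algebra A)" and K: "K \<in> A \<rightarrow>\<^sub>M prob_algebra B"
    and F: "F \<in> borel_measurable (A \<Otimes>\<^sub>M B)"
  shows "(\<integral>\<^sup>+z. F z \<partial>joint_law A B P K) = (\<integral>\<^sup>+x. \<integral>\<^sup>+y. F (x, y) \<partial>K x \<partial>P)"
proof -
  have sP: "sets P = sets A" "space P = space A"
    using P by (auto simp: space_prob_algebra dest: sets_eq_imp_space_eq)
  have "(\<integral>\<^sup>+z. F z \<partial>joint_law A B P K)
      = (\<integral>\<^sup>+x. \<integral>\<^sup>+z. F z \<partial>distr (K x) (A \<Otimes>\<^sub>M B) (Pair x) \<partial>P)"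
    unfolding joint_law_def by (rule nn_integral_bind_prob[OF P joint_law_measurable_kernel[OF K] F])
  also have "\<dots> = (\<integral>\<^sup>+x. \<integral>\<^sup>+y. F (x, y) \<partial>K x \<partial>P)"
  proof (rule nn_integral_cong)
    fix x assume "x \<in> space P"
    then have x: "x \<in> space A" by (simp add: sP)
    then have "sets (K x) = sets B"
      using measurable_space[OF K x] by (simp add: space_prob_algebra)
    then have "Pair x \<in> K x \<rightarrow>\<^sub>M A \<Otimes>\<^sub>M B"
      using measurable_Pair1'[OF x, of B] by (simp cong: measurable_cong_sets)
    then show "(\<integral>\<^sup>+z. F z \<partial>distr (K x) (A \<Otimes>\<^sub>M B) (Pair x)) = (\<integral>\<^sup>+y. F (x, y) \<partial>K x)"
      using F by (simp add: nn_integral_distr)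
  qed
  finally show ?thesis .
qed

lemma measure_eqI_nn_integral:
  assumes "sets M = sets N" "\<And>F. F \<in> borel_measurable N \<Longrightarrow> (\<integral>\<^sup>+x. F x \<partial>M) = (\<integral>\<^sup>+x. F x \<partial>N)"
  shows "M = N"
proof (rule measure_eqI[OF assms(1)])
  fix X assume "X \<in> sets M"
  then show "emeasure M X = emeasure N X"
    using assms(2)[of "indicator X"] assms(1) by simp
qed

text \<open>Captures at once the single-use channel, the block channel of a hop and the end-to-end
  channel. Positivity makes all quotients and logarithms of densities meaningful at every point,
  without null-set conventions; the bound \<open>c\<close> makes the sections of \<open>g\<close>
  integrable under every input law.\<close>

locale positive_density_kernel =
  fixes A :: "'a measure" and B :: "'b measure" and P :: "'a measure"
    and K :: "'a \<Rightarrow> 'b measure" and \<nu> :: "'b measure" and g :: "'a \<times> 'b \<Rightarrow> real" and c :: real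
  assumes P: "P \<in> space (prob_algebra A)"
    and K: "K \<in> A \<rightarrow>\<^sub>M prob_algebra B"
    and sigma_finite: "sigma_finite_measure \<nu>" and sets_\<nu>: "sets \<nu> = sets B"
    and g: "g \<in> borel_measurable (A \<Otimes>\<^sub>M B)"
    and g_pos: "\<And>x y. x \<in> space A \<Longrightarrow> y \<in> space B \<Longrightarrow> 0 < g (x, y)"
    and g_le: "\<And>x y. x \<in> space A \<Longrightarrow> y \<in> space B \<Longrightarrow> g (x, y) \<le> c"
    and K_eq: "\<And>x. x \<in> space A \<Longrightarrow> K x = density \<nu> (\<lambda>y. ennreal (g (x, y)))"
begin

definition out_density :: "'b \<Rightarrow> real" where
  "out_density y = (\<integral>x. g (x, y) \<partial>P)"

lemma sets_P: "sets P = sets A" and space_P: "space P = space A" and prob_space_P: "prob_space P"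
  using P by (auto simp: space_prob_algebra dest: sets_eq_imp_space_eq)

lemma space_\<nu>: "space \<nu> = space B"
  using sets_\<nu> by (rule sets_eq_imp_space_eq)

lemma integrable_section: "y \<in> space B \<Longrightarrow> integrable P (\<lambda>x. g (x, y))"
proof -
  assume y: "y \<in> space B"
  interpret P: prob_space P by (rule prob_space_P)
  have "(\<lambda>x. g (x, y)) \<in> borel_measurable P"
    using measurable_compose[OF measurable_Pair2'[OF y] g]
    by (simp cong: measurable_cong_sets add: sets_P)
  then show ?thesis
    using g_pos[OF _ y] g_le[OF _ y]
    by (intro P.integrable_const_bound[where B=c]) (auto simp: space_P less_imp_le)
qed

lemma out_density_pos: "y \<in> space B \<Longrightarrow> 0 < out_density y"
proof -
  assume y: "y \<in> space B"
  interpret P: prob_space P by (rule prob_space_P)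
  have nn: "AE x in P. 0 \<le> g (x, y)"
    using g_pos[OF _ y] by (auto simp: space_P less_imp_le)
  have "out_density y \<noteq> 0"
  proof
    assume "out_density y = 0"
    then have "AE x in P. g (x, y) = 0"
      using integral_nonneg_eq_0_iff_AE[OF integrable_section[OF y] nn] by (simp add: out_density_def)
    then have "AE x in P. False"
      by (rule AE_mp) (use g_pos[OF _ y] in \<open>force intro!: AE_I2 simp: space_P\<close>)
    then show False by simp
  qed
  moreover have "0 \<le> out_density y" unfolding out_density_def by (rule integral_nonneg_AE[OF nn])
  ultimately show ?thesis by simp
qed

lemma out_density_le: "y \<in> space B \<Longrightarrow> out_density y \<le> c"
proof -
  assume y: "y \<in> space B"
  interpret P: prob_space P by (rule prob_space_P)
  have "out_density y \<le> (\<integral>x. c \<partial>P)"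
    unfolding out_density_def using integrable_section[OF y] g_le[OF _ y]
    by (intro integral_mono) (auto simp: space_P)
  then show ?thesis by (simp add: P.prob_space)
qed

lemma ennreal_out_density: "y \<in> space B \<Longrightarrow> ennreal (out_density y) = (\<integral>\<^sup>+x. ennreal (g (x, y)) \<partial>P)"
  unfolding out_density_def
  using integrable_section g_pos
  by (intro nn_integral_eq_integral[symmetric]) (auto simp: space_P less_imp_le)

lemma out_density_measurable: "out_density \<in> borel_measurable B"
proof -
  interpret P: prob_space P by (rule prob_space_P)
  note [measurable_cong] = sets_P
  have [measurable]: "(\<lambda>(y, x). g (x, y)) \<in> borel_measurable (B \<Otimes>\<^sub>M P)"
    using g by simp
  show ?thesis unfolding out_density_def by measurable
qed

lemma joint_law_eq_density: "joint_law A B P K = density (P \<Otimes>\<^sub>M \<nu>) (\<lambda>z. ennreal (g z))"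
proof (rule measure_eqI_nn_integral)
  interpret \<nu>: sigma_finite_measure \<nu> by (rule sigma_finite)
  note [measurable_cong] = sets_P sets_\<nu>
  note [measurable] = g
  have s: "sets (P \<Otimes>\<^sub>M \<nu>) = sets (A \<Otimes>\<^sub>M B)"
    by (intro sets_pair_measure_cong sets_P sets_\<nu>)
  show "sets (joint_law A B P K) = sets (density (P \<Otimes>\<^sub>M \<nu>) (\<lambda>z. ennreal (g z)))"
    using joint_law_in_prob_algebra[OF P K] s by (simp add: space_prob_algebra)
  fix F :: "_ \<Rightarrow> ennreal" assume "F \<in> borel_measurable (density (P \<Otimes>\<^sub>M \<nu>) (\<lambda>z. ennreal (g z)))"
  then have F[measurable]: "F \<in> borel_measurable (A \<Otimes>\<^sub>M B)"
    using s by (simp cong: measurable_cong_sets)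
  have "(\<integral>\<^sup>+z. F z \<partial>joint_law A B P K) = (\<integral>\<^sup>+x. \<integral>\<^sup>+y. F (x, y) \<partial>K x \<partial>P)"
    by (rule nn_integral_joint_law[OF P K F])
  also have "\<dots> = (\<integral>\<^sup>+x. \<integral>\<^sup>+y. ennreal (g (x, y)) * F (x, y) \<partial>\<nu> \<partial>P)"
    by (intro nn_integral_cong, subst K_eq) (auto simp: space_P intro!: nn_integral_density)
  also have "\<dots> = (\<integral>\<^sup>+z. ennreal (g z) * F z \<partial>(P \<Otimes>\<^sub>M \<nu>))"
    by (subst \<nu>.nn_integral_fst[symmetric]) auto
  also have "\<dots> = (\<integral>\<^sup>+z. F z \<partial>density (P \<Otimes>\<^sub>M \<nu>) (\<lambda>z. ennreal (g z)))"
    by (subst nn_integral_density) auto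
  finally show "(\<integral>\<^sup>+z. F z \<partial>joint_law A B P K) = (\<integral>\<^sup>+z. F z \<partial>density (P \<Otimes>\<^sub>M \<nu>) (\<lambda>z. ennreal (g z)))" .
qed

lemma bind_eq_density: "P \<bind> K = density \<nu> (\<lambda>y. ennreal (out_density y))"
proof (rule measure_eqI_nn_integral)
  interpret \<nu>: sigma_finite_measure \<nu> by (rule sigma_finite)
  interpret P: prob_space P by (rule prob_space_P)
  interpret PN: pair_sigma_finite P \<nu> ..
  note [measurable_cong] = sets_P sets_\<nu>
  note [measurable] = g out_density_measurable
  show "sets (P \<bind> K) = sets (density \<nu> (\<lambda>y. ennreal (out_density y)))"
    using sets_bind'[OF P K] by (simp add: sets_\<nu>)
  fix F :: "_ \<Rightarrow> ennreal" assume "F \<in> borel_measurable (density \<nu> (\<lambda>y. ennreal (out_density y)))"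
  then have F[measurable]: "F \<in> borel_measurable B"
    by (simp cong: measurable_cong_sets add: sets_\<nu>)
  have "(\<integral>\<^sup>+z. F z \<partial>(P \<bind> K)) = (\<integral>\<^sup>+x. \<integral>\<^sup>+y. F y \<partial>K x \<partial>P)"
    by (rule nn_integral_bind_prob[OF P K F])
  also have "\<dots> = (\<integral>\<^sup>+x. \<integral>\<^sup>+y. ennreal (g (x, y)) * F y \<partial>\<nu> \<partial>P)"
    by (intro nn_integral_cong, subst K_eq) (auto simp: space_P intro!: nn_integral_density)
  also have "\<dots> = (\<integral>\<^sup>+y. \<integral>\<^sup>+x. ennreal (g (x, y)) * F y \<partial>P \<partial>\<nu>)"
    by (rule PN.Fubini'[symmetric]) simp
  also have "\<dots> = (\<integral>\<^sup>+y. ennreal (out_density y) * F y \<partial>\<nu>)"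
    by (intro nn_integral_cong, subst nn_integral_multc) (auto simp: space_\<nu> ennreal_out_density)
  also have "\<dots> = (\<integral>\<^sup>+z. F z \<partial>density \<nu> (\<lambda>y. ennreal (out_density y)))"
    by (subst nn_integral_density) auto
  finally show "(\<integral>\<^sup>+z. F z \<partial>(P \<bind> K)) = (\<integral>\<^sup>+z. F z \<partial>density \<nu> (\<lambda>y. ennreal (out_density y)))" .
qed

lemma distr_joint_law_fst: "distr (joint_law A B P K) A fst = P"
proof (rule measure_eqI_nn_integral)
  note J = joint_law_in_prob_algebra[OF P K]
  have m: "fst \<in> joint_law A B P K \<rightarrow>\<^sub>M A"
    using J by (simp add: space_prob_algebra cong: measurable_cong_sets)
  fix F :: "_ \<Rightarrow> ennreal" assume "F \<in> borel_measurable P"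
  then have F[measurable]: "F \<in> borel_measurable A" by (simp cong: measurable_cong_sets add: sets_P)
  have "(\<integral>\<^sup>+x. F x \<partial>distr (joint_law A B P K) A fst) = (\<integral>\<^sup>+x. \<integral>\<^sup>+y. F x \<partial>K x \<partial>P)"
    using nn_integral_joint_law[OF P K, of "\<lambda>z. F (fst z)"] m by (simp add: nn_integral_distr)
  also have "\<dots> = (\<integral>\<^sup>+x. F x \<partial>P)"
    using measurable_space[OF K]
    by (intro nn_integral_cong) (auto simp: space_P space_prob_algebra prob_space.emeasure_space_1)
  finally show "(\<integral>\<^sup>+x. F x \<partial>distr (joint_law A B P K) A fst) = (\<integral>\<^sup>+x. F x \<partial>P)" .
qed (simp add: sets_P)

lemma distr_joint_law_snd: "distr (joint_law A B P K) B snd = P \<bind> K"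
proof (rule measure_eqI_nn_integral)
  note J = joint_law_in_prob_algebra[OF P K]
  have m: "snd \<in> joint_law A B P K \<rightarrow>\<^sub>M B"
    using J by (simp add: space_prob_algebra cong: measurable_cong_sets)
  show s: "sets (distr (joint_law A B P K) B snd) = sets (P \<bind> K)"
    using sets_bind'[OF P K] by simp
  fix F :: "_ \<Rightarrow> ennreal" assume "F \<in> borel_measurable (P \<bind> K)"
  then have F[measurable]: "F \<in> borel_measurable B" using s by (simp cong: measurable_cong_sets)
  show "(\<integral>\<^sup>+x. F x \<partial>distr (joint_law A B P K) B snd) = (\<integral>\<^sup>+x. F x \<partial>(P \<bind> K))"
    using nn_integral_joint_law[OF P K, of "\<lambda>z. F (snd z)"] m nn_integral_bind_prob[OF P K F]
    by (simp add: nn_integral_distr)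
qed

text \<open>Relative to the product of \<open>P\<close> and \<open>\<nu>\<close>, the joint law has
  density \<open>g\<close> and the product of its marginals has density \<open>out_density\<close>
  of the output. The equation needs no integrability, both sides being 0 otherwise. Since the
  reference measure does not involve \<open>K\<close>, this is the form that yields measurability in
  the channel matrices.\<close>

lemma io_information_eq:
  "io_information A B P K = (\<integral>z. g z * log 2 (g z / out_density (snd z)) \<partial>(P \<Otimes>\<^sub>M \<nu>))"
proof -
  interpret \<nu>: sigma_finite_measure \<nu> by (rule sigma_finite)
  interpret P: prob_space P by (rule prob_space_P)
  interpret PN: pair_sigma_finite P \<nu> ..
  interpret J: prob_space "joint_law A B P K"
    using joint_law_in_prob_algebra[OF P K] by (simp add: space_prob_algebra)
  have sJ: "sets (joint_law A B P K) = sets (A \<Otimes>\<^sub>M B)"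
    using joint_law_in_prob_algebra[OF P K] by (simp add: space_prob_algebra)
  note [measurable_cong] = sets_P sets_\<nu>
  note [measurable] = g out_density_measurable
  have "P \<bind> K \<in> space (prob_algebra B)"
    using prob_space_bind'[OF P K] sets_bind'[OF P K] by (simp add: space_prob_algebra)
  then interpret N: prob_space "density \<nu> (\<lambda>y. ennreal (out_density y))"
    by (simp add: space_prob_algebra bind_eq_density)
  have sp: "space (P \<Otimes>\<^sub>M \<nu>) = space A \<times> space B"
    by (simp add: space_pair_measure space_P space_\<nu>)
  have "P \<Otimes>\<^sub>M density \<nu> (\<lambda>y. ennreal (out_density y))
      = density P (\<lambda>_. 1) \<Otimes>\<^sub>M density \<nu> (\<lambda>y. ennreal (out_density y))"
    by (simp add: density_1)
  also have "\<dots> = density (P \<Otimes>\<^sub>M \<nu>) (\<lambda>z. ennreal (out_density (snd z)))"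
    by (subst pair_measure_density) (auto intro: \<nu>.sigma_finite_measure_axioms N.sigma_finite_measure_axioms
        simp: case_prod_beta')
  finally have prod: "P \<Otimes>\<^sub>M density \<nu> (\<lambda>y. ennreal (out_density y))
      = density (P \<Otimes>\<^sub>M \<nu>) (\<lambda>z. ennreal (out_density (snd z)))" .
  have "io_information A B P K
      = KL_divergence 2 (P \<Otimes>\<^sub>M (P \<bind> K)) (distr (joint_law A B P K) (A \<Otimes>\<^sub>M B) (\<lambda>z. (fst z, snd z)))"
    unfolding io_information_def J.mutual_information_def distr_joint_law_fst distr_joint_law_snd ..
  also have "distr (joint_law A B P K) (A \<Otimes>\<^sub>M B) (\<lambda>z. (fst z, snd z)) = joint_law A B P K"
    using sJ by (simp add: distr_id2)
  also have "KL_divergence 2 (P \<Otimes>\<^sub>M (P \<bind> K)) (joint_law A B P K)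
     = KL_divergence 2 (density (P \<Otimes>\<^sub>M \<nu>) (\<lambda>z. ennreal (out_density (snd z))))
         (density (P \<Otimes>\<^sub>M \<nu>) (\<lambda>z. ennreal (g z)))"
    by (simp only: bind_eq_density prod joint_law_eq_density)
  also have "\<dots> = (\<integral>z. g z * log 2 (g z / out_density (snd z)) \<partial>(P \<Otimes>\<^sub>M \<nu>))"
    using out_density_pos g_pos
    by (intro PN.KL_density_density AE_I2) (fastforce simp: sp less_imp_le)+
  finally show ?thesis .
qed

text \<open>Writes information as an expectation, the form in which two channels can be compared on
  one probability space.\<close>

lemma io_information_eq_joint_law:
  "io_information A B P K = (\<integral>z. log 2 (g z / out_density (snd z)) \<partial>joint_law A B P K)"
proof -
  note [measurable_cong] = sets_P sets_\<nu>
  note [measurable] = g out_density_measurable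
  have sp: "space (P \<Otimes>\<^sub>M \<nu>) = space A \<times> space B"
    by (simp add: space_pair_measure space_P space_\<nu>)
  show ?thesis
    unfolding io_information_eq joint_law_eq_density
    using g_pos by (subst integral_real_density) (auto simp: sp less_imp_le intro!: AE_I2)
qed

end

text \<open>Packages the use of \<open>ln u <= u - 1\<close>: \<open>u\<close> is a sum of
  \<open>k\<close> likelihood ratios, each of mean at most 1. Bounding the mean through the
  nonnegative integral also provides the integrability of \<open>u\<close>.\<close>

lemma (in prob_space) integral_nonpos_of_le_nn_integral:
  fixes h u :: "'a \<Rightarrow> real"
  assumes h: "integrable M h" and u[measurable]: "u \<in> borel_measurable M"
    and u0: "\<And>x. x \<in> space M \<Longrightarrow> 0 \<le> u x"
    and k: "0 \<le> k" "(\<integral>\<^sup>+x. ennreal (u x) \<partial>M) \<le> ennreal k"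
    and le: "\<And>x. x \<in> space M \<Longrightarrow> h x \<le> u x - k"
  shows "(\<integral>x. h x \<partial>M) \<le> 0"
proof -
  have iu: "integrable M u"
    using u0 k by (intro integrableI_nonneg) (auto intro: le_less_trans)
  have "ennreal (\<integral>x. u x \<partial>M) \<le> ennreal k"
    using k u0 by (subst nn_integral_eq_integral[OF iu, symmetric]) auto
  then have "(\<integral>x. u x \<partial>M) \<le> k" using k by (simp add: ennreal_le_iff)
  moreover have "(\<integral>x. h x \<partial>M) \<le> (\<integral>x. u x - k \<partial>M)"
    using h iu le by (intro integral_mono) auto
  ultimately show ?thesis using iu by (simp add: prob_space)
qed

text \<open>With \<open>g/f\<close> and \<open>w/F\<close> the end-to-end and the single-hop information densities and \<open>q\<close> an
  arbitrary sub-density on the hop output, \<open>ln (g/f) - ln (w/q) = ln (g/f \<cdot> F/w) + ln (q/F)\<close>. Both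
  arguments on the right have mean at most \<open>1\<close>, so \<open>ln u \<le> u - 1\<close> yields data processing and
  suboptimality of \<open>q\<close> in one step.\<close>

lemma io_information_chain_le:
  assumes \<kappa>: "\<kappa> \<in> A \<rightarrow>\<^sub>M prob_algebra X"
    and W: "positive_density_kernel X Y (S \<bind> \<kappa>) W \<mu> w c"
    and V: "V \<in> Y \<rightarrow>\<^sub>M prob_algebra Z"
    and K: "positive_density_kernel A Z S K \<nu> g c'"
    and K_eq: "\<And>x. x \<in> space A \<Longrightarrow> K x = \<kappa> x \<bind> W \<bind> V"
    and q: "q \<in> borel_measurable Y" "\<And>y. y \<in> space Y \<Longrightarrow> 0 < q y"
      "(\<integral>\<^sup>+y. ennreal (q y) \<partial>\<mu>) \<le> 1"
    and int: "integrable (joint_law X Y (S \<bind> \<kappa>) W) (\<lambda>z. log 2 (w z / q (snd z)))"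
  shows "io_information A Z S K \<le> (\<integral>z. log 2 (w z / q (snd z)) \<partial>joint_law X Y (S \<bind> \<kappa>) W)"
proof -
  define Q where "Q = S \<bind> \<kappa>"
  interpret W: positive_density_kernel X Y Q W \<mu> w c using W by (simp add: Q_def)
  interpret K: positive_density_kernel A Z S K \<nu> g c' by (rule K)
  define f where "f = K.out_density"
  define F where "F = W.out_density"
  have f_pos: "\<And>z. z \<in> space Z \<Longrightarrow> 0 < f z" and F_pos: "\<And>y. y \<in> space Y \<Longrightarrow> 0 < F y"
    unfolding f_def F_def by (rule K.out_density_pos W.out_density_pos; assumption)+
  have f_meas[measurable]: "f \<in> borel_measurable Z" and F_meas[measurable]: "F \<in> borel_measurable Y"
    unfolding f_def F_def by (rule K.out_density_measurable W.out_density_measurable)+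
  note [measurable] = \<kappa> V q(1) W.g K.g W.K
  have S: "S \<in> space (prob_algebra A)" and Q: "Q \<in> space (prob_algebra X)"
    by (rule K.P, rule W.P)
  have spS: "space S = space A" and spQ: "space Q = space X" by (rule K.space_P, rule W.space_P)
  interpret Q: prob_space Q by (rule W.prob_space_P)
  interpret S: prob_space S by (rule K.prob_space_P)
  \<comment> \<open>\<open>J3\<close> is the law of the whole chain of source block, hop input, hop
    output and destination block. Its images under \<open>?\<pi>1\<close> (the two ends) and
    \<open>?\<pi>2\<close> (the two sides of the hop) are the two joint laws to be compared.\<close>
  define J1 where "J1 = joint_law A X S \<kappa>"
  define J2 where "J2 = joint_law (A \<Otimes>\<^sub>M X) Y J1 (\<lambda>p. W (snd p))"
  define J3 where "J3 = joint_law ((A \<Otimes>\<^sub>M X) \<Otimes>\<^sub>M Y) Z J2 (\<lambda>p. V (snd p))"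
  have J1: "J1 \<in> space (prob_algebra (A \<Otimes>\<^sub>M X))"
    unfolding J1_def by (rule joint_law_in_prob_algebra[OF S \<kappa>])
  have J2: "J2 \<in> space (prob_algebra ((A \<Otimes>\<^sub>M X) \<Otimes>\<^sub>M Y))"
    unfolding J2_def by (rule joint_law_in_prob_algebra[OF J1]) measurable
  have J3: "J3 \<in> space (prob_algebra (((A \<Otimes>\<^sub>M X) \<Otimes>\<^sub>M Y) \<Otimes>\<^sub>M Z))"
    unfolding J3_def by (rule joint_law_in_prob_algebra[OF J2]) measurable
  have sJ3[measurable_cong]: "sets J3 = sets (((A \<Otimes>\<^sub>M X) \<Otimes>\<^sub>M Y) \<Otimes>\<^sub>M Z)"
    using J3 by (simp add: space_prob_algebra)
  have spJ3: "space J3 = ((space A \<times> space X) \<times> space Y) \<times> space Z"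
    using sets_eq_imp_space_eq[OF sJ3] by (simp add: space_pair_measure)
  interpret J3: prob_space J3 using J3 by (simp add: space_prob_algebra)
  have nnJ3: "(\<integral>\<^sup>+p. H p \<partial>J3) = (\<integral>\<^sup>+x0. \<integral>\<^sup>+x. \<integral>\<^sup>+y. \<integral>\<^sup>+z. H (((x0, x), y), z) \<partial>V y \<partial>W x \<partial>\<kappa> x0 \<partial>S)"
    if [measurable]: "H \<in> borel_measurable (((A \<Otimes>\<^sub>M X) \<Otimes>\<^sub>M Y) \<Otimes>\<^sub>M Z)" for H
  proof -
    have V': "(\<lambda>p. V (snd p)) \<in> ((A \<Otimes>\<^sub>M X) \<Otimes>\<^sub>M Y) \<rightarrow>\<^sub>M subprob_algebra Z"
      by (rule measurable_prob_algebraD) measurable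
    have W': "(\<lambda>p. W (snd p)) \<in> A \<Otimes>\<^sub>M X \<rightarrow>\<^sub>M subprob_algebra Y"
      by (rule measurable_prob_algebraD) measurable
    have m1: "(\<lambda>p. \<integral>\<^sup>+z. H (p, z) \<partial>V (snd p)) \<in> borel_measurable ((A \<Otimes>\<^sub>M X) \<Otimes>\<^sub>M Y)"
      by (rule nn_integral_measurable_subprob_algebra2[OF _ V']) simp
    have m2: "(\<lambda>p. \<integral>\<^sup>+y. \<integral>\<^sup>+z. H ((p, y), z) \<partial>V y \<partial>W (snd p)) \<in> borel_measurable (A \<Otimes>\<^sub>M X)"
      by (rule nn_integral_measurable_subprob_algebra2[OF _ W'])
        (use m1 in \<open>simp add: case_prod_beta'\<close>)
    have "(\<integral>\<^sup>+p. H p \<partial>J3) = (\<integral>\<^sup>+p. \<integral>\<^sup>+z. H (p, z) \<partial>V (snd p) \<partial>J2)"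
      unfolding J3_def by (rule nn_integral_joint_law[OF J2]) measurable
    also have "\<dots> = (\<integral>\<^sup>+p. \<integral>\<^sup>+y. \<integral>\<^sup>+z. H ((p, y), z) \<partial>V y \<partial>W (snd p) \<partial>J1)"
      unfolding J2_def by (subst nn_integral_joint_law[OF J1 _ m1]) simp_all
    also have "\<dots> = (\<integral>\<^sup>+x0. \<integral>\<^sup>+x. \<integral>\<^sup>+y. \<integral>\<^sup>+z. H (((x0, x), y), z) \<partial>V y \<partial>W x \<partial>\<kappa> x0 \<partial>S)"
      unfolding J1_def by (subst nn_integral_joint_law[OF S _ m2]) simp_all
    finally show ?thesis .
  qed
  have V1: "(\<integral>\<^sup>+z. C \<partial>V y) = C" if "y \<in> space Y" for y C
    using measurable_space[OF V that] by (simp add: space_prob_algebra prob_space.emeasure_space_1)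
  have \<kappa>_in: "\<kappa> x \<in> space (prob_algebra X)" if "x \<in> space A" for x
    using measurable_space[OF \<kappa> that] .
  have \<kappa>1: "(\<integral>\<^sup>+z. C \<partial>\<kappa> x) = C" and sp\<kappa>: "space (\<kappa> x) = space X" if "x \<in> space A" for x C
    using \<kappa>_in[OF that] by (auto simp: space_prob_algebra prob_space.emeasure_space_1 dest: sets_eq_imp_space_eq)
  have W_in: "W x \<in> space (prob_algebra Y)" if "x \<in> space X" for x
    using measurable_space[OF W.K that] .
  have spW: "space (W x) = space Y" if "x \<in> space X" for x
    using W_in[OF that] by (auto simp: space_prob_algebra dest: sets_eq_imp_space_eq)
  have nnW: "(\<integral>\<^sup>+y. H y \<partial>W x) = (\<integral>\<^sup>+y. ennreal (w (x, y)) * H y \<partial>\<mu>)"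
    if "x \<in> space X" "H \<in> borel_measurable Y" for x H
  proof -
    note [measurable_cong] = W.sets_\<nu>
    show ?thesis using that by (subst W.K_eq) (auto intro!: nn_integral_density)
  qed
  have Vmeas: "(\<lambda>y. \<integral>\<^sup>+z. H z \<partial>V y) \<in> borel_measurable Y" if "H \<in> borel_measurable Z" for H
    using nn_integral_measurable_subprob_algebra2[OF _ measurable_prob_algebraD[OF V], of "\<lambda>_. H"] that by simp

  let ?\<pi>1 = "\<lambda>p. (fst (fst (fst p)), snd p)" and ?\<pi>2 = "\<lambda>p. (snd (fst (fst p)), snd (fst p))"
  have \<pi>1: "distr J3 (A \<Otimes>\<^sub>M Z) ?\<pi>1 = joint_law A Z S K"
  proof (rule measure_eqI_nn_integral)
    show "sets (distr J3 (A \<Otimes>\<^sub>M Z) ?\<pi>1) = sets (joint_law A Z S K)"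
      using joint_law_in_prob_algebra[OF K.P K.K] by (simp add: space_prob_algebra)
    fix H :: "_ \<Rightarrow> ennreal" assume "H \<in> borel_measurable (joint_law A Z S K)"
    then have H[measurable]: "H \<in> borel_measurable (A \<Otimes>\<^sub>M Z)"
      using joint_law_in_prob_algebra[OF K.P K.K] by (simp add: space_prob_algebra cong: measurable_cong_sets)
    have "(\<integral>\<^sup>+p. H p \<partial>distr J3 (A \<Otimes>\<^sub>M Z) ?\<pi>1) = (\<integral>\<^sup>+p. H (?\<pi>1 p) \<partial>J3)"
      by (rule nn_integral_distr) measurable
    also have "\<dots> = (\<integral>\<^sup>+x0. \<integral>\<^sup>+x. \<integral>\<^sup>+y. \<integral>\<^sup>+z. H (x0, z) \<partial>V y \<partial>W x \<partial>\<kappa> x0 \<partial>S)"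
      by (subst nnJ3) simp_all
    also have "\<dots> = (\<integral>\<^sup>+x0. \<integral>\<^sup>+z. H (x0, z) \<partial>K x0 \<partial>S)"
    proof (rule nn_integral_cong)
      fix x0 assume "x0 \<in> space S"
      then have x0: "x0 \<in> space A" by (simp add: spS)
      have Hx: "(\<lambda>z. H (x0, z)) \<in> borel_measurable Z" using x0 by measurable
      have "\<kappa> x0 \<bind> W \<in> space (prob_algebra Y)"
        using prob_space_bind'[OF \<kappa>_in[OF x0] W.K] sets_bind'[OF \<kappa>_in[OF x0] W.K] by (simp add: space_prob_algebra)
      then show "(\<integral>\<^sup>+x. \<integral>\<^sup>+y. \<integral>\<^sup>+z. H (x0, z) \<partial>V y \<partial>W x \<partial>\<kappa> x0) = (\<integral>\<^sup>+z. H (x0, z) \<partial>K x0)"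
        unfolding K_eq[OF x0]
        by (simp add: nn_integral_bind_prob[OF _ V Hx] nn_integral_bind_prob[OF \<kappa>_in[OF x0] W.K Vmeas[OF Hx]])
    qed
    also have "\<dots> = (\<integral>\<^sup>+p. H p \<partial>joint_law A Z S K)"
      by (rule nn_integral_joint_law[OF K.P K.K H, symmetric])
    finally show "(\<integral>\<^sup>+p. H p \<partial>distr J3 (A \<Otimes>\<^sub>M Z) ?\<pi>1) = (\<integral>\<^sup>+p. H p \<partial>joint_law A Z S K)" .
  qed
  have \<pi>2: "distr J3 (X \<Otimes>\<^sub>M Y) ?\<pi>2 = joint_law X Y Q W"
  proof (rule measure_eqI_nn_integral)
    show "sets (distr J3 (X \<Otimes>\<^sub>M Y) ?\<pi>2) = sets (joint_law X Y Q W)"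
      using joint_law_in_prob_algebra[OF W.P W.K] by (simp add: space_prob_algebra)
    fix H :: "_ \<Rightarrow> ennreal" assume "H \<in> borel_measurable (joint_law X Y Q W)"
    then have H[measurable]: "H \<in> borel_measurable (X \<Otimes>\<^sub>M Y)"
      using joint_law_in_prob_algebra[OF W.P W.K] by (simp add: space_prob_algebra cong: measurable_cong_sets)
    have H': "(\<lambda>x. \<integral>\<^sup>+y. H (x, y) \<partial>W x) \<in> borel_measurable X"
      by (rule nn_integral_measurable_subprob_algebra2[OF _ measurable_prob_algebraD[OF W.K]]) simp
    have "(\<integral>\<^sup>+p. H p \<partial>distr J3 (X \<Otimes>\<^sub>M Y) ?\<pi>2) = (\<integral>\<^sup>+p. H (?\<pi>2 p) \<partial>J3)"
      by (rule nn_integral_distr) measurable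
    also have "\<dots> = (\<integral>\<^sup>+x0. \<integral>\<^sup>+x. \<integral>\<^sup>+y. \<integral>\<^sup>+z. H (x, y) \<partial>V y \<partial>W x \<partial>\<kappa> x0 \<partial>S)"
      by (subst nnJ3) simp_all
    also have "\<dots> = (\<integral>\<^sup>+x0. \<integral>\<^sup>+x. \<integral>\<^sup>+y. H (x, y) \<partial>W x \<partial>\<kappa> x0 \<partial>S)"
      using V1 by (intro nn_integral_cong) (simp add: spS sp\<kappa> spW)
    also have "\<dots> = (\<integral>\<^sup>+p. H p \<partial>joint_law X Y Q W)"
      unfolding nn_integral_joint_law[OF W.P W.K H]
      by (simp add: Q_def nn_integral_bind_prob[OF S \<kappa> H'])
    finally show "(\<integral>\<^sup>+p. H p \<partial>distr J3 (X \<Otimes>\<^sub>M Y) ?\<pi>2) = (\<integral>\<^sup>+p. H p \<partial>joint_law X Y Q W)" .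
  qed

  define a where "a p = log 2 (g (?\<pi>1 p) / f (snd p))" for p :: "(('a \<times> 'b) \<times> 'c) \<times> 'd"
  define b where "b p = log 2 (w (?\<pi>2 p) / q (snd (fst p)))" for p :: "(('a \<times> 'b) \<times> 'c) \<times> 'd"
  define u1 where "u1 p = g (?\<pi>1 p) / f (snd p) * (F (snd (fst p)) / w (?\<pi>2 p))" for p :: "(('a \<times> 'b) \<times> 'c) \<times> 'd"
  define u2 where "u2 p = q (snd (fst p)) / F (snd (fst p))" for p :: "(('a \<times> 'b) \<times> 'c) \<times> 'd"
  have m1: "?\<pi>1 \<in> J3 \<rightarrow>\<^sub>M A \<Otimes>\<^sub>M Z" and m2: "?\<pi>2 \<in> J3 \<rightarrow>\<^sub>M X \<Otimes>\<^sub>M Y" by measurable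
  have lhs: "io_information A Z S K = (\<integral>p. a p \<partial>J3)"
    unfolding K.io_information_eq_joint_law \<pi>1[symmetric] f_def[symmetric]
    by (subst integral_distr[OF m1]) (auto simp: a_def[abs_def])
  have rhs: "(\<integral>z. log 2 (w z / q (snd z)) \<partial>joint_law X Y Q W) = (\<integral>p. b p \<partial>J3)"
    unfolding \<pi>2[symmetric] by (subst integral_distr[OF m2]) (auto simp: b_def[abs_def])
  have int_b: "integrable J3 b"
    using int unfolding Q_def[symmetric] \<pi>2[symmetric]
    by (subst (asm) integrable_distr_eq[OF m2]) (auto simp: b_def[abs_def])

  \<comment> \<open>Integration against \<open>W x\<close> cancels \<open>w\<close> and leaves
    \<open>F\<close>, the output density of the hop, so the hop output no longer depends on
    \<open>x\<close>. The destination block then has law \<open>\<zeta>\<close> independently of the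
    source, and averaging \<open>g (x0, z)\<close> over \<open>x0\<close> gives exactly
    \<open>f z\<close>.\<close>
  have u1: "(\<integral>\<^sup>+p. ennreal (u1 p) \<partial>J3) \<le> 1"
  proof -
    define \<zeta> where "\<zeta> = Q \<bind> W \<bind> V"
    have QW: "Q \<bind> W \<in> space (prob_algebra Y)"
      using prob_space_bind'[OF Q W.K] sets_bind'[OF Q W.K] by (simp add: space_prob_algebra)
    have \<zeta>: "\<zeta> \<in> space (prob_algebra Z)"
      using prob_space_bind'[OF QW V] sets_bind'[OF QW V] by (simp add: space_prob_algebra \<zeta>_def)
    then have [measurable_cong]: "sets \<zeta> = sets Z" and sp\<zeta>: "space \<zeta> = space Z"
      by (auto simp: space_prob_algebra dest: sets_eq_imp_space_eq)
    interpret \<zeta>: prob_space \<zeta> using \<zeta> by (simp add: space_prob_algebra)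
    interpret S\<zeta>: pair_sigma_finite S \<zeta> ..
    note [measurable_cong] = K.sets_P
    have "(\<integral>\<^sup>+p. ennreal (u1 p) \<partial>J3)
      = (\<integral>\<^sup>+x0. \<integral>\<^sup>+x. \<integral>\<^sup>+y. \<integral>\<^sup>+z. ennreal (g (x0, z) / f z * (F y / w (x, y))) \<partial>V y \<partial>W x \<partial>\<kappa> x0 \<partial>S)"
      by (subst nnJ3) (simp_all add: u1_def[abs_def])
    also have "\<dots> = (\<integral>\<^sup>+x0. \<integral>\<^sup>+z. ennreal (g (x0, z) / f z) \<partial>\<zeta> \<partial>S)"
    proof (rule nn_integral_cong)
      fix x0 assume "x0 \<in> space S"
      then have x0: "x0 \<in> space A" by (simp add: spS)
      define G where "G = (\<lambda>y. \<integral>\<^sup>+z. ennreal (g (x0, z) / f z) \<partial>V y)"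
      have gx[measurable]: "(\<lambda>z. ennreal (g (x0, z) / f z)) \<in> borel_measurable Z" using x0 by measurable
      have G[measurable]: "G \<in> borel_measurable Y" unfolding G_def by (rule Vmeas[OF gx])
      have "(\<integral>\<^sup>+x. \<integral>\<^sup>+y. \<integral>\<^sup>+z. ennreal (g (x0, z) / f z * (F y / w (x, y))) \<partial>V y \<partial>W x \<partial>\<kappa> x0)
        = (\<integral>\<^sup>+x. (\<integral>\<^sup>+y. ennreal (F y) * G y \<partial>\<mu>) \<partial>\<kappa> x0)"
      proof (rule nn_integral_cong)
        fix x assume "x \<in> space (\<kappa> x0)"
        then have x: "x \<in> space X" by (simp add: sp\<kappa>[OF x0])
        have wx[measurable]: "(\<lambda>y. w (x, y)) \<in> borel_measurable Y" using x by measurable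
        have "(\<integral>\<^sup>+y. \<integral>\<^sup>+z. ennreal (g (x0, z) / f z * (F y / w (x, y))) \<partial>V y \<partial>W x)
          = (\<integral>\<^sup>+y. G y * ennreal (F y / w (x, y)) \<partial>W x)"
        proof (rule nn_integral_cong)
          fix y assume "y \<in> space (W x)"
          then have y: "y \<in> space Y" by (simp add: spW[OF x])
          have nn: "0 \<le> F y / w (x, y)" using F_pos[OF y] W.g_pos[OF x y] by simp
          have sV: "sets (V y) = sets Z" using measurable_space[OF V y] by (simp add: space_prob_algebra)
          have "(\<integral>\<^sup>+z. ennreal (g (x0, z) / f z * (F y / w (x, y))) \<partial>V y)
            = (\<integral>\<^sup>+z. ennreal (g (x0, z) / f z) * ennreal (F y / w (x, y)) \<partial>V y)"
            using nn by (intro nn_integral_cong) (simp only: ennreal_mult'')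
          also have "\<dots> = G y * ennreal (F y / w (x, y))"
            unfolding G_def using gx sV by (intro nn_integral_multc) (simp cong: measurable_cong_sets)
          finally show "(\<integral>\<^sup>+z. ennreal (g (x0, z) / f z * (F y / w (x, y))) \<partial>V y) = G y * ennreal (F y / w (x, y))" .
        qed
        also have "\<dots> = (\<integral>\<^sup>+y. ennreal (w (x, y)) * (G y * ennreal (F y / w (x, y))) \<partial>\<mu>)"
          by (rule nnW[OF x]) measurable
        also have "\<dots> = (\<integral>\<^sup>+y. ennreal (F y) * G y \<partial>\<mu>)"
        proof (rule nn_integral_cong)
          fix y assume "y \<in> space \<mu>"
          then have y: "y \<in> space Y" by (simp add: W.space_\<nu>)
          have "ennreal (w (x, y)) * ennreal (F y / w (x, y)) = ennreal (F y)"
            using F_pos[OF y] W.g_pos[OF x y] by (simp flip: ennreal_mult')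
          then show "ennreal (w (x, y)) * (G y * ennreal (F y / w (x, y))) = ennreal (F y) * G y"
            by (simp add: ac_simps)
        qed
        finally show "(\<integral>\<^sup>+y. \<integral>\<^sup>+z. ennreal (g (x0, z) / f z * (F y / w (x, y))) \<partial>V y \<partial>W x)
          = (\<integral>\<^sup>+y. ennreal (F y) * G y \<partial>\<mu>)" .
      qed
      also have "\<dots> = (\<integral>\<^sup>+y. ennreal (F y) * G y \<partial>\<mu>)" by (rule \<kappa>1[OF x0])
      also have "\<dots> = (\<integral>\<^sup>+y. G y \<partial>(Q \<bind> W))"
      proof -
        note [measurable_cong] = W.sets_\<nu>
        show ?thesis unfolding W.bind_eq_density F_def[symmetric]
          by (rule nn_integral_density[symmetric]) measurable
      qed
      also have "\<dots> = (\<integral>\<^sup>+z. ennreal (g (x0, z) / f z) \<partial>\<zeta>)"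
        unfolding \<zeta>_def G_def by (rule nn_integral_bind_prob[OF QW V gx, symmetric])
      finally show "(\<integral>\<^sup>+x. \<integral>\<^sup>+y. \<integral>\<^sup>+z. ennreal (g (x0, z) / f z * (F y / w (x, y))) \<partial>V y \<partial>W x \<partial>\<kappa> x0)
        = (\<integral>\<^sup>+z. ennreal (g (x0, z) / f z) \<partial>\<zeta>)" .
    qed
    also have "\<dots> = (\<integral>\<^sup>+z. \<integral>\<^sup>+x0. ennreal (g (x0, z) / f z) \<partial>S \<partial>\<zeta>)"
      by (rule S\<zeta>.Fubini'[symmetric]) simp
    also have "\<dots> = (\<integral>\<^sup>+z. 1 \<partial>\<zeta>)"
    proof (rule nn_integral_cong)
      fix z assume "z \<in> space \<zeta>"
      then have z: "z \<in> space Z" by (simp add: sp\<zeta>)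
      have gz: "(\<lambda>x0. g (x0, z)) \<in> borel_measurable S" using z by measurable
      have "(\<integral>\<^sup>+x0. ennreal (g (x0, z) / f z) \<partial>S) = (\<integral>\<^sup>+x0. ennreal (g (x0, z)) / ennreal (f z) \<partial>S)"
        using f_pos[OF z] K.g_pos[OF _ z]
        by (intro nn_integral_cong) (simp add: divide_ennreal spS less_imp_le)
      also have "\<dots> = (\<integral>\<^sup>+x0. ennreal (g (x0, z)) \<partial>S) / ennreal (f z)"
        using gz by (intro nn_integral_divide) simp
      also have "\<dots> = ennreal (f z) / ennreal (f z)"
        unfolding f_def K.ennreal_out_density[OF z] ..
      also have "\<dots> = 1" using f_pos[OF z] by (simp add: ennreal_divide_self)
      finally show "(\<integral>\<^sup>+x0. ennreal (g (x0, z) / f z) \<partial>S) = 1" .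
    qed
    also have "\<dots> = 1" by (simp add: \<zeta>.emeasure_space_1)
    finally show ?thesis by simp
  qed

  \<comment> \<open>The hop output has density \<open>F\<close> with respect to
    \<open>\<mu>\<close>, so the mean of \<open>q / F\<close> is the total mass of
    \<open>q\<close>.\<close>
  have u2: "(\<integral>\<^sup>+p. ennreal (u2 p) \<partial>J3) \<le> 1"
  proof -
    note [measurable_cong] = W.sets_\<nu>
    have "(\<integral>\<^sup>+p. ennreal (u2 p) \<partial>J3) = (\<integral>\<^sup>+z. ennreal (q (snd z) / F (snd z)) \<partial>joint_law X Y Q W)"
      unfolding \<pi>2[symmetric] by (subst nn_integral_distr[OF m2]) (simp_all add: u2_def)
    also have "\<dots> = (\<integral>\<^sup>+x. \<integral>\<^sup>+y. ennreal (q y / F y) \<partial>W x \<partial>Q)"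
      by (subst nn_integral_joint_law[OF Q W.K]) simp_all
    also have "\<dots> = (\<integral>\<^sup>+y. ennreal (q y / F y) \<partial>(Q \<bind> W))"
      by (rule nn_integral_bind_prob[OF Q W.K, symmetric]) measurable
    also have "\<dots> = (\<integral>\<^sup>+y. ennreal (F y) * ennreal (q y / F y) \<partial>\<mu>)"
      unfolding W.bind_eq_density F_def[symmetric] by (rule nn_integral_density) measurable
    also have "\<dots> = (\<integral>\<^sup>+y. ennreal (q y) \<partial>\<mu>)"
    proof (rule nn_integral_cong)
      fix y assume "y \<in> space \<mu>"
      then have y: "y \<in> space Y" by (simp add: W.space_\<nu>)
      show "ennreal (F y) * ennreal (q y / F y) = ennreal (q y)"
        using F_pos[OF y] by (simp flip: ennreal_mult')
    qed
    finally show ?thesis using q(3) by simp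
  qed

  \<comment> \<open>Prepares the case where the end-to-end information density is not integrable.
    Through \<open>ln u <= u - 1\<close> this bound makes the mean of \<open>log 2 (w / q)\<close>
    nonnegative.\<close>
  have "(\<integral>\<^sup>+z. ennreal (q (snd z) / w z) \<partial>joint_law X Y Q W) \<le> 1"
  proof -
    note [measurable_cong] = W.sets_\<nu>
    have "(\<integral>\<^sup>+z. ennreal (q (snd z) / w z) \<partial>joint_law X Y Q W)
      = (\<integral>\<^sup>+x. \<integral>\<^sup>+y. ennreal (q y / w (x, y)) \<partial>W x \<partial>Q)"
      by (subst nn_integral_joint_law[OF Q W.K]) simp_all
    also have "\<dots> = (\<integral>\<^sup>+x. \<integral>\<^sup>+y. ennreal (q y) \<partial>\<mu> \<partial>Q)"
    proof (rule nn_integral_cong)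
      fix x assume "x \<in> space Q"
      then have x: "x \<in> space X" by (simp add: spQ)
      have wx[measurable]: "(\<lambda>y. w (x, y)) \<in> borel_measurable Y" using x by measurable
      have "(\<integral>\<^sup>+y. ennreal (q y / w (x, y)) \<partial>W x)
        = (\<integral>\<^sup>+y. ennreal (w (x, y)) * ennreal (q y / w (x, y)) \<partial>\<mu>)"
        by (rule nnW[OF x]) measurable
      also have "\<dots> = (\<integral>\<^sup>+y. ennreal (q y) \<partial>\<mu>)"
      proof (rule nn_integral_cong)
        fix y assume "y \<in> space \<mu>"
        then have y: "y \<in> space Y" by (simp add: W.space_\<nu>)
        show "ennreal (w (x, y)) * ennreal (q y / w (x, y)) = ennreal (q y)"
          using W.g_pos[OF x y] by (simp flip: ennreal_mult')
      qed
      finally show "(\<integral>\<^sup>+y. ennreal (q y / w (x, y)) \<partial>W x) = (\<integral>\<^sup>+y. ennreal (q y) \<partial>\<mu>)" .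
    qed
    also have "\<dots> \<le> 1" using q(3) by (simp add: Q.emeasure_space_1)
    finally show ?thesis .
  qed
  then have u3: "(\<integral>\<^sup>+p. ennreal (q (snd (fst p)) / w (?\<pi>2 p)) \<partial>J3) \<le> 1"
    unfolding \<pi>2[symmetric] by (subst (asm) nn_integral_distr[OF m2]) simp_all

  have pos: "0 < g (?\<pi>1 p)" "0 < f (snd p)" "0 < F (snd (fst p))" "0 < w (?\<pi>2 p)" "0 < q (snd (fst p))"
    if "p \<in> space J3" for p
    using that K.g_pos W.g_pos f_pos F_pos q(2) by (auto simp: spJ3)
  have "(\<integral>p. a p \<partial>J3) \<le> (\<integral>p. b p \<partial>J3)"
  proof (cases "integrable J3 a")
    case True
    have "(\<integral>p. ln 2 * (a p - b p) \<partial>J3) \<le> 0"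
    proof (rule J3.integral_nonpos_of_le_nn_integral[where u="\<lambda>p. u1 p + u2 p" and k=2])
      show "integrable J3 (\<lambda>p. ln 2 * (a p - b p))" using True int_b by auto
      show m: "(\<lambda>p. u1 p + u2 p) \<in> borel_measurable J3" unfolding u1_def u2_def by measurable
      have mm: "u1 \<in> borel_measurable J3" "u2 \<in> borel_measurable J3"
        unfolding u1_def[abs_def] u2_def[abs_def] by measurable
      have nn: "0 \<le> u1 p" "0 \<le> u2 p" if "p \<in> space J3" for p
        using pos[OF that] by (simp_all add: u1_def u2_def)
      then show "0 \<le> u1 p + u2 p" if "p \<in> space J3" for p using that by (simp add: add_nonneg_nonneg)
      have "(\<integral>\<^sup>+p. ennreal (u1 p + u2 p) \<partial>J3) = (\<integral>\<^sup>+p. ennreal (u1 p) + ennreal (u2 p) \<partial>J3)"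
        using nn by (intro nn_integral_cong) (simp add: ennreal_plus)
      also have "\<dots> = (\<integral>\<^sup>+p. ennreal (u1 p) \<partial>J3) + (\<integral>\<^sup>+p. ennreal (u2 p) \<partial>J3)"
        using mm by (intro nn_integral_add) auto
      also have "\<dots> \<le> 1 + 1" by (intro add_mono u1 u2)
      finally show "(\<integral>\<^sup>+p. ennreal (u1 p + u2 p) \<partial>J3) \<le> ennreal 2" by simp
      fix p assume p: "p \<in> space J3"
      have "ln 2 * (a p - b p) = ln (u1 p) + ln (u2 p)"
        unfolding right_diff_distrib
        using pos[OF p] by (simp add: a_def b_def u1_def u2_def log_def ln_div ln_mult)
      also have "\<dots> \<le> (u1 p - 1) + (u2 p - 1)"
        using pos[OF p] by (intro add_mono ln_le_minus_one) (simp_all add: u1_def u2_def)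
      finally show "ln 2 * (a p - b p) \<le> u1 p + u2 p - 2" by simp
    qed simp
    then show ?thesis using True int_b by (simp add: mult_le_0_iff)
  next
    case False \<comment> \<open>the information then has the junk value \<open>0\<close>\<close>
    have "(\<integral>p. ln 2 * (- b p) \<partial>J3) \<le> 0"
    proof (rule J3.integral_nonpos_of_le_nn_integral[where u="\<lambda>p. q (snd (fst p)) / w (?\<pi>2 p)" and k=1])
      show "integrable J3 (\<lambda>p. ln 2 * - b p)" using int_b by auto
      show "(\<lambda>p. q (snd (fst p)) / w (?\<pi>2 p)) \<in> borel_measurable J3" by measurable
      show "0 \<le> q (snd (fst p)) / w (?\<pi>2 p)" if "p \<in> space J3" for p using pos[OF that] by simp
      fix p assume p: "p \<in> space J3"
      have "ln 2 * - b p = ln (q (snd (fst p)) / w (?\<pi>2 p))"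
        using pos[OF p] by (simp add: b_def log_def ln_div)
      also have "\<dots> \<le> q (snd (fst p)) / w (?\<pi>2 p) - 1"
        using pos[OF p] by (intro ln_le_minus_one) simp
      finally show "ln 2 * - b p \<le> q (snd (fst p)) / w (?\<pi>2 p) - 1" .
    qed (use u3 in auto)
    then have "0 \<le> (\<integral>p. b p \<partial>J3)" by (simp add: zero_le_mult_iff)
    with False show ?thesis by (simp add: not_integrable_integral_eq)
  qed
  then show ?thesis by (simp add: lhs rhs flip: Q_def)
qed

section \<open>The Gaussian vector channel\<close>

lemma cmod_sq_eq_prod_exp:
  "exp (- (cmod z)\<^sup>2 / a) = (\<Prod>b\<in>Basis. exp (- (z \<bullet> b)\<^sup>2 / a))"
  by (simp add: Basis_complex_def cmod_power2 flip: exp_add) (simp add: add_divide_distrib diff_divide_distrib)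

lemma nn_integral_real_gaussian:
  "0 < a \<Longrightarrow> (\<integral>\<^sup>+x. ennreal (exp (- x\<^sup>2 / a)) \<partial>lborel) = ennreal (sqrt (pi * a))"
proof -
  assume a: "0 < a"
  define s where "s = sqrt (a / 2)"
  have s: "0 < s" "2 * pi * s\<^sup>2 = pi * a" "2 * s\<^sup>2 = a" using a by (simp_all add: s_def)
  have "(\<integral>\<^sup>+x. ennreal (exp (- x\<^sup>2 / a)) \<partial>lborel)
      = (\<integral>\<^sup>+x. ennreal (sqrt (pi * a)) * ennreal (normal_density 0 s x) \<partial>lborel)"
    using a by (intro nn_integral_cong) (simp add: normal_density_def s(2,3) flip: ennreal_mult')
  also have "\<dots> = ennreal (sqrt (pi * a)) * (\<integral>\<^sup>+x. ennreal (normal_density 0 s x) \<partial>lborel)"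
    by (intro nn_integral_cmult) simp
  also have "(\<integral>\<^sup>+x. ennreal (normal_density 0 s x) \<partial>lborel) = 1"
    using s by (subst nn_integral_eq_integral) simp_all
  finally show ?thesis by simp
qed

lemma nn_integral_complex_gaussian:
  "0 < a \<Longrightarrow> (\<integral>\<^sup>+z. ennreal (exp (- (cmod z)\<^sup>2 / a)) \<partial>lborel) = ennreal (pi * a)"
proof -
  assume a: "0 < a"
  have "(\<integral>\<^sup>+z. ennreal (exp (- (cmod z)\<^sup>2 / a)) \<partial>lborel)
      = (\<integral>\<^sup>+z. (\<Prod>b\<in>Basis. ennreal (exp (- (z \<bullet> b)\<^sup>2 / a))) \<partial>(lborel::complex measure))"
    by (intro nn_integral_cong) (simp only: cmod_sq_eq_prod_exp prod_ennreal[symmetric] exp_ge_zero)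
  also have "\<dots> = (\<Prod>b\<in>(Basis::complex set). (\<integral>\<^sup>+x. ennreal (exp (- x\<^sup>2 / a)) \<partial>lborel))"
    by (rule nn_integral_lborel_prod) simp_all
  also have "\<dots> = ennreal (sqrt (pi * a)) * ennreal (sqrt (pi * a))"
    unfolding nn_integral_real_gaussian[OF a] by (simp add: Basis_complex_def)
  also have "\<dots> = ennreal (pi * a)" using a by (simp flip: ennreal_mult')
  finally show ?thesis .
qed

lemma sets_complex_gaussian[measurable_cong, simp]: "sets complex_gaussian = sets borel"
  by (simp add: complex_gaussian_def)

lemma space_complex_gaussian[simp]: "space complex_gaussian = UNIV"
  by (simp add: complex_gaussian_def)

lemma prob_space_complex_gaussian: "prob_space complex_gaussian"
proof
  have "emeasure complex_gaussian (space complex_gaussian)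
      = (\<integral>\<^sup>+z. ennreal (exp (- (cmod z)\<^sup>2 / 1)) / ennreal pi \<partial>lborel)"
    unfolding complex_gaussian_def by (simp add: emeasure_density divide_ennreal)
  also have "\<dots> = (\<integral>\<^sup>+z. ennreal (exp (- (cmod z)\<^sup>2 / 1)) \<partial>lborel) / ennreal pi"
    by (intro nn_integral_divide) simp
  also have "\<dots> = 1" by (subst nn_integral_complex_gaussian) (simp_all add: ennreal_divide_self)
  finally show "emeasure complex_gaussian (space complex_gaussian) = 1" .
qed

lemma complex_gaussian_second_moment: "(\<integral>\<^sup>+z. ennreal ((cmod z)\<^sup>2) \<partial>complex_gaussian) < \<infinity>"
proof -
  \<comment> \<open>Half of the exponent absorbs the factor \<open>t\<close>. What remains is again
    a Gaussian integral, now with \<open>a = 2\<close>; only its finiteness matters.\<close>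
  have le: "t / pi * exp (- t) \<le> 2 * exp (- t / 2)" if "0 \<le> t" for t :: real
  proof -
    have "t \<le> 2 * exp (t / 2)" using exp_ge_add_one_self[of "t/2"] by linarith
    then have "t * exp (- t) \<le> 2 * exp (t / 2) * exp (- t)" by (intro mult_right_mono) auto
    also have "\<dots> = 2 * exp (- t / 2)" by (simp flip: exp_add)
    finally have "t * exp (- t) \<le> 2 * exp (- t / 2)" .
    moreover have "t / pi * exp (- t) \<le> t * exp (- t)"
      using that pi_gt3 mult_right_mono[of 1 pi t] by (intro mult_right_mono) (auto simp: field_simps)
    ultimately show ?thesis by linarith
  qed
  have "(\<integral>\<^sup>+z. ennreal ((cmod z)\<^sup>2) \<partial>complex_gaussian)
      = (\<integral>\<^sup>+z. ennreal (exp (- (cmod z)\<^sup>2) / pi) * ennreal ((cmod z)\<^sup>2) \<partial>lborel)"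
    unfolding complex_gaussian_def by (rule nn_integral_density) measurable
  also have "\<dots> \<le> (\<integral>\<^sup>+z. 2 * ennreal (exp (- (cmod z)\<^sup>2 / 2)) \<partial>(lborel::complex measure))"
  proof (rule nn_integral_mono)
    fix z :: complex
    have "ennreal (exp (- (cmod z)\<^sup>2) / pi) * ennreal ((cmod z)\<^sup>2)
        = ennreal ((cmod z)\<^sup>2 / pi * exp (- (cmod z)\<^sup>2))"
      by (simp add: mult.commute flip: ennreal_mult')
    also have "\<dots> \<le> ennreal (2 * exp (- (cmod z)\<^sup>2 / 2))" using le[of "(cmod z)\<^sup>2"] by (intro ennreal_leI) simp
    finally show "ennreal (exp (- (cmod z)\<^sup>2) / pi) * ennreal ((cmod z)\<^sup>2) \<le> 2 * ennreal (exp (- (cmod z)\<^sup>2 / 2))"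
      by (simp add: ennreal_mult')
  qed
  also have "\<dots> = 2 * ennreal (pi * 2)"
    using nn_integral_complex_gaussian[of 2] by (subst nn_integral_cmult) simp_all
  also have "\<dots> < \<infinity>" by (simp add: ennreal_mult_less_top)
  finally show ?thesis .
qed

section \<open>Densities and translates of product laws on matrix entries\<close>

lemma density_PiM_lborel:
  fixes f :: "'i \<Rightarrow> 'a::euclidean_space \<Rightarrow> real"
  assumes I: "finite I" and f[measurable]: "\<And>p. f p \<in> borel_measurable borel" and f0: "\<And>p z. 0 \<le> f p z"
    and prob: "\<And>p. prob_space (density lborel (\<lambda>z. ennreal (f p z)))"
  shows "density (PiM I (\<lambda>_. lborel)) (\<lambda>y. ennreal (\<Prod>p\<in>I. f p (y p)))
    = PiM I (\<lambda>p. density lborel (\<lambda>z. ennreal (f p z)))"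
proof -
  interpret L: product_sigma_finite "\<lambda>_::'i. lborel :: 'a measure" ..
  interpret D: product_sigma_finite "\<lambda>p. density lborel (\<lambda>z. ennreal (f p z))"
    using prob by (simp add: product_sigma_finite_def prob_space_imp_sigma_finite)
  show ?thesis
  proof (rule D.PiM_eqI[OF I])
    show "sets (density (PiM I (\<lambda>_. lborel)) (\<lambda>y. ennreal (\<Prod>p\<in>I. f p (y p))))
      = sets (PiM I (\<lambda>p. density lborel (\<lambda>z. ennreal (f p z))))"
      by (simp cong: sets_PiM_cong)
    fix A :: "'i \<Rightarrow> 'a set" assume "\<And>i. i \<in> I \<Longrightarrow> A i \<in> sets (density lborel (\<lambda>z. ennreal (f i z)))"
    then have A: "\<And>i. i \<in> I \<Longrightarrow> A i \<in> sets borel" by simp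
    have AE[measurable]: "Pi\<^sub>E I A \<in> sets (PiM I (\<lambda>_. lborel))"
      using A by (intro sets_PiM_I_finite I) auto
    have "emeasure (density (PiM I (\<lambda>_. lborel)) (\<lambda>y. ennreal (\<Prod>p\<in>I. f p (y p)))) (Pi\<^sub>E I A)
      = (\<integral>\<^sup>+y. ennreal (\<Prod>p\<in>I. f p (y p)) * indicator (Pi\<^sub>E I A) y \<partial>PiM I (\<lambda>_. lborel))"
      by (rule emeasure_density) measurable
    also have "\<dots> = (\<integral>\<^sup>+y. (\<Prod>p\<in>I. ennreal (f p (y p)) * indicator (A p) (y p)) \<partial>PiM I (\<lambda>_. lborel))"
    proof (rule nn_integral_cong)
      fix y assume y: "y \<in> space (PiM I (\<lambda>_. lborel::'a measure))"
      have "indicator (Pi\<^sub>E I A) y = (\<Prod>p\<in>I. indicator (A p) (y p) :: ennreal)"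
        using y I by (auto simp: indicator_def PiE_iff space_PiM)
      then show "ennreal (\<Prod>p\<in>I. f p (y p)) * indicator (Pi\<^sub>E I A) y
          = (\<Prod>p\<in>I. ennreal (f p (y p)) * indicator (A p) (y p))"
        by (simp add: prod.distrib prod_ennreal f0)
    qed
    also have "\<dots> = (\<Prod>p\<in>I. \<integral>\<^sup>+z. ennreal (f p z) * indicator (A p) z \<partial>lborel)"
      using A by (intro L.product_nn_integral_prod I borel_measurable_times_ennreal) auto
    also have "\<dots> = (\<Prod>p\<in>I. emeasure (density lborel (\<lambda>z. ennreal (f p z))) (A p))"
      using A by (intro prod.cong refl emeasure_density[symmetric]) auto
    finally show "emeasure (density (PiM I (\<lambda>_. lborel)) (\<lambda>y. ennreal (\<Prod>p\<in>I. f p (y p)))) (Pi\<^sub>E I A)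
      = (\<Prod>p\<in>I. emeasure (density lborel (\<lambda>z. ennreal (f p z))) (A p))" .
  qed
qed

text \<open>A shift acting entry by entry preserves independence. The amounts \<open>m p\<close>
  will be the entries of the noiseless output, so the image is a product of laws that differ from
  entry to entry.\<close>

lemma distr_PiM_shift:
  fixes M :: "'a::euclidean_space measure" and m :: "'i \<Rightarrow> 'a"
  assumes I: "finite I" and M: "prob_space M" and [simp, measurable_cong]: "sets M = sets borel"
  shows "distr (PiM I (\<lambda>_. M)) (PiM I (\<lambda>_. borel)) (\<lambda>z. \<lambda>p\<in>I. m p + z p)
    = PiM I (\<lambda>p. distr M borel (\<lambda>z. m p + z))"
proof -
  interpret M: product_sigma_finite "\<lambda>_::'i. M"
    using M by (simp add: product_sigma_finite_def prob_space_imp_sigma_finite)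
  have spM: "space M = UNIV" using sets_eq_imp_space_eq[of M borel] by simp
  interpret D: product_sigma_finite "\<lambda>p. distr M borel (\<lambda>z. m p + z)"
    using M by (auto simp: product_sigma_finite_def intro!: prob_space_imp_sigma_finite prob_space.prob_space_distr)
  show ?thesis
  proof (rule D.PiM_eqI[OF I])
    show "sets (distr (PiM I (\<lambda>_. M)) (PiM I (\<lambda>_. borel)) (\<lambda>z. \<lambda>p\<in>I. m p + z p))
       = sets (PiM I (\<lambda>p. distr M borel (\<lambda>z. m p + z)))"
      by (simp cong: sets_PiM_cong)
    fix A :: "'i \<Rightarrow> 'a set" assume "\<And>i. i \<in> I \<Longrightarrow> A i \<in> sets (distr M borel (\<lambda>z. m i + z))"
    then have A: "\<And>i. i \<in> I \<Longrightarrow> A i \<in> sets borel" by simp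
    have AE: "Pi\<^sub>E I A \<in> sets (PiM I (\<lambda>_. borel))" using A by (intro sets_PiM_I_finite I) auto
    have meas: "(\<lambda>z. \<lambda>p\<in>I. m p + z p) \<in> PiM I (\<lambda>_. M) \<rightarrow>\<^sub>M PiM I (\<lambda>_. borel)" by measurable
    have pre: "(\<lambda>z. m p + z) -` A p \<in> sets M" if "p \<in> I" for p
      using measurable_sets[of "\<lambda>z. m p + z" M borel "A p"] A[OF that] by (simp add: spM)
    have "emeasure (distr (PiM I (\<lambda>_. M)) (PiM I (\<lambda>_. borel)) (\<lambda>z. \<lambda>p\<in>I. m p + z p)) (Pi\<^sub>E I A)
      = emeasure (PiM I (\<lambda>_. M)) ((\<lambda>z. \<lambda>p\<in>I. m p + z p) -` Pi\<^sub>E I A \<inter> space (PiM I (\<lambda>_. M)))"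
      by (rule emeasure_distr[OF meas AE])
    also have "(\<lambda>z. \<lambda>p\<in>I. m p + z p) -` Pi\<^sub>E I A \<inter> space (PiM I (\<lambda>_. M)) = (\<Pi>\<^sub>E p\<in>I. (\<lambda>z. m p + z) -` A p)"
      by (auto simp: space_PiM spM PiE_iff extensional_def)
    also have "emeasure (PiM I (\<lambda>_. M)) \<dots> = (\<Prod>p\<in>I. emeasure M ((\<lambda>z. m p + z) -` A p))"
      using pre by (intro M.emeasure_PiM I)
    also have "\<dots> = (\<Prod>p\<in>I. emeasure (distr M borel (\<lambda>z. m p + z)) (A p))"
      using A by (intro prod.cong refl) (simp add: emeasure_distr spM)
    finally show "emeasure (distr (PiM I (\<lambda>_. M)) (PiM I (\<lambda>_. borel)) (\<lambda>z. \<lambda>p\<in>I. m p + z p)) (Pi\<^sub>E I A)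
      = (\<Prod>p\<in>I. emeasure (distr M borel (\<lambda>z. m p + z)) (A p))" .
  qed
qed

lemma distr_complex_gaussian_shift:
  "distr complex_gaussian borel (\<lambda>z. m + z)
    = density lborel (\<lambda>y. ennreal (exp (- (cmod (y - m))\<^sup>2) / pi))"
proof -
  have "density lborel (\<lambda>y. ennreal (exp (- (cmod (y - m))\<^sup>2) / pi))
      = density (distr lborel borel ((+) m)) (\<lambda>y. ennreal (exp (- (cmod (y - m))\<^sup>2) / pi))"
    by (simp add: lborel_distr_plus)
  also have "\<dots> = distr complex_gaussian borel (\<lambda>z. m + z)"
    by (subst density_distr) (simp_all add: complex_gaussian_def)
  finally show ?thesis ..
qed

section \<open>The channel law as a density with respect to Lebesgue measure\<close>

definition mat_lborel :: "nat \<Rightarrow> nat \<Rightarrow> cmat measure" where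
  "mat_lborel n m = PiM ({..<n} \<times> {..<m}) (\<lambda>_. lborel)"

text \<open>The matrix product \<open>H x\<close> as a plain function of the index pair, without
  restriction to the index set, so that it can be added, subtracted and measured by
  \<open>frob_sq\<close> pointwise. Restriction happens only when an element of
  \<open>mat_space\<close> is formed.\<close>

definition mat_apply :: "nat \<Rightarrow> cmat \<Rightarrow> cmat \<Rightarrow> cmat" where
  "mat_apply k H x p = (\<Sum>b<k. H (fst p, b) * x (b, snd p))"

definition awgn_density :: "nat \<Rightarrow> nat \<Rightarrow> nat \<Rightarrow> cmat \<Rightarrow> cmat \<Rightarrow> cmat \<Rightarrow> real" where
  "awgn_density nt nr L H x y =
     (\<Prod>p\<in>{..<nr} \<times> {..<L}. exp (- (cmod (y p - mat_apply nt H x p))\<^sup>2) / pi)"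

lemma sets_gaussian_mat[measurable_cong, simp]: "sets (gaussian_mat n m) = sets (mat_space n m)"
  unfolding gaussian_mat_def mat_space_def by (intro sets_PiM_cong) simp_all

lemma space_gaussian_mat[simp]: "space (gaussian_mat n m) = space (mat_space n m)"
  by (rule sets_eq_imp_space_eq) simp

lemma sets_mat_lborel[measurable_cong, simp]: "sets (mat_lborel n m) = sets (mat_space n m)"
  unfolding mat_lborel_def mat_space_def by (intro sets_PiM_cong) simp_all

lemma space_mat_space: "space (mat_space n m) = extensional ({..<n} \<times> {..<m})"
  by (auto simp: mat_space_def space_PiM PiE_def)

lemma prob_space_gaussian_mat: "prob_space (gaussian_mat n m)"
  unfolding gaussian_mat_def by (intro prob_space_PiM prob_space_complex_gaussian)

lemma sigma_finite_mat_lborel: "sigma_finite_measure (mat_lborel n m)"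
proof -
  interpret product_sigma_finite "\<lambda>_::nat \<times> nat. lborel :: complex measure" ..
  show ?thesis unfolding mat_lborel_def by (intro sigma_finite) simp
qed

lemma gaussian_mat_in_prob_algebra: "gaussian_mat n m \<in> space (prob_algebra (mat_space n m))"
  by (simp add: space_prob_algebra prob_space_gaussian_mat)

lemma measurable_mat_entry:
  assumes "f \<in> M \<rightarrow>\<^sub>M mat_space n m" "fst p < n" "snd p < m"
  shows "(\<lambda>x. f x p) \<in> borel_measurable M"
proof -
  have "(\<lambda>x. x p) \<in> mat_space n m \<rightarrow>\<^sub>M borel"
    unfolding mat_space_def using assms(2,3) by (intro measurable_component_singleton) (auto simp: mem_Times_iff)
  from measurable_compose[OF assms(1) this] show ?thesis .
qed

lemma measurable_mat_restrict:
  assumes "\<And>p. fst p < n \<Longrightarrow> snd p < m \<Longrightarrow> (\<lambda>x. f x p) \<in> borel_measurable M"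
  shows "(\<lambda>x. \<lambda>p\<in>{..<n} \<times> {..<m}. f x p) \<in> M \<rightarrow>\<^sub>M mat_space n m"
  unfolding mat_space_def using assms by (intro measurable_restrict) auto

lemma measurable_mat_apply:
  assumes "f \<in> M \<rightarrow>\<^sub>M mat_space n k" "g \<in> M \<rightarrow>\<^sub>M mat_space k m"
    and p: "fst p < n" "snd p < m"
  shows "(\<lambda>x. mat_apply k (f x) (g x) p) \<in> borel_measurable M"
  unfolding mat_apply_def using p
  by (intro borel_measurable_sum borel_measurable_times measurable_mat_entry[OF assms(1)]
      measurable_mat_entry[OF assms(2)]) auto

lemma measurable_awgn_density[measurable (raw)]:
  assumes "h \<in> M \<rightarrow>\<^sub>M mat_space nr nt" "f \<in> M \<rightarrow>\<^sub>M mat_space nt L" "g \<in> M \<rightarrow>\<^sub>M mat_space nr L"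
  shows "(\<lambda>x. awgn_density nt nr L (h x) (f x) (g x)) \<in> borel_measurable M"
  unfolding awgn_density_def
proof (rule borel_measurable_prod)
  fix p assume p: "p \<in> {..<nr} \<times> {..<L}"
  then have [measurable]: "(\<lambda>x. g x p) \<in> borel_measurable M"
      "(\<lambda>x. mat_apply nt (h x) (f x) p) \<in> borel_measurable M"
    by (auto intro: measurable_mat_entry[OF assms(3)] measurable_mat_apply[OF assms(1,2)])
  show "(\<lambda>x. exp (- (cmod (g x p - mat_apply nt (h x) (f x) p))\<^sup>2) / pi) \<in> borel_measurable M"
    by measurable
qed

lemma measurable_frob_sq[measurable]: "frob_sq n m \<in> borel_measurable (mat_space n m)"
  unfolding frob_sq_def
proof (rule borel_measurable_sum)
  fix p assume "p \<in> {..<n} \<times> {..<m}"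
  then have [measurable]: "(\<lambda>x. x p) \<in> borel_measurable (mat_space n m)"
    by (auto intro: measurable_mat_entry[OF measurable_ident_sets[OF refl]])
  show "(\<lambda>x. (cmod (x p))\<^sup>2) \<in> borel_measurable (mat_space n m)" by measurable
qed

lemma awgn_density_pos: "0 < awgn_density nt nr L H x y"
  unfolding awgn_density_def by (intro prod_pos) simp

text \<open>Every factor is at most \<open>1 / pi\<close>, hence below 1. This is the bound
  \<open>c = 1\<close> with which the kernel locale is instantiated.\<close>

lemma awgn_density_le_1: "awgn_density nt nr L H x y \<le> 1"
  unfolding awgn_density_def
proof (intro prod_le_1 conjI)
  fix p
  have "exp (- (cmod (y p - mat_apply nt H x p))\<^sup>2) \<le> 1" by simp
  also have "1 \<le> pi" using pi_gt3 by simp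
  finally show "exp (- (cmod (y p - mat_apply nt H x p))\<^sup>2) / pi \<le> 1" by simp
qed simp

lemma ln_awgn_density:
  "ln (awgn_density nt nr L H x y)
    = - frob_sq nr L (\<lambda>p. y p - mat_apply nt H x p) - real (nr * L) * ln pi"
  unfolding awgn_density_def frob_sq_def
  by (subst ln_prod) (simp_all add: ln_div sum_subtractf sum_negf)

lemma awgn_eq: "awgn nt nr L H x = distr (gaussian_mat nr L) (mat_space nr L)
    (\<lambda>z. \<lambda>p\<in>{..<nr} \<times> {..<L}. mat_apply nt H x p + z p)"
  unfolding awgn_def mat_apply_def by (intro distr_cong) (auto simp: restrict_def fun_eq_iff)

lemma awgn_eq_density:
  "awgn nt nr L H x = density (mat_lborel nr L) (\<lambda>y. ennreal (awgn_density nt nr L H x y))"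
proof -
  have "awgn nt nr L H x = PiM ({..<nr} \<times> {..<L}) (\<lambda>p. density lborel
      (\<lambda>y. ennreal (exp (- (cmod (y - mat_apply nt H x p))\<^sup>2) / pi)))"
    unfolding awgn_eq gaussian_mat_def mat_space_def distr_complex_gaussian_shift[symmetric]
    by (intro distr_PiM_shift prob_space_complex_gaussian) simp_all
  also have "\<dots> = density (mat_lborel nr L) (\<lambda>y. ennreal (awgn_density nt nr L H x y))"
    unfolding mat_lborel_def awgn_density_def
    by (rule density_PiM_lborel[symmetric])
      (simp_all add: distr_complex_gaussian_shift[symmetric] prob_space.prob_space_distr prob_space_complex_gaussian)
  finally show ?thesis .
qed

lemma measurable_awgn[measurable (raw)]:
  assumes h: "h \<in> M \<rightarrow>\<^sub>M mat_space nr nt" and f: "f \<in> M \<rightarrow>\<^sub>M mat_space nt L"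
  shows "(\<lambda>x. awgn nt nr L (h x) (f x)) \<in> M \<rightarrow>\<^sub>M prob_algebra (mat_space nr L)"
  unfolding awgn_eq
proof (rule measurable_distr_prob_space2[where M="mat_space nr L"])
  show "(\<lambda>x. gaussian_mat nr L) \<in> M \<rightarrow>\<^sub>M prob_algebra (mat_space nr L)"
    by (intro measurable_const gaussian_mat_in_prob_algebra)
  have h': "(\<lambda>p. h (fst p)) \<in> M \<Otimes>\<^sub>M mat_space nr L \<rightarrow>\<^sub>M mat_space nr nt"
    and f': "(\<lambda>p. f (fst p)) \<in> M \<Otimes>\<^sub>M mat_space nr L \<rightarrow>\<^sub>M mat_space nt L"
    using h f by measurable
  show "(\<lambda>(x, z). \<lambda>p\<in>{..<nr} \<times> {..<L}. mat_apply nt (h x) (f x) p + z p)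
     \<in> M \<Otimes>\<^sub>M mat_space nr L \<rightarrow>\<^sub>M mat_space nr L"
    unfolding case_prod_beta'
    by (intro measurable_mat_restrict borel_measurable_add measurable_mat_apply[OF h' f']
        measurable_mat_entry[OF measurable_snd])
qed

lemma positive_density_kernel_awgn:
  assumes "H \<in> space (mat_space nr nt)" "Q \<in> space (prob_algebra (mat_space nt L))"
  shows "positive_density_kernel (mat_space nt L) (mat_space nr L) Q (awgn nt nr L H) (mat_lborel nr L)
    (\<lambda>z. awgn_density nt nr L H (fst z) (snd z)) 1"
proof (rule positive_density_kernel.intro)
  show "awgn nt nr L H \<in> mat_space nt L \<rightarrow>\<^sub>M prob_algebra (mat_space nr L)"
    by (rule measurable_awgn[OF measurable_const[OF assms(1)] measurable_ident_sets[OF refl]])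
  show "(\<lambda>z. awgn_density nt nr L H (fst z) (snd z)) \<in> borel_measurable (mat_space nt L \<Otimes>\<^sub>M mat_space nr L)"
    by (rule measurable_awgn_density[OF measurable_const[OF assms(1)] measurable_fst measurable_snd])
qed (simp_all add: assms(2) sigma_finite_mat_lborel awgn_density_pos awgn_density_le_1 awgn_eq_density)

section \<open>Columns of a block, each an \<open>n x 1\<close> matrix and thus a block of length
  1\<close>

definition mat_col :: "nat \<Rightarrow> nat \<Rightarrow> cmat \<Rightarrow> cmat" where
  "mat_col n t x = (\<lambda>p\<in>{..<n} \<times> {..<1}. x (fst p, t))"

lemma measurable_mat_col:
  assumes "f \<in> M \<rightarrow>\<^sub>M mat_space n L" "t < L"
  shows "(\<lambda>x. mat_col n t (f x)) \<in> M \<rightarrow>\<^sub>M mat_space n 1"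
  unfolding mat_col_def
  by (intro measurable_mat_restrict measurable_mat_entry[OF assms(1)]) (use assms(2) in auto)

lemma mat_col_apply: "fst p < n \<Longrightarrow> snd p < 1 \<Longrightarrow> mat_col n t x p = x (fst p, t)"
  by (simp add: mat_col_def mem_Times_iff)

lemma mat_apply_col:
  "fst p < nr \<Longrightarrow> snd p < 1 \<Longrightarrow> mat_apply nt H (mat_col nt t x) p = mat_apply nt H x (fst p, t)"
  by (simp add: mat_apply_def mat_col_def mem_Times_iff)

lemma prod_mat_columns:
  fixes f :: "nat \<times> nat \<Rightarrow> 'a::comm_monoid_mult"
  shows "(\<Prod>p\<in>{..<n} \<times> {..<L}. f p) = (\<Prod>t<L. \<Prod>p\<in>{..<n} \<times> {..<1::nat}. f (fst p, t))"
proof -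
  have "(\<Prod>p\<in>{..<n} \<times> {..<L}. f p) = (\<Prod>a<n. \<Prod>t<L. f (a, t))"
    by (simp add: prod.cartesian_product)
  also have "\<dots> = (\<Prod>t<L. \<Prod>a<n. f (a, t))" by (rule prod.swap)
  also have "\<dots> = (\<Prod>t<L. \<Prod>a<n. \<Prod>s<1::nat. f (a, t))" by simp
  also have "\<dots> = (\<Prod>t<L. \<Prod>p\<in>{..<n} \<times> {..<1::nat}. f (fst p, t))"
    unfolding prod.cartesian_product by (simp add: case_prod_beta')
  finally show ?thesis .
qed

lemma sum_mat_columns:
  fixes f :: "nat \<times> nat \<Rightarrow> 'a::comm_monoid_add"
  shows "(\<Sum>p\<in>{..<n} \<times> {..<L}. f p) = (\<Sum>t<L. \<Sum>p\<in>{..<n} \<times> {..<1::nat}. f (fst p, t))"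
proof -
  have "(\<Sum>p\<in>{..<n} \<times> {..<L}. f p) = (\<Sum>a<n. \<Sum>t<L. f (a, t))"
    by (simp add: sum.cartesian_product)
  also have "\<dots> = (\<Sum>t<L. \<Sum>a<n. f (a, t))" by (rule sum.swap)
  also have "\<dots> = (\<Sum>t<L. \<Sum>a<n. \<Sum>s<1::nat. f (a, t))" by simp
  also have "\<dots> = (\<Sum>t<L. \<Sum>p\<in>{..<n} \<times> {..<1::nat}. f (fst p, t))"
    unfolding sum.cartesian_product by (simp add: case_prod_beta')
  finally show ?thesis .
qed

lemma awgn_density_columns:
  "awgn_density nt nr L H x y = (\<Prod>t<L. awgn_density nt nr 1 H (mat_col nt t x) (mat_col nr t y))"
  unfolding awgn_density_def
  by (subst prod_mat_columns, intro prod.cong refl) (auto simp: mat_apply_col[where nr=nr] mat_col_apply)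

lemma frob_sq_columns: "frob_sq n L x = (\<Sum>t<L. frob_sq n 1 (mat_col n t x))"
  unfolding frob_sq_def by (subst sum_mat_columns, intro sum.cong refl) (auto simp: mat_col_apply)

lemma distr_gaussian_mat_col:
  assumes "t < L"
  shows "distr (gaussian_mat n L) (mat_space n 1) (mat_col n t) = gaussian_mat n 1"
proof -
  have "distr (gaussian_mat n L) (gaussian_mat n 1) (\<lambda>z. \<lambda>p\<in>{..<n} \<times> {..<1}. z (fst p, t)) = gaussian_mat n 1"
    unfolding gaussian_mat_def
    by (rule distr_PiM_reindex) (use assms in \<open>auto simp: prob_space_complex_gaussian inj_on_def\<close>)
  moreover have "distr (gaussian_mat n L) (mat_space n 1) (mat_col n t)
      = distr (gaussian_mat n L) (gaussian_mat n 1) (\<lambda>z. \<lambda>p\<in>{..<n} \<times> {..<1}. z (fst p, t))"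
    by (intro distr_cong) (auto simp: mat_col_def)
  ultimately show ?thesis by simp
qed

text \<open>Memorylessness: the matrix acts on each column separately, and every column of the noise
  is again standard Gaussian.\<close>

lemma distr_awgn_col:
  assumes t: "t < L"
  shows "distr (awgn nt nr L H x) (mat_space nr 1) (mat_col nr t) = awgn nt nr 1 H (mat_col nt t x)"
proof -
  have m: "mat_col nr t \<in> mat_space nr L \<rightarrow>\<^sub>M mat_space nr 1"
    using measurable_mat_col[OF measurable_ident_sets[OF refl] t] .
  have id: "(\<lambda>z. z) \<in> gaussian_mat nr k \<rightarrow>\<^sub>M mat_space nr k" for k by (rule measurable_ident_sets) simp
  have s: "(\<lambda>z. \<lambda>p\<in>{..<nr} \<times> {..<k}. f p + z p) \<in> gaussian_mat nr k \<rightarrow>\<^sub>M mat_space nr k" for f k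
    by (intro measurable_mat_restrict borel_measurable_add borel_measurable_const measurable_mat_entry[OF id])
  have s': "(\<lambda>z. \<lambda>p\<in>{..<nr} \<times> {..<1}. f p + z p) \<in> mat_space nr 1 \<rightarrow>\<^sub>M mat_space nr 1" for f
    by (intro measurable_mat_restrict borel_measurable_add borel_measurable_const
        measurable_mat_entry[OF measurable_ident_sets[OF refl]])
  have m': "mat_col nr t \<in> gaussian_mat nr L \<rightarrow>\<^sub>M mat_space nr 1" using m by (simp cong: measurable_cong_sets)
  have "mat_col nr t (\<lambda>p\<in>{..<nr} \<times> {..<L}. mat_apply nt H x p + z p)
      = (\<lambda>p\<in>{..<nr} \<times> {..<1}. mat_apply nt H (mat_col nt t x) p + mat_col nr t z p)" for z
  proof
    fix p
    show "mat_col nr t (\<lambda>p\<in>{..<nr} \<times> {..<L}. mat_apply nt H x p + z p) p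
      = (\<lambda>p\<in>{..<nr} \<times> {..<1}. mat_apply nt H (mat_col nt t x) p + mat_col nr t z p) p"
    proof (cases "p \<in> {..<nr} \<times> {..<1}")
      case True
      then show ?thesis using t by (auto simp: mat_col_apply mat_apply_col[where nr=nr])
    qed (simp add: mat_col_def)
  qed
  then show ?thesis
    unfolding awgn_eq distr_distr[OF m s] distr_gaussian_mat_col[OF t, symmetric] distr_distr[OF s' m']
    by (intro distr_cong refl) simp
qed

section \<open>Norm bounds and second moments\<close>

lemma frob_sq_nonneg: "0 \<le> frob_sq n m x"
  by (simp add: frob_sq_def sum_nonneg)

lemma norm_add_sq_le: "(norm (a + b))\<^sup>2 \<le> 2 * (norm a)\<^sup>2 + 2 * (norm b)\<^sup>2" for a b :: "'a::real_normed_vector"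
proof -
  have "(norm (a + b))\<^sup>2 \<le> (norm a + norm b)\<^sup>2" by (intro power_mono norm_triangle_ineq) simp
  also have "\<dots> \<le> 2 * (norm a)\<^sup>2 + 2 * (norm b)\<^sup>2"
    using sum_squares_bound[of "norm a" "norm b"] by (simp add: power2_sum)
  finally show ?thesis .
qed

lemma frob_sq_add_le: "frob_sq n m (\<lambda>p. x p + y p) \<le> 2 * frob_sq n m x + 2 * frob_sq n m y"
  unfolding frob_sq_def sum_distrib_left sum.distrib[symmetric]
  by (intro sum_mono norm_add_sq_le)

lemma frob_sq_diff_le: "frob_sq n m (\<lambda>p. x p - y p) \<le> 2 * frob_sq n m x + 2 * frob_sq n m y"
  using frob_sq_add_le[of n m x "\<lambda>p. - y p"] by (simp add: frob_sq_def)

text \<open>A crude bound: each entry of \<open>x\<close> is at most the norm of the whole block. It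
  is used only for integrability at a fixed matrix, so any constant that depends on \<open>H\<close>
  alone will do.\<close>

lemma frob_sq_mat_apply_le:
  "frob_sq nr L (mat_apply nt H x)
    \<le> (\<Sum>p\<in>{..<nr} \<times> {..<L}. (\<Sum>b<nt. cmod (H (fst p, b)))\<^sup>2) * frob_sq nt L x"
  unfolding frob_sq_def[of nr] sum_distrib_right
proof (rule sum_mono)
  fix p assume p: "p \<in> {..<nr} \<times> {..<L}"
  have x: "cmod (x (b, snd p)) \<le> sqrt (frob_sq nt L x)" if "b < nt" for b
  proof -
    have "(cmod (x (b, snd p)))\<^sup>2 \<le> frob_sq nt L x"
      unfolding frob_sq_def using p that by (intro member_le_sum[of "(b, snd p)"]) auto
    then show ?thesis by (rule real_le_rsqrt)
  qed
  have "cmod (mat_apply nt H x p) \<le> (\<Sum>b<nt. cmod (H (fst p, b)) * sqrt (frob_sq nt L x))"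
    unfolding mat_apply_def using x
    by (intro order_trans[OF norm_sum] sum_mono) (auto simp: norm_mult intro!: mult_left_mono)
  then have "(cmod (mat_apply nt H x p))\<^sup>2 \<le> ((\<Sum>b<nt. cmod (H (fst p, b))) * sqrt (frob_sq nt L x))\<^sup>2"
    by (intro power_mono) (simp_all add: sum_distrib_right)
  then show "(cmod (mat_apply nt H x p))\<^sup>2 \<le> (\<Sum>b<nt. cmod (H (fst p, b)))\<^sup>2 * frob_sq nt L x"
    by (simp add: power_mult_distrib frob_sq_nonneg)
qed

lemma gaussian_mat_second_moment: "(\<integral>\<^sup>+z. ennreal (frob_sq n m z) \<partial>gaussian_mat n m) < \<infinity>"
proof -
  have comp: "(\<lambda>z. z p) \<in> gaussian_mat n m \<rightarrow>\<^sub>M complex_gaussian" if "p \<in> {..<n} \<times> {..<m}" for p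
    unfolding gaussian_mat_def using that by (rule measurable_component_singleton)
  have "(\<integral>\<^sup>+z. ennreal (frob_sq n m z) \<partial>gaussian_mat n m)
    = (\<integral>\<^sup>+z. (\<Sum>p\<in>{..<n} \<times> {..<m}. ennreal ((cmod (z p))\<^sup>2)) \<partial>gaussian_mat n m)"
    by (simp add: frob_sq_def sum_ennreal)
  also have "\<dots> = (\<Sum>p\<in>{..<n} \<times> {..<m}. \<integral>\<^sup>+z. ennreal ((cmod (z p))\<^sup>2) \<partial>gaussian_mat n m)"
  proof (rule nn_integral_sum)
    fix p assume p: "p \<in> {..<n} \<times> {..<m}"
    have "(\<lambda>z. ennreal ((cmod z)\<^sup>2)) \<in> borel_measurable complex_gaussian" by measurable
    from measurable_compose[OF comp[OF p] this]
    show "(\<lambda>z. ennreal ((cmod (z p))\<^sup>2)) \<in> borel_measurable (gaussian_mat n m)" .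
  qed
  also have "\<dots> = (\<Sum>p\<in>{..<n} \<times> {..<m}. \<integral>\<^sup>+z. ennreal ((cmod z)\<^sup>2) \<partial>complex_gaussian)"
  proof (rule sum.cong[OF refl])
    fix p assume p: "p \<in> {..<n} \<times> {..<m}"
    have "distr (gaussian_mat n m) complex_gaussian (\<lambda>z. z p) = complex_gaussian"
      unfolding gaussian_mat_def by (rule distr_PiM_component[OF prob_space_complex_gaussian p])
    then have "(\<integral>\<^sup>+z. ennreal ((cmod z)\<^sup>2) \<partial>complex_gaussian)
        = (\<integral>\<^sup>+z. ennreal ((cmod z)\<^sup>2) \<partial>distr (gaussian_mat n m) complex_gaussian (\<lambda>z. z p))" by simp
    also have "\<dots> = (\<integral>\<^sup>+z. ennreal ((cmod (z p))\<^sup>2) \<partial>gaussian_mat n m)"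
      by (rule nn_integral_distr[OF comp[OF p]]) measurable
    finally show "(\<integral>\<^sup>+z. ennreal ((cmod (z p))\<^sup>2) \<partial>gaussian_mat n m)
        = (\<integral>\<^sup>+z. ennreal ((cmod z)\<^sup>2) \<partial>complex_gaussian)" by simp
  qed
  also have "\<dots> < \<infinity>"
    using complex_gaussian_second_moment by (simp add: ennreal_mult_less_top of_nat_less_top)
  finally show ?thesis .
qed

definition channel_output :: "nat \<Rightarrow> nat \<Rightarrow> nat \<Rightarrow> cmat \<Rightarrow> cmat \<Rightarrow> cmat \<Rightarrow> cmat" where
  "channel_output nt nr L H x z = (\<lambda>p\<in>{..<nr} \<times> {..<L}. mat_apply nt H x p + z p)"

lemma measurable_channel_output:
  assumes "h \<in> M \<rightarrow>\<^sub>M mat_space nr nt" "f \<in> M \<rightarrow>\<^sub>M mat_space nt L" "g \<in> M \<rightarrow>\<^sub>M mat_space nr L"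
  shows "(\<lambda>x. channel_output nt nr L (h x) (f x) (g x)) \<in> M \<rightarrow>\<^sub>M mat_space nr L"
  unfolding channel_output_def
  by (intro measurable_mat_restrict borel_measurable_add measurable_mat_apply[OF assms(1,2)]
      measurable_mat_entry[OF assms(3)])

lemma frob_sq_cong: "(\<And>p. p \<in> {..<n} \<times> {..<m} \<Longrightarrow> x p = y p) \<Longrightarrow> frob_sq n m x = frob_sq n m y"
  unfolding frob_sq_def by (intro sum.cong) simp_all

text \<open>Realises input and output as functions of independent input and noise. Integrability
  under the joint law then reduces to second moments of these two.\<close>

lemma joint_law_awgn_eq_distr:
  assumes H: "H \<in> space (mat_space nr nt)" and Q: "Q \<in> space (prob_algebra (mat_space nt L))"
  shows "joint_law (mat_space nt L) (mat_space nr L) Q (awgn nt nr L H)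
    = distr (Q \<Otimes>\<^sub>M gaussian_mat nr L) (mat_space nt L \<Otimes>\<^sub>M mat_space nr L)
        (\<lambda>p. (fst p, channel_output nt nr L H (fst p) (snd p)))" (is "?J = distr ?M ?N ?T")
    and "(\<lambda>p. (fst p, channel_output nt nr L H (fst p) (snd p)))
      \<in> Q \<Otimes>\<^sub>M gaussian_mat nr L \<rightarrow>\<^sub>M mat_space nt L \<Otimes>\<^sub>M mat_space nr L"
proof -
  interpret K: positive_density_kernel "mat_space nt L" "mat_space nr L" Q "awgn nt nr L H"
    "mat_lborel nr L" "\<lambda>z. awgn_density nt nr L H (fst z) (snd z)" 1
    by (rule positive_density_kernel_awgn[OF H Q])
  interpret G: prob_space "gaussian_mat nr L" by (rule prob_space_gaussian_mat)
  have sets: "sets ?M = sets ?N" by (intro sets_pair_measure_cong K.sets_P) simp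
  have "fst \<in> ?M \<rightarrow>\<^sub>M mat_space nt L" "snd \<in> ?M \<rightarrow>\<^sub>M mat_space nr L"
    using sets by (simp_all cong: measurable_cong_sets)
  then show T: "?T \<in> ?M \<rightarrow>\<^sub>M ?N"
    using H by (intro measurable_Pair measurable_channel_output measurable_const)
  have J: "?J \<in> space (prob_algebra ?N)" by (rule joint_law_in_prob_algebra[OF K.P K.K])
  show "?J = distr ?M ?N ?T"
  proof (rule measure_eqI_nn_integral)
    show "sets ?J = sets (distr ?M ?N ?T)" using J by (simp add: space_prob_algebra)
    fix F :: "_ \<Rightarrow> ennreal" assume "F \<in> borel_measurable (distr ?M ?N ?T)"
    then have F: "F \<in> borel_measurable ?N" by simp
    have F': "(\<lambda>y. F (x, y)) \<in> borel_measurable (mat_space nr L)" if "x \<in> space (mat_space nt L)" for x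
      using measurable_compose[OF measurable_Pair1'[OF that] F] .
    have "(\<integral>\<^sup>+z. F z \<partial>?J) = (\<integral>\<^sup>+x. \<integral>\<^sup>+y. F (x, y) \<partial>awgn nt nr L H x \<partial>Q)"
      by (rule nn_integral_joint_law[OF K.P K.K F])
    also have "\<dots> = (\<integral>\<^sup>+x. \<integral>\<^sup>+z. F (x, channel_output nt nr L H x z) \<partial>gaussian_mat nr L \<partial>Q)"
    proof (rule nn_integral_cong)
      fix x assume "x \<in> space Q"
      then have x: "x \<in> space (mat_space nt L)" by (simp add: K.space_P)
      have "channel_output nt nr L H x \<in> gaussian_mat nr L \<rightarrow>\<^sub>M mat_space nr L"
        by (rule measurable_channel_output[OF measurable_const[OF H] measurable_const[OF x] measurable_ident_sets]) simp
      then show "(\<integral>\<^sup>+y. F (x, y) \<partial>awgn nt nr L H x)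
          = (\<integral>\<^sup>+z. F (x, channel_output nt nr L H x z) \<partial>gaussian_mat nr L)"
        unfolding awgn_eq channel_output_def[symmetric] using F'[OF x] by (intro nn_integral_distr) simp_all
    qed
    also have "\<dots> = (\<integral>\<^sup>+p. F (?T p) \<partial>?M)"
      by (subst G.nn_integral_fst[symmetric]) (use measurable_compose[OF T F] in simp_all)
    also have "\<dots> = (\<integral>\<^sup>+z. F z \<partial>distr ?M ?N ?T)"
      using F by (simp add: nn_integral_distr[OF T])
    finally show "(\<integral>\<^sup>+z. F z \<partial>?J) = (\<integral>\<^sup>+z. F z \<partial>distr ?M ?N ?T)" .
  qed
qed

text \<open>A Gaussian density has Gaussian tails under any power-constrained input, so the
  logarithm of the output density is dominated by a quadratic function.\<close>

lemma integrable_awgn_information_density: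
  assumes H: "H \<in> space (mat_space nr nt)" and Q: "Q \<in> space (prob_algebra (mat_space nt L))"
    and power: "(\<integral>\<^sup>+x. ennreal (frob_sq nt L x) \<partial>Q) < \<infinity>"
  defines "w \<equiv> \<lambda>z. awgn_density nt nr L H (fst z) (snd z)"
  shows "integrable (joint_law (mat_space nt L) (mat_space nr L) Q (awgn nt nr L H))
     (\<lambda>z. log 2 (w z / positive_density_kernel.out_density Q w (snd z)))"
proof -
  interpret K: positive_density_kernel "mat_space nt L" "mat_space nr L" Q "awgn nt nr L H"
    "mat_lborel nr L" w 1
    unfolding w_def by (rule positive_density_kernel_awgn[OF H Q])
  interpret G: prob_space "gaussian_mat nr L" by (rule prob_space_gaussian_mat)
  interpret Q: prob_space Q by (rule K.prob_space_P)
  note [measurable_cong] = K.sets_P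
  note [measurable] = K.g K.out_density_measurable
  define C where "C = (\<Sum>p\<in>{..<nr} \<times> {..<L}. (\<Sum>b<nt. cmod (H (fst p, b)))\<^sup>2)"
  have C0: "0 \<le> C" by (simp add: C_def sum_nonneg)
  have C: "frob_sq nr L (mat_apply nt H x) \<le> C * frob_sq nt L x" for x
    unfolding C_def by (rule frob_sq_mat_apply_le)
  define k where "k = real (nr * L) * ln pi"
  have k0: "0 \<le> k" unfolding k_def using pi_gt3 by (intro mult_nonneg_nonneg) auto
  have ln_w: "ln (w (x, y)) = - frob_sq nr L (\<lambda>p. y p - mat_apply nt H x p) - k" for x y
    by (simp add: w_def ln_awgn_density k_def)
  have int_frob: "integrable Q (frob_sq nt L)"
    using power by (intro integrableI_nonneg) (auto simp: frob_sq_nonneg)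
  define P where "P = (\<integral>x. frob_sq nt L x \<partial>Q)"
  have P0: "0 \<le> P" unfolding P_def by (simp add: frob_sq_nonneg)
  have out_ge: "- (2 * frob_sq nr L y + 2 * C * P + k) \<le> ln (K.out_density y)"
    and out_le: "ln (K.out_density y) \<le> 0" if y: "y \<in> space (mat_space nr L)" for y
  proof -
    define U where "U x = 2 * frob_sq nr L y + 2 * C * frob_sq nt L x" for x
    define m where "m = 2 * frob_sq nr L y + 2 * C * P"
    have intU: "integrable Q U" using int_frob by (simp add: U_def[abs_def])
    have m: "(\<integral>x. U x \<partial>Q) = m"
      unfolding U_def m_def P_def using int_frob by (simp add: Q.prob_space)
    \<comment> \<open>Jensen's inequality by a tangent line: \<open>m\<close> is the mean of
      \<open>U\<close>, and \<open>exp (- U x - k)\<close> lies above its tangent at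
      \<open>U x = m\<close>. Averaging the tangent leaves \<open>exp (- m - k)\<close>, a lower
      bound for the output density.\<close>
    have w_ge: "exp (- m - k) * (1 + (m - U x)) \<le> w (x, y)" for x
    proof -
      have "- U x - k \<le> ln (w (x, y))"
        unfolding ln_w U_def using frob_sq_diff_le[of nr L y "mat_apply nt H x"] C[of x] by linarith
      moreover have "0 < w (x, y)" by (simp add: w_def awgn_density_pos)
      ultimately have "exp (- U x - k) \<le> w (x, y)" by (simp add: ln_ge_iff)
      moreover have "exp (- m - k) * (1 + (m - U x)) \<le> exp (- m - k) * exp (m - U x)"
        by (intro mult_left_mono exp_ge_add_one_self) simp
      moreover have "exp (- m - k) * exp (m - U x) = exp (- U x - k)" by (simp flip: exp_add)
      ultimately show ?thesis by linarith
    qed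
    have "exp (- m - k) = (\<integral>x. exp (- m - k) * (1 + (m - U x)) \<partial>Q)"
      using intU by (simp add: m Q.prob_space)
    also have "\<dots> \<le> K.out_density y"
      unfolding K.out_density_def using intU K.integrable_section[OF y] w_ge
      by (intro integral_mono) auto
    finally have "exp (- m - k) \<le> K.out_density y" .
    then have "- m - k \<le> ln (K.out_density y)" using K.out_density_pos[OF y] by (simp add: ln_ge_iff)
    then show "- (2 * frob_sq nr L y + 2 * C * P + k) \<le> ln (K.out_density y)" by (simp add: m_def)
    show "ln (K.out_density y) \<le> 0" using K.out_density_le[OF y] K.out_density_pos[OF y] by simp
  qed
  let ?M = "Q \<Otimes>\<^sub>M gaussian_mat nr L"
  let ?T = "\<lambda>p. (fst p, channel_output nt nr L H (fst p) (snd p))"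
  \<comment> \<open>The density \<open>w\<close> contributes the squared noise norm and
    \<open>k\<close>. The output density contributes twice the squared norm of \<open>y\<close>,
    plus \<open>2 * C * P + k\<close>, and that squared norm is at most \<open>2 * C\<close> times
    the input power plus twice the squared noise norm. Hence the coefficients \<open>4 * C\<close>
    and \<open>5 = 1 + 4\<close>.\<close>
  let ?B = "\<lambda>p. (4 * C * frob_sq nt L (fst p) + 5 * frob_sq nr L (snd p) + (2 * C * P + 2 * k)) / ln 2"
  have T: "?T \<in> ?M \<rightarrow>\<^sub>M mat_space nt L \<Otimes>\<^sub>M mat_space nr L"
    by (rule joint_law_awgn_eq_distr(2)[OF H Q])
  have int1: "integrable ?M (\<lambda>p. frob_sq nt L (fst p))"
  proof (rule integrableI_nonneg)
    have "(\<integral>\<^sup>+p. ennreal (frob_sq nt L (fst p)) \<partial>?M) = (\<integral>\<^sup>+x. ennreal (frob_sq nt L x) \<partial>Q)"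
      by (subst G.nn_integral_fst[symmetric]) (simp_all add: G.emeasure_space_1[simplified])
    then show "(\<integral>\<^sup>+p. ennreal (frob_sq nt L (fst p)) \<partial>?M) < \<infinity>" using power by simp
  qed (auto simp: frob_sq_nonneg)
  have int2: "integrable ?M (\<lambda>p. frob_sq nr L (snd p))"
  proof (rule integrableI_nonneg)
    have "(\<integral>\<^sup>+p. ennreal (frob_sq nr L (snd p)) \<partial>?M) = (\<integral>\<^sup>+z. ennreal (frob_sq nr L z) \<partial>gaussian_mat nr L)"
      by (subst G.nn_integral_fst[symmetric]) (simp_all add: Q.emeasure_space_1)
    then show "(\<integral>\<^sup>+p. ennreal (frob_sq nr L (snd p)) \<partial>?M) < \<infinity>" using gaussian_mat_second_moment by simp
  qed (auto simp: frob_sq_nonneg)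
  interpret QG: pair_prob_space Q "gaussian_mat nr L" ..
  have intB: "integrable ?M ?B"
    by (rule integrable_divide_zero,
        rule Bochner_Integration.integrable_add[OF Bochner_Integration.integrable_add
          [OF integrable_mult_right[OF int1] integrable_mult_right[OF int2]] QG.P.integrable_const])
  let ?l = "\<lambda>z. log 2 (w z / K.out_density (snd z))"
  have l: "?l \<in> borel_measurable (mat_space nt L \<Otimes>\<^sub>M mat_space nr L)" by measurable
  have "integrable ?M (\<lambda>p. ?l (?T p))"
  proof (rule Bochner_Integration.integrable_bound[OF intB measurable_compose[OF T l] AE_I2])
    fix p assume "p \<in> space ?M"
    then have p: "fst p \<in> space (mat_space nt L)" "snd p \<in> space (mat_space nr L)"
      by (auto simp: space_pair_measure K.space_P)
    define y where "y = channel_output nt nr L H (fst p) (snd p)"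
    have y: "y \<in> space (mat_space nr L)" by (auto simp: y_def channel_output_def space_mat_space)
    have "frob_sq nr L y = frob_sq nr L (\<lambda>q. mat_apply nt H (fst p) q + snd p q)"
      by (intro frob_sq_cong) (simp add: y_def channel_output_def)
    also have "\<dots> \<le> 2 * (C * frob_sq nt L (fst p)) + 2 * frob_sq nr L (snd p)"
      using frob_sq_add_le[of nr L "mat_apply nt H (fst p)" "snd p"] C[of "fst p"] by linarith
    finally have fy: "frob_sq nr L y \<le> 2 * (C * frob_sq nt L (fst p)) + 2 * frob_sq nr L (snd p)" .
    have "frob_sq nr L (\<lambda>q. y q - mat_apply nt H (fst p) q) = frob_sq nr L (snd p)"
      by (intro frob_sq_cong) (simp add: y_def channel_output_def)
    then have lw: "ln (w (fst p, y)) = - frob_sq nr L (snd p) - k" by (simp add: ln_w)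
    have pos: "0 < w (fst p, y)" "0 < K.out_density y"
      using K.out_density_pos[OF y] by (simp_all add: w_def awgn_density_pos)
    have "\<bar>ln (w (fst p, y)) - ln (K.out_density y)\<bar>
        \<le> 4 * C * frob_sq nt L (fst p) + 5 * frob_sq nr L (snd p) + (2 * C * P + 2 * k)"
      using lw out_ge[OF y] out_le[OF y] fy k0 mult_nonneg_nonneg[OF C0 P0]
        mult_nonneg_nonneg[OF C0 frob_sq_nonneg[of nt L "fst p"]] frob_sq_nonneg[of nr L "snd p"]
      by (simp add: abs_le_iff)
    moreover have "?l (fst p, y) = (ln (w (fst p, y)) - ln (K.out_density y)) / ln 2"
      using pos by (simp add: log_def ln_div)
    ultimately have "\<bar>?l (fst p, y)\<bar> \<le> ?B p"
      by (simp only: abs_divide abs_of_pos[OF ln_gt_zero] divide_right_mono ln_ge_zero)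
    also have "?B p \<le> norm (?B p)" unfolding real_norm_def by (rule abs_ge_self)
    finally show "norm (?l (?T p)) \<le> norm (?B p)" by (simp add: y_def)
  qed
  then show ?thesis
    unfolding joint_law_awgn_eq_distr(1)[OF H Q] by (subst integrable_distr_eq[OF T l])
qed

section \<open>From blocks to single channel uses\<close>

text \<open>Keeps the simplifier from rewriting the block length in \<open>mat_space n 1\<close> to
  \<open>Suc 0\<close>, which would no longer match the lemmas about single channel uses.\<close>

declare One_nat_def [simp del]

text \<open>The law of the column at a uniformly random time. The time index is an explicit factor
  of a product space, so the mixture is the image under one measurable map and Fubini turns its
  integrals into averages over the columns.\<close>

definition mean_col_law :: "nat \<Rightarrow> nat \<Rightarrow> cmat measure \<Rightarrow> cmat measure" where
  "mean_col_law n L Q =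
     distr (uniform_count_measure {..<L} \<Otimes>\<^sub>M Q) (mat_space n 1) (\<lambda>p. mat_col n (fst p) (snd p))"

lemma nn_integral_uniform_count_measure:
  assumes "finite A"
  shows "(\<integral>\<^sup>+x. f x \<partial>uniform_count_measure A) = ennreal (1 / card A) * (\<Sum>x\<in>A. f x)"
  using assms unfolding uniform_count_measure_def
  by (simp add: nn_integral_point_measure_finite sum_distrib_left)

text \<open>The time index ranges over a countable discrete space, so joint measurability can be
  checked one time at a time.\<close>

lemma measurable_uniform_pair:
  assumes "\<And>t. t < L \<Longrightarrow> (\<lambda>x. f (t, x)) \<in> N \<rightarrow>\<^sub>M K"
  shows "f \<in> uniform_count_measure {..<L::nat} \<Otimes>\<^sub>M N \<rightarrow>\<^sub>M K"
proof -
  have "f \<in> count_space {..<L} \<Otimes>\<^sub>M N \<rightarrow>\<^sub>M K"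
    using assms by (intro measurable_pair_measure_countable1) auto
  moreover have "sets (uniform_count_measure {..<L} \<Otimes>\<^sub>M N) = sets (count_space {..<L} \<Otimes>\<^sub>M N)"
    by (intro sets_pair_measure_cong sets_uniform_count_measure_count_space refl)
  ultimately show ?thesis by (simp cong: measurable_cong_sets)
qed

lemma measurable_mat_col_fst:
  assumes "sets Q = sets (mat_space n L)"
  shows "(\<lambda>p. mat_col n (fst p) (snd p)) \<in> uniform_count_measure {..<L} \<Otimes>\<^sub>M Q \<rightarrow>\<^sub>M mat_space n 1"
  using assms by (intro measurable_uniform_pair) (simp add: measurable_mat_col[OF measurable_ident_sets])

lemma mean_col_law_in_prob_algebra:
  assumes L: "1 \<le> L" and Q: "Q \<in> space (prob_algebra (mat_space n L))"
  shows "mean_col_law n L Q \<in> space (prob_algebra (mat_space n 1))"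
proof -
  have sQ: "sets Q = sets (mat_space n L)" and "prob_space Q" using Q by (auto simp: space_prob_algebra)
  then have "prob_space (uniform_count_measure {..<L} \<Otimes>\<^sub>M Q)"
    using L by (intro prob_space_pair prob_space_uniform_count_measure) (auto simp: lessThan_empty_iff)
  then show ?thesis
    unfolding mean_col_law_def space_prob_algebra
    by (auto intro!: prob_space.prob_space_distr measurable_mat_col_fst sQ)
qed

lemma nn_integral_mean_col_law:
  assumes Q: "Q \<in> space (prob_algebra (mat_space n L))" and F: "F \<in> borel_measurable (mat_space n 1)"
  shows "(\<integral>\<^sup>+x. F x \<partial>mean_col_law n L Q) = ennreal (1 / L) * (\<Sum>t<L. \<integral>\<^sup>+x. F (mat_col n t x) \<partial>Q)"
proof -
  have sQ: "sets Q = sets (mat_space n L)" using Q by (auto simp: space_prob_algebra)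
  interpret Q: prob_space Q using Q by (auto simp: space_prob_algebra)
  note m = measurable_mat_col_fst[OF sQ]
  have "(\<integral>\<^sup>+x. F x \<partial>mean_col_law n L Q)
      = (\<integral>\<^sup>+p. F (mat_col n (fst p) (snd p)) \<partial>(uniform_count_measure {..<L} \<Otimes>\<^sub>M Q))"
    unfolding mean_col_law_def using F by (simp add: nn_integral_distr[OF m])
  also have "\<dots> = (\<integral>\<^sup>+t. \<integral>\<^sup>+x. F (mat_col n t x) \<partial>Q \<partial>uniform_count_measure {..<L})"
    by (subst Q.nn_integral_fst[symmetric]) (use measurable_compose[OF m F] in simp_all)
  finally show ?thesis by (simp add: nn_integral_uniform_count_measure)
qed

lemma nn_integral_frob_sq_mean_col_law:
  assumes Q: "Q \<in> space (prob_algebra (mat_space n L))"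
  shows "(\<integral>\<^sup>+x. ennreal (frob_sq n 1 x) \<partial>mean_col_law n L Q)
    = ennreal (1 / L) * (\<integral>\<^sup>+x. ennreal (frob_sq n L x) \<partial>Q)"
proof -
  have sQ: "sets Q = sets (mat_space n L)" using Q by (auto simp: space_prob_algebra)
  have "(\<Sum>t<L. \<integral>\<^sup>+x. ennreal (frob_sq n 1 (mat_col n t x)) \<partial>Q)
      = (\<integral>\<^sup>+x. (\<Sum>t<L. ennreal (frob_sq n 1 (mat_col n t x))) \<partial>Q)"
  proof (rule nn_integral_sum[symmetric])
    fix t assume "t \<in> {..<L}"
    then have "mat_col n t \<in> Q \<rightarrow>\<^sub>M mat_space n 1"
      using measurable_mat_col[OF measurable_ident_sets[OF sQ]] by simp
    then show "(\<lambda>x. ennreal (frob_sq n 1 (mat_col n t x))) \<in> borel_measurable Q"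
      by (intro measurable_compose[OF _ measurable_ennreal] measurable_compose[OF _ measurable_frob_sq])
  qed
  also have "\<dots> = (\<integral>\<^sup>+x. ennreal (frob_sq n L x) \<partial>Q)"
    by (simp add: frob_sq_columns[of n L] sum_ennreal frob_sq_nonneg)
  finally show ?thesis
    using nn_integral_mean_col_law[OF Q, of "\<lambda>x. ennreal (frob_sq n 1 x)"] by simp
qed

text \<open>All columns pass through the same matrix, so picking a random time commutes with passing
  through the channel. Expectations under the single-use joint law become averages over the columns
  of the block, with the same time for input and output.\<close>

lemma joint_law_mean_col_law:
  assumes H: "H \<in> space (mat_space nr nt)" and L: "1 \<le> L" and Q: "Q \<in> space (prob_algebra (mat_space nt L))"
  defines "J \<equiv> joint_law (mat_space nt L) (mat_space nr L) Q (awgn nt nr L H)"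
    and "cols \<equiv> \<lambda>p. (mat_col nt (fst p) (fst (snd p)), mat_col nr (fst p) (snd (snd p)))"
  shows "joint_law (mat_space nt 1) (mat_space nr 1) (mean_col_law nt L Q) (awgn nt nr 1 H)
      = distr (uniform_count_measure {..<L} \<Otimes>\<^sub>M J) (mat_space nt 1 \<Otimes>\<^sub>M mat_space nr 1) cols" (is "?J1 = distr ?M ?N cols")
    and "cols \<in> uniform_count_measure {..<L} \<Otimes>\<^sub>M J \<rightarrow>\<^sub>M mat_space nt 1 \<Otimes>\<^sub>M mat_space nr 1"
proof -
  note Q1 = mean_col_law_in_prob_algebra[OF L Q]
  have K1: "awgn nt nr k H \<in> mat_space nt k \<rightarrow>\<^sub>M prob_algebra (mat_space nr k)" for k
    by (rule measurable_awgn[OF measurable_const[OF H] measurable_ident_sets[OF refl]])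
  have sQ: "sets Q = sets (mat_space nt L)" "space Q = space (mat_space nt L)"
    using Q by (auto simp: space_prob_algebra dest: sets_eq_imp_space_eq)
  have J: "J \<in> space (prob_algebra (mat_space nt L \<Otimes>\<^sub>M mat_space nr L))"
    unfolding J_def by (rule joint_law_in_prob_algebra[OF Q K1])
  interpret J: prob_space J using J by (simp add: space_prob_algebra)
  have sJ: "sets J = sets (mat_space nt L \<Otimes>\<^sub>M mat_space nr L)" using J by (simp add: space_prob_algebra)
  have cols_t: "(\<lambda>p. cols (t, p)) \<in> mat_space nt L \<Otimes>\<^sub>M mat_space nr L \<rightarrow>\<^sub>M ?N" if "t < L" for t
    unfolding cols_def fst_conv snd_conv using that
    by (intro measurable_Pair measurable_mat_col[OF measurable_fst] measurable_mat_col[OF measurable_snd])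
  then show cols: "cols \<in> ?M \<rightarrow>\<^sub>M ?N"
    by (intro measurable_uniform_pair) (simp add: sJ cong: measurable_cong_sets)
  have J1: "?J1 \<in> space (prob_algebra ?N)" by (rule joint_law_in_prob_algebra[OF Q1 K1])
  show "?J1 = distr ?M ?N cols"
  proof (rule measure_eqI_nn_integral)
    show "sets ?J1 = sets (distr ?M ?N cols)" using J1 by (simp add: space_prob_algebra)
    fix F :: "_ \<Rightarrow> ennreal" assume "F \<in> borel_measurable (distr ?M ?N cols)"
    then have F: "F \<in> borel_measurable ?N" by simp
    define G where "G x = (\<integral>\<^sup>+y. F (x, y) \<partial>awgn nt nr 1 H x)" for x
    have G: "G \<in> borel_measurable (mat_space nt 1)"
      unfolding G_def by (rule nn_integral_measurable_subprob_algebra2[OF _ measurable_prob_algebraD[OF K1]])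
        (use F in simp)
    have "(\<integral>\<^sup>+p. F (cols (t, p)) \<partial>J) = (\<integral>\<^sup>+x. G (mat_col nt t x) \<partial>Q)" if t: "t < L" for t
    proof -
      have "(\<integral>\<^sup>+p. F (cols (t, p)) \<partial>J)
        = (\<integral>\<^sup>+x. \<integral>\<^sup>+y. F (mat_col nt t x, mat_col nr t y) \<partial>awgn nt nr L H x \<partial>Q)"
        unfolding J_def by (subst nn_integral_joint_law[OF Q K1 measurable_compose[OF cols_t[OF t] F]])
          (simp add: cols_def)
      also have "\<dots> = (\<integral>\<^sup>+x. G (mat_col nt t x) \<partial>Q)"
      proof (rule nn_integral_cong)
        fix x assume "x \<in> space Q"
        then have x: "x \<in> space (mat_space nt L)" by (simp add: sQ)
        have "mat_col nt t x \<in> space (mat_space nt 1)" by (auto simp: mat_col_def space_mat_space)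
        then have F': "(\<lambda>y. F (mat_col nt t x, y)) \<in> borel_measurable (mat_space nr 1)"
          using measurable_compose[OF measurable_Pair1' F] by blast
        have sW: "sets (awgn nt nr L H x) = sets (mat_space nr L)"
          using measurable_space[OF K1 x] by (simp add: space_prob_algebra)
        have "mat_col nr t \<in> awgn nt nr L H x \<rightarrow>\<^sub>M mat_space nr 1"
          using measurable_mat_col[OF measurable_ident_sets[OF sW] t] .
        then show "(\<integral>\<^sup>+y. F (mat_col nt t x, mat_col nr t y) \<partial>awgn nt nr L H x) = G (mat_col nt t x)"
          unfolding G_def distr_awgn_col[OF t, symmetric] using F' by (simp add: nn_integral_distr)
      qed
      finally show ?thesis .
    qed
    then have "ennreal (1 / L) * (\<Sum>t<L. \<integral>\<^sup>+p. F (cols (t, p)) \<partial>J)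
        = ennreal (1 / L) * (\<Sum>t<L. \<integral>\<^sup>+x. G (mat_col nt t x) \<partial>Q)" by simp
    also have "\<dots> = (\<integral>\<^sup>+x. G x \<partial>mean_col_law nt L Q)"
      by (rule nn_integral_mean_col_law[OF Q G, symmetric])
    also have "\<dots> = (\<integral>\<^sup>+z. F z \<partial>?J1)"
      unfolding G_def by (rule nn_integral_joint_law[OF Q1 K1 F, symmetric])
    finally have rhs: "(\<integral>\<^sup>+z. F z \<partial>?J1) = ennreal (1 / L) * (\<Sum>t<L. \<integral>\<^sup>+p. F (cols (t, p)) \<partial>J)" by simp
    have "(\<integral>\<^sup>+z. F z \<partial>distr ?M ?N cols) = (\<integral>\<^sup>+t. \<integral>\<^sup>+p. F (cols (t, p)) \<partial>J \<partial>uniform_count_measure {..<L})"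
      using F by (simp add: nn_integral_distr[OF cols] J.nn_integral_fst[symmetric] measurable_compose[OF cols])
    then show "(\<integral>\<^sup>+z. F z \<partial>?J1) = (\<integral>\<^sup>+z. F z \<partial>distr ?M ?N cols)"
      by (simp add: rhs nn_integral_uniform_count_measure)
  qed
qed

text \<open>The product of the column output densities is the output density of the block channel
  under the input whose columns are independent copies of the mean column.\<close>

lemma nn_integral_prod_out_density_le_1:
  assumes H: "H \<in> space (mat_space nr nt)" and P: "P \<in> space (prob_algebra (mat_space nt 1))"
  defines "w \<equiv> \<lambda>z. awgn_density nt nr 1 H (fst z) (snd z)"
  shows "(\<integral>\<^sup>+y. ennreal (\<Prod>t<L. positive_density_kernel.out_density P w (mat_col nr t y)) \<partial>mat_lborel nr L) \<le> 1"
proof -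
  interpret K: positive_density_kernel "mat_space nt 1" "mat_space nr 1" P "awgn nt nr 1 H"
    "mat_lborel nr 1" w 1
    unfolding w_def by (rule positive_density_kernel_awgn[OF H P])
  interpret PP: product_prob_space "\<lambda>_::nat. P"
    using K.prob_space_P by (simp add: product_prob_space_def product_prob_space_axioms_def
        product_sigma_finite_def prob_space_imp_sigma_finite)
  interpret PX: prob_space "PiM {..<L} (\<lambda>_. P)" by (intro prob_space_PiM K.prob_space_P)
  interpret Y: sigma_finite_measure "mat_lborel nr L" by (rule sigma_finite_mat_lborel)
  interpret PXY: pair_sigma_finite "PiM {..<L} (\<lambda>_. P)" "mat_lborel nr L" ..
  have col_in: "mat_col nr t y \<in> space (mat_space nr 1)" for t y
    by (auto simp: mat_col_def space_mat_space)
  have out: "ennreal (\<Prod>t<L. K.out_density (mat_col nr t y))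
      = (\<integral>\<^sup>+X. (\<Prod>t<L. ennreal (w (X t, mat_col nr t y))) \<partial>PiM {..<L} (\<lambda>_. P))" for y
  proof -
    have "(\<lambda>x. w (x, mat_col nr t y)) \<in> borel_measurable P" for t
      using K.integrable_section[OF col_in[of t y]] by (rule borel_measurable_integrable)
    then have "(\<integral>\<^sup>+X. (\<Prod>t<L. ennreal (w (X t, mat_col nr t y))) \<partial>PiM {..<L} (\<lambda>_. P))
        = (\<Prod>t<L. \<integral>\<^sup>+x. ennreal (w (x, mat_col nr t y)) \<partial>P)"
      by (intro PP.product_nn_integral_prod) auto
    then show ?thesis
      using K.out_density_pos[OF col_in]
      by (simp add: K.ennreal_out_density[OF col_in, symmetric] prod_ennreal less_imp_le)
  qed
  define stack where "stack X = (\<lambda>p\<in>{..<nt} \<times> {..<L}. X (snd p) (fst p, 0::nat))" for X :: "nat \<Rightarrow> cmat"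
  have block: "(\<Prod>t<L. ennreal (w (X t, mat_col nr t y))) = ennreal (awgn_density nt nr L H (stack X) y)"
    if X: "X \<in> space (PiM {..<L} (\<lambda>_. P))" for X y
  proof -
    have "mat_col nt t (stack X) = X t" if t: "t < L" for t
    proof
      fix p
      have "X t \<in> extensional ({..<nt} \<times> {..<1})"
        using X t by (auto simp: space_PiM K.space_P space_mat_space PiE_iff)
      then show "mat_col nt t (stack X) p = X t p"
        using t by (cases p) (auto simp: mat_col_def stack_def extensional_def)
    qed
    then have "awgn_density nt nr L H (stack X) y = (\<Prod>t<L. w (X t, mat_col nr t y))"
      unfolding awgn_density_columns[of nt nr L] w_def by (intro prod.cong refl) simp
    then show ?thesis by (simp add: prod_ennreal w_def awgn_density_pos less_imp_le)
  qed
  have meas: "(\<lambda>(X, y). \<Prod>t<L. ennreal (w (X t, mat_col nr t y)))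
      \<in> borel_measurable (PiM {..<L} (\<lambda>_. P) \<Otimes>\<^sub>M mat_lborel nr L)"
    unfolding case_prod_beta' w_def fst_conv snd_conv
  proof (rule borel_measurable_prod_ennreal)
    fix t assume "t \<in> {..<L}"
    then have t: "t < L" by simp
    have "(\<lambda>X. X t) \<in> PiM {..<L} (\<lambda>_. P) \<rightarrow>\<^sub>M P"
      using t by (intro measurable_component_singleton) simp
    then have "(\<lambda>X. X t) \<in> PiM {..<L} (\<lambda>_. P) \<rightarrow>\<^sub>M mat_space nt 1"
      by (rule measurable_compose[OF _ measurable_ident_sets[OF K.sets_P]])
    then have m1: "(\<lambda>p. fst p t) \<in> PiM {..<L} (\<lambda>_. P) \<Otimes>\<^sub>M mat_lborel nr L \<rightarrow>\<^sub>M mat_space nt 1"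
      by (rule measurable_compose[OF measurable_fst])
    have "mat_col nr t \<in> mat_lborel nr L \<rightarrow>\<^sub>M mat_space nr 1"
      using measurable_mat_col[OF measurable_ident_sets t] by simp
    then have m2: "(\<lambda>p. mat_col nr t (snd p)) \<in> PiM {..<L} (\<lambda>_. P) \<Otimes>\<^sub>M mat_lborel nr L \<rightarrow>\<^sub>M mat_space nr 1"
      by (rule measurable_compose[OF measurable_snd])
    show "(\<lambda>p. ennreal (awgn_density nt nr 1 H (fst p t) (mat_col nr t (snd p))))
        \<in> borel_measurable (PiM {..<L} (\<lambda>_. P) \<Otimes>\<^sub>M mat_lborel nr L)"
      by (rule measurable_compose[OF measurable_awgn_density[OF measurable_const[OF H] m1 m2] measurable_ennreal])
  qed
  have "(\<integral>\<^sup>+y. ennreal (\<Prod>t<L. K.out_density (mat_col nr t y)) \<partial>mat_lborel nr L)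
      = (\<integral>\<^sup>+y. \<integral>\<^sup>+X. (\<Prod>t<L. ennreal (w (X t, mat_col nr t y))) \<partial>PiM {..<L} (\<lambda>_. P) \<partial>mat_lborel nr L)"
    by (simp only: out)
  also have "\<dots> = (\<integral>\<^sup>+X. \<integral>\<^sup>+y. (\<Prod>t<L. ennreal (w (X t, mat_col nr t y))) \<partial>mat_lborel nr L \<partial>PiM {..<L} (\<lambda>_. P))"
    by (rule PXY.Fubini'[OF meas])
  also have "\<dots> = (\<integral>\<^sup>+X. 1 \<partial>PiM {..<L} (\<lambda>_. P))"
  proof (rule nn_integral_cong)
    fix X assume X: "X \<in> space (PiM {..<L} (\<lambda>_. P))"
    have s: "stack X \<in> space (mat_space nt L)" by (auto simp: stack_def space_mat_space)
    have W: "awgn nt nr L H (stack X) \<in> space (prob_algebra (mat_space nr L))"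
      by (rule measurable_space[OF measurable_awgn[OF measurable_const[OF H] measurable_ident_sets[OF refl]] s])
    have m: "(\<lambda>y. ennreal (awgn_density nt nr L H (stack X) y)) \<in> borel_measurable (mat_lborel nr L)"
      by (rule measurable_compose[OF measurable_awgn_density[OF measurable_const[OF H] measurable_const[OF s]
            measurable_ident_sets[OF sets_mat_lborel]] measurable_ennreal])
    have sp: "space (mat_lborel nr L) = space (mat_space nr L)" by (rule sets_eq_imp_space_eq) simp
    have "(\<integral>\<^sup>+y. (\<Prod>t<L. ennreal (w (X t, mat_col nr t y))) \<partial>mat_lborel nr L)
        = emeasure (awgn nt nr L H (stack X)) (space (mat_space nr L))"
      unfolding block[OF X] awgn_eq_density
      by (subst emeasure_density[OF m]) (auto simp: sp intro!: nn_integral_cong)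
    also have "\<dots> = 1" by (rule in_space_prob_algebra[OF W])
    finally show "(\<integral>\<^sup>+y. (\<Prod>t<L. ennreal (w (X t, mat_col nr t y))) \<partial>mat_lborel nr L) = 1" .
  qed
  also have "\<dots> = 1" by (simp add: PX.emeasure_space_1)
  finally show ?thesis by simp
qed

text \<open>The chain inequality is applied with \<open>q\<close> the product over the columns of
  the output density of one use under the mean column law. The block density is a product too, so
  \<open>log 2 (wL / q)\<close> is a sum of information densities \<open>l\<close>, all relative to
  the same output density. The average of their means over the columns is the single-use information
  of the mixture.\<close>

theorem io_information_le_single_letter:
  assumes \<kappa>: "\<kappa> \<in> A \<rightarrow>\<^sub>M prob_algebra (mat_space nt L)" and L: "1 \<le> L"
    and H: "H \<in> space (mat_space nr nt)"
    and V: "V \<in> mat_space nr L \<rightarrow>\<^sub>M prob_algebra Z"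
    and K: "positive_density_kernel A Z S K \<nu> g c"
    and K_eq: "\<And>x. x \<in> space A \<Longrightarrow> K x = \<kappa> x \<bind> awgn nt nr L H \<bind> V"
    and power: "(\<integral>\<^sup>+x. ennreal (frob_sq nt L x) \<partial>(S \<bind> \<kappa>)) < \<infinity>"
  shows "io_information A Z S K \<le>
    L * io_information (mat_space nt 1) (mat_space nr 1) (mean_col_law nt L (S \<bind> \<kappa>)) (awgn nt nr 1 H)"
proof -
  interpret K: positive_density_kernel A Z S K \<nu> g c by (rule K)
  define Q where "Q = S \<bind> \<kappa>"
  have Q: "Q \<in> space (prob_algebra (mat_space nt L))"
    using prob_space_bind'[OF K.P \<kappa>] sets_bind'[OF K.P \<kappa>] by (simp add: space_prob_algebra Q_def)
  define P where "P = mean_col_law nt L Q"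
  have P: "P \<in> space (prob_algebra (mat_space nt 1))"
    unfolding P_def by (rule mean_col_law_in_prob_algebra[OF L Q])
  define w where "w z = awgn_density nt nr 1 H (fst z) (snd z)" for z
  define wL where "wL z = awgn_density nt nr L H (fst z) (snd z)" for z
  interpret W: positive_density_kernel "mat_space nt L" "mat_space nr L" Q "awgn nt nr L H" "mat_lborel nr L" wL 1
    unfolding wL_def[abs_def] by (rule positive_density_kernel_awgn[OF H Q])
  interpret W1: positive_density_kernel "mat_space nt 1" "mat_space nr 1" P "awgn nt nr 1 H" "mat_lborel nr 1" w 1
    unfolding w_def[abs_def] by (rule positive_density_kernel_awgn[OF H P])
  have col_in: "mat_col n t y \<in> space (mat_space n 1)" for n t y
    by (auto simp: mat_col_def space_mat_space)
  define q where "q y = (\<Prod>t<L. W1.out_density (mat_col nr t y))" for y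
  have q_pos: "0 < q y" for y
    unfolding q_def by (intro prod_pos) (simp add: W1.out_density_pos col_in)
  have q_meas: "q \<in> borel_measurable (mat_space nr L)"
    unfolding q_def
  proof (rule borel_measurable_prod)
    fix t assume "t \<in> {..<L}"
    then show "(\<lambda>y. W1.out_density (mat_col nr t y)) \<in> borel_measurable (mat_space nr L)"
      by (intro measurable_compose[OF measurable_mat_col W1.out_density_measurable]) auto
  qed
  have q_le: "(\<integral>\<^sup>+y. ennreal (q y) \<partial>mat_lborel nr L) \<le> 1"
    unfolding q_def w_def[abs_def] by (rule nn_integral_prod_out_density_le_1[OF H P])
  define J where "J = joint_law (mat_space nt L) (mat_space nr L) Q (awgn nt nr L H)"
  define J1 where "J1 = joint_law (mat_space nt 1) (mat_space nr 1) P (awgn nt nr 1 H)"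
  define cols where "cols = (\<lambda>p. (mat_col nt (fst p) (fst (snd p)), mat_col nr (fst p) (snd (snd p))))"
  define l where "l z = log 2 (w z / W1.out_density (snd z))" for z
  let ?U = "uniform_count_measure {..<L}"
  have J1_eq: "J1 = distr (?U \<Otimes>\<^sub>M J) (mat_space nt 1 \<Otimes>\<^sub>M mat_space nr 1) cols"
    and cols: "cols \<in> ?U \<Otimes>\<^sub>M J \<rightarrow>\<^sub>M mat_space nt 1 \<Otimes>\<^sub>M mat_space nr 1"
    unfolding J1_def P_def J_def cols_def by (rule joint_law_mean_col_law[OF H L Q])+
  have "(\<integral>\<^sup>+x. ennreal (frob_sq nt 1 x) \<partial>P) < \<infinity>"
    unfolding P_def nn_integral_frob_sq_mean_col_law[OF Q]
    using power by (simp add: Q_def ennreal_mult_less_top)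
  then have int_l: "integrable J1 l"
    unfolding J1_def l_def[abs_def] w_def[abs_def]
    by (rule integrable_awgn_information_density[OF H P])
  have l_meas: "l \<in> borel_measurable (mat_space nt 1 \<Otimes>\<^sub>M mat_space nr 1)"
    using W1.g W1.out_density_measurable unfolding l_def[abs_def] by measurable
  have int: "integrable (?U \<Otimes>\<^sub>M J) (\<lambda>p. l (cols p))"
    using int_l unfolding J1_eq by (simp add: integrable_distr_eq[OF cols l_meas])
  interpret U: prob_space ?U
    using L by (intro prob_space_uniform_count_measure) (auto simp: lessThan_empty_iff)
  have J_in: "J \<in> space (prob_algebra (mat_space nt L \<Otimes>\<^sub>M mat_space nr L))"
    unfolding J_def by (rule joint_law_in_prob_algebra[OF W.P W.K])
  interpret J: prob_space J using J_in by (simp add: space_prob_algebra)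
  interpret UJ: pair_sigma_finite ?U J ..
  \<comment> \<open>Every time has positive weight, so a property that holds for almost every time
    holds for each.\<close>
  have int_t: "integrable J (\<lambda>p. l (cols (t, p)))" if "t < L" for t
  proof -
    have "AE t in ?U. integrable J (\<lambda>p. l (cols (t, p)))" by (rule UJ.AE_integrable_fst'[OF int])
    with that L show ?thesis unfolding uniform_count_measure_def AE_point_measure by auto
  qed
  have "io_information (mat_space nt 1) (mat_space nr 1) P (awgn nt nr 1 H) = (\<integral>z. l z \<partial>J1)"
    unfolding W1.io_information_eq_joint_law J1_def l_def ..
  also have "\<dots> = (\<integral>p. l (cols p) \<partial>(?U \<Otimes>\<^sub>M J))"
    unfolding J1_eq by (rule integral_distr[OF cols l_meas])
  also have "\<dots> = (\<integral>t. \<integral>p. l (cols (t, p)) \<partial>J \<partial>?U)"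
    by (rule UJ.integral_fst'[OF int, symmetric])
  also have "\<dots> = (\<Sum>t<L. \<integral>p. l (cols (t, p)) \<partial>J) / L"
    by (simp add: integral_uniform_count_measure)
  finally have I1: "L * io_information (mat_space nt 1) (mat_space nr 1) P (awgn nt nr 1 H)
      = (\<Sum>t<L. \<integral>p. l (cols (t, p)) \<partial>J)" using L by simp
  have log_eq: "log 2 (wL z / q (snd z)) = (\<Sum>t<L. l (cols (t, z)))" for z
  proof -
    have "wL z / q (snd z) = (\<Prod>t<L. w (cols (t, z)) / W1.out_density (snd (cols (t, z))))"
      unfolding wL_def awgn_density_columns[of nt nr L] q_def by (simp add: prod_dividef w_def cols_def)
    moreover have "w (cols (t, z)) / W1.out_density (snd (cols (t, z))) \<noteq> 0" for t
      by (intro less_imp_neq[THEN not_sym] divide_pos_pos)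
        (simp_all add: w_def awgn_density_pos cols_def W1.out_density_pos col_in)
    ultimately show ?thesis
      unfolding l_def log_def sum_divide_distrib[symmetric]
      by (simp only: ln_prod finite_lessThan not_False_eq_True)
  qed
  have int_J: "integrable J (\<lambda>z. log 2 (wL z / q (snd z)))"
    unfolding log_eq using int_t by (intro Bochner_Integration.integrable_sum) simp
  have "io_information A Z S K \<le> (\<integral>z. log 2 (wL z / q (snd z)) \<partial>J)"
    unfolding J_def Q_def
    by (rule io_information_chain_le[OF \<kappa> W.positive_density_kernel_axioms[unfolded Q_def] V K K_eq q_meas q_pos q_le
        int_J[unfolded J_def Q_def]])
  also have "\<dots> = (\<Sum>t<L. \<integral>p. l (cols (t, p)) \<partial>J)"
    unfolding log_eq using int_t by (intro Bochner_Integration.integral_sum) simp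
  finally show ?thesis unfolding I1[symmetric] P_def Q_def .
qed

section \<open>Relaying strategies\<close>

lemma (in prob_space) prob_le_twice_mean_ge_half:
  assumes u[measurable]: "u \<in> borel_measurable M" and a: "0 < a" "(\<integral>\<^sup>+x. u x \<partial>M) \<le> ennreal a"
  shows "1 / 2 \<le> prob {x \<in> space M. u x \<le> ennreal (2 * a)}"
proof -
  let ?c = "ennreal (1 / (2 * a))"
  have "emeasure M {x \<in> space M. \<not> u x \<le> ennreal (2 * a)} \<le> emeasure M {x \<in> space M. 1 \<le> ?c * u x}"
  proof (rule emeasure_mono)
    have "1 \<le> ?c * u x" if "ennreal (2 * a) < u x" for x
    proof -
      have "1 = ?c * ennreal (2 * a)" using a by (simp flip: ennreal_mult)
      also have "\<dots> \<le> ?c * u x" using that by (intro mult_left_mono) auto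
      finally show ?thesis .
    qed
    then show "{x \<in> space M. \<not> u x \<le> ennreal (2 * a)} \<subseteq> {x \<in> space M. 1 \<le> ?c * u x}" by auto
  qed measurable
  also have "\<dots> \<le> ?c * (\<integral>\<^sup>+x. u x * indicator (space M) x \<partial>M)"
    by (rule nn_integral_Markov_inequality) auto
  also have "(\<integral>\<^sup>+x. u x * indicator (space M) x \<partial>M) = (\<integral>\<^sup>+x. u x \<partial>M)"
    by (intro nn_integral_cong) simp
  also have "?c * \<dots> \<le> ?c * ennreal a" using a by (intro mult_left_mono) auto
  also have "\<dots> = ennreal (1 / 2)" using a by (simp flip: ennreal_mult)
  finally have "prob {x \<in> space M. \<not> u x \<le> ennreal (2 * a)} \<le> 1 / 2"
    unfolding emeasure_eq_measure by (simp only: ennreal_le_iff zero_le_divide_1_iff zero_le_numeral)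
  moreover have "prob {x \<in> space M. \<not> u x \<le> ennreal (2 * a)} = 1 - prob {x \<in> space M. u x \<le> ennreal (2 * a)}"
    by (rule prob_neg) measurable
  ultimately show ?thesis by linarith
qed

lemma measurable_prob_algebra_domain:
  assumes "P \<in> space (prob_algebra A)" "f \<in> A \<rightarrow>\<^sub>M K"
  shows "f \<in> P \<rightarrow>\<^sub>M K"
proof -
  have "sets P = sets A" using assms(1) by (simp add: space_prob_algebra)
  from measurable_compose[OF measurable_ident_sets[OF this] assms(2)] show ?thesis .
qed

text \<open>A lower bound for an infimum of reals needs a nonempty index set. The point mass at the
  zero input, whose power is 0, is a witness.\<close>

lemma mimo_outage_nonneg:
  assumes "0 < snr"
  shows "0 \<le> mimo_outage nt nr snr R"
  unfolding mimo_outage_def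
proof (rule cINF_greatest)
  define x0 :: cmat where "x0 = (\<lambda>p\<in>{..<nt} \<times> {..<1}. 0)"
  have x0: "x0 \<in> space (mat_space nt 1)" by (simp add: x0_def space_mat_space)
  have "frob_sq nt 1 x0 = 0" by (simp add: frob_sq_def x0_def)
  then have "mimo_input nt snr (return (mat_space nt 1) x0)"
    using x0 assms by (simp add: mimo_input_def space_prob_algebra prob_space_return nn_integral_return)
  then show "{Q. mimo_input nt snr Q} \<noteq> {}" by auto
qed (simp add: mimo_outage_of_def)

lemma mimo_outage_le:
  assumes "mimo_input nt snr Q"
  shows "mimo_outage nt nr snr R \<le> mimo_outage_of nt nr Q R"
  unfolding mimo_outage_def
  by (rule cINF_lower) (use assms in \<open>auto intro!: bdd_belowI[of _ 0] simp: mimo_outage_of_def\<close>)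

text \<open>Causality of the channel knowledge. For layer \<open>i - 1\<close> it says that the
  input of hop \<open>i\<close> does not react to the matrix of hop \<open>i\<close>, as the infimum
  in \<open>mimo_outage\<close> requires.\<close>

lemma transmit_law_cong:
  "(\<And>j. j \<in> {1..i} \<Longrightarrow> h j = h' j) \<Longrightarrow> transmit_law n T h i x0 = transmit_law n T h' i x0"
proof (induction i)
  case (Suc i)
  have "transmit_law n T h i x0 = transmit_law n T h' i x0" by (rule Suc.IH) (use Suc.prems in auto)
  moreover have "h (Suc i) = h' (Suc i)" using Suc.prems by simp
  moreover have "restrict h {1..Suc i} = restrict h' {1..Suc i}"
    using Suc.prems by (auto simp: restrict_def fun_eq_iff)
  ultimately show ?case by simp
qed simp

lemma prob_space_multihop_fading: "prob_space (multihop_fading N n)"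
  unfolding multihop_fading_def by (intro prob_space_PiM prob_space_gaussian_mat)

lemma measurable_multihop_fading_component:
  assumes "i \<in> {1..N}"
  shows "(\<lambda>h. h i) \<in> multihop_fading N n \<rightarrow>\<^sub>M mat_space (n i) (n (i - 1))"
proof -
  have "(\<lambda>h. h i) \<in> multihop_fading N n \<rightarrow>\<^sub>M gaussian_mat (n i) (n (i - 1))"
    unfolding multihop_fading_def using assms by (rule measurable_component_singleton)
  from measurable_compose[OF this measurable_ident_sets[OF sets_gaussian_mat]] show ?thesis .
qed

lemma nn_integral_multihop_fading_split:
  assumes i: "i \<in> {1..N}" and f: "f \<in> borel_measurable (multihop_fading N n)"
  shows "(\<integral>\<^sup>+h. f h \<partial>multihop_fading N n)
    = (\<integral>\<^sup>+h. \<integral>\<^sup>+H. f (h(i := H)) \<partial>gaussian_mat (n i) (n (i - 1))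
         \<partial>PiM ({1..N} - {i}) (\<lambda>j. gaussian_mat (n j) (n (j - 1))))"
proof -
  interpret product_sigma_finite "\<lambda>j. gaussian_mat (n j) (n (j - 1))"
    by (simp add: product_sigma_finite_def prob_space_imp_sigma_finite prob_space_gaussian_mat)
  have "insert i ({1..N} - {i}) = {1..N}" using i by auto
  then show ?thesis
    using product_nn_integral_insert[of "{1..N} - {i}" i f] f unfolding multihop_fading_def by simp
qed

section \<open>Kernels and densities of a fixed strategy\<close>

locale multihop_strategy =
  fixes N :: nat and n :: "nat \<Rightarrow> nat" and snr :: real and T :: strategy
  assumes N: "1 \<le> N" and strategy: "relaying_strategy N n snr T"
begin

abbreviation L where "L \<equiv> block_len T"
abbreviation B where "B \<equiv> block_space n T"
abbreviation fading where "fading \<equiv> multihop_fading N n"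

lemma L: "1 \<le> L" and source_in: "source T \<in> space (prob_algebra (B 0))"
  using strategy by (auto simp: relaying_strategy_def)

lemma power: "i < N \<Longrightarrow> (\<integral>\<^sup>+h. (\<integral>\<^sup>+x. ennreal (frob_sq (n i) L x) \<partial>(source T \<bind> transmit_law n T h i)) \<partial>fading)
    \<le> ennreal (real L * snr)"
  using strategy by (simp add: relaying_strategy_def)

lemma measurable_relay:
  assumes i: "i \<in> {1..<N}" and h: "f \<in> M \<rightarrow>\<^sub>M fading" and y: "g \<in> M \<rightarrow>\<^sub>M B i"
  shows "(\<lambda>p. relay T i (restrict (f p) {1..i}, g p)) \<in> M \<rightarrow>\<^sub>M prob_algebra (B i)"
proof -
  have "relay T i \<in> PiM {1..i} (\<lambda>j. mat_space (n j) (n (j - 1))) \<Otimes>\<^sub>M B i \<rightarrow>\<^sub>M prob_algebra (B i)"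
    using strategy i by (simp add: relaying_strategy_def)
  moreover have "(\<lambda>h. restrict h {1..i}) \<in> fading \<rightarrow>\<^sub>M PiM {1..i} (\<lambda>j. mat_space (n j) (n (j - 1)))"
    unfolding multihop_fading_def using i by (intro measurable_restrict_subset') auto
  ultimately show ?thesis
    using measurable_compose[OF measurable_Pair[OF measurable_compose[OF h] y]] by blast
qed

text \<open>Joint measurability in the channel matrices and the source block, not merely for each
  fixed \<open>h\<close>: powers and informations are later treated as random variables of the
  fading.\<close>

lemma measurable_transmit_law:
  "i < N \<Longrightarrow> (\<lambda>p. transmit_law n T (fst p) i (snd p)) \<in> fading \<Otimes>\<^sub>M B 0 \<rightarrow>\<^sub>M prob_algebra (B i)"
proof (induction i)
  case 0
  show ?case by (simp add: measurable_compose[OF measurable_snd measurable_return_prob_space])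
next
  case (Suc i)
  then have i: "Suc i \<in> {1..<N}" and IH: "(\<lambda>p. transmit_law n T (fst p) i (snd p)) \<in> fading \<Otimes>\<^sub>M B 0 \<rightarrow>\<^sub>M prob_algebra (B i)"
    by auto
  have h: "(\<lambda>q. fst (fst q)) \<in> (fading \<Otimes>\<^sub>M B 0) \<Otimes>\<^sub>M K \<rightarrow>\<^sub>M fading" for K :: "cmat measure" by measurable
  have hi: "(\<lambda>q. fst (fst q) (Suc i)) \<in> (fading \<Otimes>\<^sub>M B 0) \<Otimes>\<^sub>M B i \<rightarrow>\<^sub>M mat_space (n (Suc i)) (n i)"
    using measurable_compose[OF h measurable_multihop_fading_component[of "Suc i" N n]] i by simp
  show ?case
    unfolding transmit_law.simps
  proof (rule measurable_bind_prob_space2[where N="B (Suc i)"], rule measurable_bind_prob_space2[where N="B i"])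
    show "(\<lambda>(p, x). awgn (n i) (n (Suc i)) L (fst p (Suc i)) x)
        \<in> (fading \<Otimes>\<^sub>M B 0) \<Otimes>\<^sub>M B i \<rightarrow>\<^sub>M prob_algebra (B (Suc i))"
      unfolding case_prod_beta' by (rule measurable_awgn[OF hi measurable_snd])
    show "(\<lambda>(p, y). relay T (Suc i) (restrict (fst p) {1..Suc i}, y))
        \<in> (fading \<Otimes>\<^sub>M B 0) \<Otimes>\<^sub>M B (Suc i) \<rightarrow>\<^sub>M prob_algebra (B (Suc i))"
      unfolding case_prod_beta' by (rule measurable_relay[OF i h measurable_snd])
  qed (rule IH)
qed

lemma measurable_transmit_law_fixed:
  assumes "h \<in> space fading" "i < N"
  shows "transmit_law n T h i \<in> B 0 \<rightarrow>\<^sub>M prob_algebra (B i)"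
  using measurable_compose[OF measurable_Pair1'[OF assms(1)] measurable_transmit_law[OF assms(2)]] by simp

lemma component_in: "h \<in> space fading \<Longrightarrow> i \<in> {1..N} \<Longrightarrow> h i \<in> space (mat_space (n i) (n (i - 1)))"
  by (rule measurable_space[OF measurable_multihop_fading_component])

lemma measurable_awgn_hop:
  assumes "h \<in> space fading" "i \<in> {1..N}"
  shows "awgn (n (i - 1)) (n i) L (h i) \<in> B (i - 1) \<rightarrow>\<^sub>M prob_algebra (B i)"
  by (rule measurable_awgn[OF measurable_const[OF component_in[OF assms]] measurable_ident_sets[OF refl]])

lemma measurable_receive_law:
  assumes "h \<in> space fading" "i \<in> {1..N}"
  shows "receive_law n T h i \<in> B 0 \<rightarrow>\<^sub>M prob_algebra (B i)"
proof -
  have "i - 1 < N" using assms(2) by auto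
  then show ?thesis
    unfolding receive_law_def
    by (intro measurable_bind_prob_space[OF measurable_transmit_law_fixed[OF assms(1)] measurable_awgn_hop[OF assms]])
qed

lemma receive_law_Suc:
  assumes h: "h \<in> space fading" and i: "i \<in> {1..<N}" and x: "x \<in> space (B 0)"
  shows "receive_law n T h (Suc i) x = receive_law n T h i x
    \<bind> (\<lambda>y. relay T i (restrict h {1..i}, y) \<bind> awgn (n i) (n (Suc i)) L (h (Suc i)))"
proof -
  obtain k where k: "i = Suc k" using i by (cases i) auto
  have eq: "transmit_law n T h i x = receive_law n T h i x \<bind> (\<lambda>y. relay T i (restrict h {1..i}, y))"
    by (simp add: k receive_law_def)
  have r: "receive_law n T h i x \<in> space (prob_algebra (B i))"
    by (rule measurable_space[OF measurable_receive_law[OF h] x]) (use i in auto)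
  have m1: "(\<lambda>y. relay T i (restrict h {1..i}, y)) \<in> receive_law n T h i x \<rightarrow>\<^sub>M subprob_algebra (B i)"
    by (rule measurable_prob_algebra_domain[OF r measurable_prob_algebraD
          [OF measurable_relay[OF i measurable_const[OF h] measurable_ident_sets[OF refl]]]])
  have m2: "awgn (n i) (n (Suc i)) L (h (Suc i)) \<in> B i \<rightarrow>\<^sub>M subprob_algebra (B (Suc i))"
    using measurable_awgn_hop[OF h, of "Suc i"] i by (auto intro: measurable_prob_algebraD)
  have "receive_law n T h (Suc i) x = transmit_law n T h i x \<bind> awgn (n i) (n (Suc i)) L (h (Suc i))"
    by (simp add: receive_law_def)
  then show ?thesis unfolding eq bind_assoc[OF m1 m2] .
qed

text \<open>The Markov property. \<open>V\<close> composes all relays and hops after layer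
  \<open>i\<close>, starting from \<open>return\<close> when \<open>j = i\<close>. It may depend on
  \<open>h\<close>, since data processing is applied with all matrices fixed.\<close>

lemma receive_law_factor:
  assumes h: "h \<in> space fading" and i: "1 \<le> i" and "i \<le> j" and "j \<le> N"
  shows "\<exists>V. V \<in> B i \<rightarrow>\<^sub>M prob_algebra (B j) \<and>
    (\<forall>x\<in>space (B 0). receive_law n T h j x = receive_law n T h i x \<bind> V)"
  using \<open>i \<le> j\<close> \<open>j \<le> N\<close>
proof (induction j rule: dec_induct)
  case base
  have "receive_law n T h i x = receive_law n T h i x \<bind> return (B i)" if x: "x \<in> space (B 0)" for x
  proof (rule bind_return''[symmetric])
    show "sets (receive_law n T h i x) = sets (B i)"
      using measurable_space[OF measurable_receive_law[OF h] x, of i] i base by (simp add: space_prob_algebra)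
  qed
  then show ?case by (intro exI[of _ "return (B i)"]) (simp add: measurable_return_prob_space)
next
  case (step j)
  then obtain V where V: "V \<in> B i \<rightarrow>\<^sub>M prob_algebra (B j)"
    and eq: "\<And>x. x \<in> space (B 0) \<Longrightarrow> receive_law n T h j x = receive_law n T h i x \<bind> V"
    using Suc_leD by blast
  have j: "j \<in> {1..<N}" and ij: "i \<in> {1..N}" using step.hyps step.prems i by auto
  define W where "W y = relay T j (restrict h {1..j}, y) \<bind> awgn (n j) (n (Suc j)) L (h (Suc j))" for y
  have "(\<lambda>y. relay T j (restrict h {1..j}, y)) \<in> B j \<rightarrow>\<^sub>M prob_algebra (B j)"
    by (rule measurable_relay[OF j measurable_const[OF h] measurable_ident_sets[OF refl]])
  moreover have "awgn (n j) (n (Suc j)) L (h (Suc j)) \<in> B j \<rightarrow>\<^sub>M prob_algebra (B (Suc j))"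
    using measurable_awgn_hop[OF h, of "Suc j"] j by auto
  ultimately have W: "W \<in> B j \<rightarrow>\<^sub>M prob_algebra (B (Suc j))"
    unfolding W_def[abs_def] by (rule measurable_bind_prob_space)
  have "receive_law n T h (Suc j) x = receive_law n T h i x \<bind> (\<lambda>y. V y \<bind> W)" if x: "x \<in> space (B 0)" for x
  proof -
    have "V \<in> receive_law n T h i x \<rightarrow>\<^sub>M subprob_algebra (B j)"
      by (rule measurable_prob_algebra_domain[OF measurable_space[OF measurable_receive_law[OF h ij] x]
            measurable_prob_algebraD[OF V]])
    from bind_assoc[OF this measurable_prob_algebraD[OF W]]
    show ?thesis unfolding receive_law_Suc[OF h j x] eq[OF x] W_def[abs_def] .
  qed
  moreover have "(\<lambda>y. V y \<bind> W) \<in> B i \<rightarrow>\<^sub>M prob_algebra (B (Suc j))"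
    by (rule measurable_bind_prob_space[OF V W])
  ultimately show ?case by (intro exI[of _ "\<lambda>y. V y \<bind> W"]) simp
qed

text \<open>The density of the last hop averaged over what layer \<open>N - 1\<close> sends. The
  noise of that hop makes it positive and bounded whatever the relays do. The nonnegative integral
  against a kernel gives measurability jointly in \<open>h\<close> and both blocks; its value is the
  \<open>out_density\<close> of the last hop.\<close>

definition destination_density :: "(nat \<Rightarrow> cmat) \<Rightarrow> cmat \<times> cmat \<Rightarrow> real" where
  "destination_density h z = enn2real (\<integral>\<^sup>+x. ennreal (awgn_density (n (N - 1)) (n N) L (h N) x (snd z))
     \<partial>transmit_law n T h (N - 1) (fst z))"

lemma measurable_destination_density:
  "(\<lambda>p. destination_density (fst p) (snd p)) \<in> borel_measurable (fading \<Otimes>\<^sub>M (B 0 \<Otimes>\<^sub>M B N))"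
proof -
  let ?M = "fading \<Otimes>\<^sub>M (B 0 \<Otimes>\<^sub>M B N)"
  have tr: "(\<lambda>p. (fst p, fst (snd p))) \<in> ?M \<rightarrow>\<^sub>M fading \<Otimes>\<^sub>M B 0" by measurable
  have "(\<lambda>p. transmit_law n T (fst p) (N - 1) (fst (snd p))) \<in> ?M \<rightarrow>\<^sub>M prob_algebra (B (N - 1))"
    using measurable_compose[OF tr measurable_transmit_law[of "N - 1"]] N by simp
  then have K: "(\<lambda>p. transmit_law n T (fst p) (N - 1) (fst (snd p))) \<in> ?M \<rightarrow>\<^sub>M subprob_algebra (B (N - 1))"
    by (rule measurable_prob_algebraD)
  have hN: "(\<lambda>q. fst (fst q) N) \<in> ?M \<Otimes>\<^sub>M B (N - 1) \<rightarrow>\<^sub>M mat_space (n N) (n (N - 1))"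
    using measurable_compose[OF measurable_compose[OF measurable_fst measurable_fst]
        measurable_multihop_fading_component[of N N n]] N by simp
  have z: "(\<lambda>q. snd (snd (fst q))) \<in> ?M \<Otimes>\<^sub>M B (N - 1) \<rightarrow>\<^sub>M B N" by measurable
  have "(\<lambda>(p, x). ennreal (awgn_density (n (N - 1)) (n N) L (fst p N) x (snd (snd p))))
      \<in> borel_measurable (?M \<Otimes>\<^sub>M B (N - 1))"
    unfolding case_prod_beta'
    by (rule measurable_compose[OF measurable_awgn_density[OF hN measurable_snd z] measurable_ennreal])
  from nn_integral_measurable_subprob_algebra2[OF this K]
  show ?thesis
    unfolding destination_density_def by measurable
qed

lemma positive_density_kernel_receive_law:
  assumes h: "h \<in> space fading"
  shows "positive_density_kernel (B 0) (B N) (source T) (receive_law n T h N) (mat_lborel (n N) L)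
    (destination_density h) 1"
proof -
  have N1: "N - 1 < N" "N \<in> {1..N}" using N by auto
  have K: "positive_density_kernel (B (N - 1)) (B N) (transmit_law n T h (N - 1) x0)
      (awgn (n (N - 1)) (n N) L (h N)) (mat_lborel (n N) L)
      (\<lambda>z. awgn_density (n (N - 1)) (n N) L (h N) (fst z) (snd z)) 1" if "x0 \<in> space (B 0)" for x0
    by (rule positive_density_kernel_awgn[OF component_in[OF h N1(2)]
          measurable_space[OF measurable_transmit_law_fixed[OF h N1(1)] that]])
  have eq: "destination_density h (x0, z) = positive_density_kernel.out_density (transmit_law n T h (N - 1) x0)
      (\<lambda>z. awgn_density (n (N - 1)) (n N) L (h N) (fst z) (snd z)) z"
    if x0: "x0 \<in> space (B 0)" and z: "z \<in> space (B N)" for x0 z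
    using positive_density_kernel.ennreal_out_density[OF K[OF x0] z]
      positive_density_kernel.out_density_pos[OF K[OF x0] z]
    by (simp add: destination_density_def flip: enn2real_ennreal)
  have sp: "space (mat_lborel (n N) L) = space (B N)" by (rule sets_eq_imp_space_eq) simp
  have meas: "destination_density h \<in> borel_measurable (B 0 \<Otimes>\<^sub>M B N)"
    using measurable_compose[OF measurable_Pair1'[OF h] measurable_destination_density] by simp
  show ?thesis
  proof (rule positive_density_kernel.intro)
    show "destination_density h \<in> borel_measurable (B 0 \<Otimes>\<^sub>M B N)" by (rule meas)
    fix x0 z assume x0: "x0 \<in> space (B 0)" and z: "z \<in> space (B N)"
    show "0 < destination_density h (x0, z)" "destination_density h (x0, z) \<le> 1"
      unfolding eq[OF x0 z]
      by (rule positive_density_kernel.out_density_pos[OF K[OF x0] z]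
          positive_density_kernel.out_density_le[OF K[OF x0] z])+
  next
    fix x0 assume x0: "x0 \<in> space (B 0)"
    interpret K: positive_density_kernel "B (N - 1)" "B N" "transmit_law n T h (N - 1) x0"
      "awgn (n (N - 1)) (n N) L (h N)" "mat_lborel (n N) L"
      "\<lambda>z. awgn_density (n (N - 1)) (n N) L (h N) (fst z) (snd z)" 1
      by (rule K[OF x0])
    show "receive_law n T h N x0 = density (mat_lborel (n N) L) (\<lambda>z. ennreal (destination_density h (x0, z)))"
      unfolding receive_law_def K.bind_eq_density
    proof (rule density_cong)
      show "(\<lambda>z. ennreal (K.out_density z)) \<in> borel_measurable (mat_lborel (n N) L)"
        using K.out_density_measurable by simp
      show "AE z in mat_lborel (n N) L. ennreal (K.out_density z) = ennreal (destination_density h (x0, z))"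
        using eq[OF x0] by (intro AE_I2) (simp add: sp)
      have "(\<lambda>z. destination_density h (x0, z)) \<in> borel_measurable (B N)"
        using measurable_compose[OF measurable_Pair1'[OF x0] meas] by simp
      then show "(\<lambda>z. ennreal (destination_density h (x0, z))) \<in> borel_measurable (mat_lborel (n N) L)" by simp
    qed
  qed (use N1 in \<open>auto simp: source_in sigma_finite_mat_lborel intro: measurable_receive_law[OF h]\<close>)
qed

end

section \<open>Conditioning on the other hops and comparing outage probabilities\<close>

context multihop_strategy
begin

text \<open>Needed because \<^const>\<open>measure\<close> is \<open>0\<close> on non-measurable sets, so that otherwise the outage
  probability could not be bounded from below.\<close>

lemma measurable_end_to_end_information:
  "(\<lambda>h. end_to_end_information N n T h) \<in> borel_measurable fading"
proof -
  interpret S: prob_space "source T" using source_in by (simp add: space_prob_algebra)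
  have sS[measurable_cong]: "sets (source T) = sets (B 0)" using source_in by (simp add: space_prob_algebra)
  interpret Y: sigma_finite_measure "mat_lborel (n N) L" by (rule sigma_finite_mat_lborel)
  interpret SY: pair_sigma_finite "source T" "mat_lborel (n N) L" ..
  define f where "f h y = (\<integral>x. destination_density h (x, y) \<partial>source T)" for h y
  have "(\<lambda>p. (fst (fst p), snd p, snd (fst p))) \<in> (fading \<Otimes>\<^sub>M B N) \<Otimes>\<^sub>M source T \<rightarrow>\<^sub>M fading \<Otimes>\<^sub>M (B 0 \<Otimes>\<^sub>M B N)"
    by measurable
  from measurable_compose[OF this measurable_destination_density]
  have "(\<lambda>(p, x). destination_density (fst p) (x, snd p)) \<in> borel_measurable ((fading \<Otimes>\<^sub>M B N) \<Otimes>\<^sub>M source T)"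
    by (simp add: case_prod_beta')
  then have f: "(\<lambda>p. f (fst p) (snd p)) \<in> borel_measurable (fading \<Otimes>\<^sub>M B N)"
    unfolding f_def by (rule S.borel_measurable_lebesgue_integral)
  define G where "G h z = destination_density h z * log 2 (destination_density h z / f h (snd z))" for h z
  have "(\<lambda>p. (fst p, snd (snd p))) \<in> fading \<Otimes>\<^sub>M (B 0 \<Otimes>\<^sub>M B N) \<rightarrow>\<^sub>M fading \<Otimes>\<^sub>M B N"
    by measurable
  from measurable_compose[OF this f]
  have [measurable]: "(\<lambda>p. f (fst p) (snd (snd p))) \<in> borel_measurable (fading \<Otimes>\<^sub>M (B 0 \<Otimes>\<^sub>M B N))" by simp
  note [measurable] = measurable_destination_density
  have "(\<lambda>p. G (fst p) (snd p)) \<in> borel_measurable (fading \<Otimes>\<^sub>M (B 0 \<Otimes>\<^sub>M B N))"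
    unfolding G_def by measurable
  moreover have "sets (fading \<Otimes>\<^sub>M (source T \<Otimes>\<^sub>M mat_lborel (n N) L)) = sets (fading \<Otimes>\<^sub>M (B 0 \<Otimes>\<^sub>M B N))"
    by (intro sets_pair_measure_cong refl sS sets_mat_lborel)
  ultimately have "(\<lambda>p. G (fst p) (snd p)) \<in> borel_measurable (fading \<Otimes>\<^sub>M (source T \<Otimes>\<^sub>M mat_lborel (n N) L))"
    by (simp cong: measurable_cong_sets)
  then have "(\<lambda>(h, z). G h z) \<in> borel_measurable (fading \<Otimes>\<^sub>M (source T \<Otimes>\<^sub>M mat_lborel (n N) L))"
    by (simp add: case_prod_beta')
  then have "(\<lambda>h. (\<integral>z. G h z \<partial>(source T \<Otimes>\<^sub>M mat_lborel (n N) L)) / real L) \<in> borel_measurable fading"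
    by (intro borel_measurable_divide SY.borel_measurable_lebesgue_integral) simp_all
  moreover have "end_to_end_information N n T h = (\<integral>z. G h z \<partial>(source T \<Otimes>\<^sub>M mat_lborel (n N) L)) / real L"
    if h: "h \<in> space fading" for h
    unfolding end_to_end_information_def G_def f_def
      positive_density_kernel.io_information_eq[OF positive_density_kernel_receive_law[OF h]]
      positive_density_kernel.out_density_def[OF positive_density_kernel_receive_law[OF h]] ..
  ultimately show ?thesis by (simp cong: measurable_cong)
qed

text \<open>Extended-valued, because the power constraint bounds only its mean over the fading and
  leaves infinite values at particular \<open>h\<close> possible.\<close>

definition hop_power :: "nat \<Rightarrow> (nat \<Rightarrow> cmat) \<Rightarrow> ennreal" where
  "hop_power i h = (\<integral>\<^sup>+x. ennreal (frob_sq (n i) L x) \<partial>(source T \<bind> transmit_law n T h i))"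

lemma measurable_hop_power:
  assumes "i < N"
  shows "hop_power i \<in> borel_measurable fading"
proof -
  have "(\<lambda>h. source T \<bind> transmit_law n T h i) \<in> fading \<rightarrow>\<^sub>M prob_algebra (B i)"
    by (rule measurable_bind_prob_space2[OF measurable_const[OF source_in]])
      (use measurable_transmit_law[OF assms] in \<open>simp add: case_prod_beta'\<close>)
  from nn_integral_measurable_subprob_algebra2[OF _ measurable_prob_algebraD[OF this]]
  show ?thesis unfolding hop_power_def[abs_def] by simp
qed

lemma transmit_law_upd:
  assumes "i \<in> {1..N}"
  shows "transmit_law n T (h(i := H)) (i - 1) = transmit_law n T (h(i := H')) (i - 1)"
  using assms by (intro ext transmit_law_cong) auto

text \<open>Finite power guarantees that the single-use information on the right is the integral of
  an integrable density and not the default value 0. Dividing by the block length turns the block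
  bound into one per channel use.\<close>

lemma end_to_end_information_le_hop:
  assumes h: "h \<in> space fading" and i: "i \<in> {1..N}" and power: "hop_power (i - 1) h < \<infinity>"
  shows "end_to_end_information N n T h
    \<le> io_information (mat_space (n (i - 1)) 1) (mat_space (n i) 1)
        (mean_col_law (n (i - 1)) L (source T \<bind> transmit_law n T h (i - 1))) (awgn (n (i - 1)) (n i) 1 (h i))"
proof -
  obtain V where V: "V \<in> B i \<rightarrow>\<^sub>M prob_algebra (B N)"
    and eq: "\<And>x. x \<in> space (B 0) \<Longrightarrow> receive_law n T h N x = receive_law n T h i x \<bind> V"
    using receive_law_factor[OF h _ _ order_refl] i by (meson atLeastAtMost_iff)
  have "io_information (B 0) (B N) (source T) (receive_law n T h N)
    \<le> L * io_information (mat_space (n (i - 1)) 1) (mat_space (n i) 1)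
        (mean_col_law (n (i - 1)) L (source T \<bind> transmit_law n T h (i - 1))) (awgn (n (i - 1)) (n i) 1 (h i))"
  proof (rule io_information_le_single_letter[OF _ L component_in[OF h i] V
        positive_density_kernel_receive_law[OF h]])
    show "transmit_law n T h (i - 1) \<in> B 0 \<rightarrow>\<^sub>M prob_algebra (B (i - 1))"
      using i by (intro measurable_transmit_law_fixed[OF h]) auto
    show "receive_law n T h N x = transmit_law n T h (i - 1) x \<bind> awgn (n (i - 1)) (n i) L (h i) \<bind> V"
      if "x \<in> space (B 0)" for x
      using eq[OF that] by (simp add: receive_law_def)
    show "(\<integral>\<^sup>+x. ennreal (frob_sq (n (i - 1)) L x) \<partial>(source T \<bind> transmit_law n T h (i - 1))) < \<infinity>"
      using power by (simp add: hop_power_def)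
  qed
  then show ?thesis
    unfolding end_to_end_information_def mult.commute[of "real L"]
    by (rule mult_imp_div_pos_le[rotated]) (use L in linarith)
qed

text \<open>With \<open>m\<close> the hop outage at \<open>2 * snr\<close>, the claim follows from
  \<open>m * prob P <= prob E\<close> and \<open>1 / 2 <= prob P\<close>. The first inequality is
  proved on every section that fixes all hops but \<open>i\<close> and is then integrated. Two rates
  appear because the limit argument compares different multiplexing gains at different snr.\<close>

lemma mimo_outage_le_end_to_end_outage:
  assumes i: "i \<in> {1..N}" and snr: "0 < snr" and R: "R' \<le> R"
  shows "mimo_outage (n (i - 1)) (n i) (2 * snr) R' \<le> 2 * end_to_end_outage N n T R"
proof -
  interpret F: prob_space fading by (rule prob_space_multihop_fading)
  interpret G: prob_space "gaussian_mat (n i) (n (i - 1))" by (rule prob_space_gaussian_mat)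
  define m where "m = mimo_outage (n (i - 1)) (n i) (2 * snr) R'"
  have m0: "0 \<le> m" unfolding m_def using snr by (intro mimo_outage_nonneg) simp
  have i': "i - 1 < N" using i by auto
  define E where "E = {h \<in> space fading. end_to_end_information N n T h < R}"
  define P where "P = {h \<in> space fading. hop_power (i - 1) h \<le> ennreal (2 * (L * snr))}"
  have E: "E \<in> sets fading"
    unfolding E_def using measurable_end_to_end_information by measurable
  have P: "P \<in> sets fading"
    unfolding P_def using measurable_hop_power[OF i'] by measurable
  have half: "1 / 2 \<le> F.prob P"
    unfolding P_def using L snr power[OF i']
    by (intro F.prob_le_twice_mean_ge_half measurable_hop_power[OF i']) (simp_all add: hop_power_def)
  let ?I = "{1..N} - {i}"
  let ?MI = "PiM ?I (\<lambda>j. gaussian_mat (n j) (n (j - 1)))"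
  let ?g = "gaussian_mat (n i) (n (i - 1))"
  have upd: "x(i := H) \<in> space fading" if "x \<in> space ?MI" "H \<in> space ?g" for x H
    using that i unfolding multihop_fading_def by (auto simp: space_PiM PiE_iff extensional_def)
  have upd_meas: "(\<lambda>H. x(i := H)) \<in> ?g \<rightarrow>\<^sub>M fading" if x: "x \<in> space ?MI" for x
  proof -
    have "insert i ?I = {1..N}" using i by auto
    then show ?thesis
      using measurable_component_update[OF x, of i] unfolding multihop_fading_def by simp
  qed
  \<comment> \<open>Membership in \<open>P\<close> concerns only hops before \<open>i\<close>, so a
    section of \<open>P\<close> is either empty or everything. If it is empty, the left side is 0;
    otherwise it is at most \<open>m\<close>, and one input law \<open>Q1\<close>, the same for all
    \<open>H\<close>, is admissible at \<open>2 * snr\<close>.\<close>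
  have section_le: "ennreal m * (\<integral>\<^sup>+H. indicator P (x(i := H)) \<partial>?g) \<le> (\<integral>\<^sup>+H. indicator E (x(i := H)) \<partial>?g)"
    if x: "x \<in> space ?MI" for x
  proof (cases "\<exists>H0\<in>space ?g. x(i := H0) \<in> P")
    case False
    then have "(\<integral>\<^sup>+H. indicator P (x(i := H)) \<partial>?g) = (\<integral>\<^sup>+H. 0 \<partial>?g)"
      by (intro nn_integral_cong) (auto simp: indicator_def)
    then show ?thesis by simp
  next
    case True
    then obtain H0 where H0: "H0 \<in> space ?g" "x(i := H0) \<in> P" by auto
    define Q where "Q = source T \<bind> transmit_law n T (x(i := H0)) (i - 1)"
    have Q_eq: "source T \<bind> transmit_law n T (x(i := H)) (i - 1) = Q" for H
      unfolding Q_def by (simp only: transmit_law_upd[OF i, of x H H0])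
    have pw: "hop_power (i - 1) (x(i := H)) \<le> ennreal (2 * (L * snr))" for H
      using H0(2) by (simp add: P_def hop_power_def Q_eq)
    define Q1 where "Q1 = mean_col_law (n (i - 1)) L Q"
    have "transmit_law n T (x(i := H0)) (i - 1) \<in> B 0 \<rightarrow>\<^sub>M prob_algebra (B (i - 1))"
      by (rule measurable_transmit_law_fixed[OF upd[OF x H0(1)] i'])
    from prob_space_bind'[OF source_in this] sets_bind'[OF source_in this]
    have Q: "Q \<in> space (prob_algebra (B (i - 1)))"
      by (simp add: Q_def space_prob_algebra)
    have "mimo_input (n (i - 1)) (2 * snr) Q1"
      unfolding mimo_input_def
    proof
      show "Q1 \<in> space (prob_algebra (mat_space (n (i - 1)) 1))"
        unfolding Q1_def by (rule mean_col_law_in_prob_algebra[OF L Q])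
      have "(\<integral>\<^sup>+x. ennreal (frob_sq (n (i - 1)) 1 x) \<partial>Q1) = ennreal (1 / L) * hop_power (i - 1) (x(i := H0))"
        unfolding Q1_def nn_integral_frob_sq_mean_col_law[OF Q] hop_power_def Q_eq ..
      also have "\<dots> \<le> ennreal (1 / L) * ennreal (2 * (L * snr))" by (intro mult_left_mono pw) simp
      also have "\<dots> = ennreal (1 / L * (2 * (L * snr)))" by (rule ennreal_mult'[symmetric]) simp
      also have "1 / L * (2 * (L * snr)) = 2 * snr" using L by simp
      finally show "(\<integral>\<^sup>+x. ennreal (frob_sq (n (i - 1)) 1 x) \<partial>Q1) \<le> ennreal (2 * snr)" .
    qed
    then have "m \<le> mimo_outage_of (n (i - 1)) (n i) Q1 R'"
      unfolding m_def by (rule mimo_outage_le)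
    \<comment> \<open>Monotonicity asks for measurability of the larger set only, here the section
      of \<open>E\<close>.\<close>
    also have "\<dots> \<le> G.prob ((\<lambda>H. x(i := H)) -` E \<inter> space ?g)"
      unfolding mimo_outage_of_def
    proof (rule G.finite_measure_mono)
      show "(\<lambda>H. x(i := H)) -` E \<inter> space ?g \<in> sets ?g" by (rule measurable_sets[OF upd_meas[OF x] E])
      show "{H \<in> space ?g. io_information (mat_space (n (i - 1)) 1) (mat_space (n i) 1) Q1
          (awgn (n (i - 1)) (n i) 1 H) < R'} \<subseteq> (\<lambda>H. x(i := H)) -` E \<inter> space ?g"
      proof
        fix H assume "H \<in> {H \<in> space ?g. io_information (mat_space (n (i - 1)) 1) (mat_space (n i) 1) Q1
          (awgn (n (i - 1)) (n i) 1 H) < R'}"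
        then have H: "H \<in> space ?g"
          and less: "io_information (mat_space (n (i - 1)) 1) (mat_space (n i) 1) Q1 (awgn (n (i - 1)) (n i) 1 H) < R'"
          by simp_all
        have "hop_power (i - 1) (x(i := H)) < \<infinity>" using pw[of H] by (rule le_less_trans) simp
        from end_to_end_information_le_hop[OF upd[OF x H] i this]
        have "x(i := H) \<in> E"
          unfolding E_def using upd[OF x H] less R by (simp add: Q_eq Q1_def)
        with H show "H \<in> (\<lambda>H. x(i := H)) -` E \<inter> space ?g" by simp
      qed
    qed
    finally have "ennreal m \<le> emeasure ?g ((\<lambda>H. x(i := H)) -` E \<inter> space ?g)"
      by (simp add: G.emeasure_eq_measure ennreal_leI)
    also have "\<dots> = (\<integral>\<^sup>+H. indicator E (x(i := H)) \<partial>?g)"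
      by (subst nn_integral_indicator[symmetric, OF measurable_sets[OF upd_meas[OF x] E]])
        (intro nn_integral_cong, auto simp: indicator_def)
    finally have "ennreal m \<le> (\<integral>\<^sup>+H. indicator E (x(i := H)) \<partial>?g)" .
    moreover have "(\<integral>\<^sup>+H. indicator P (x(i := H)) \<partial>?g) \<le> (\<integral>\<^sup>+H. 1 \<partial>?g)"
      by (intro nn_integral_mono) (simp add: indicator_def)
    then have "(\<integral>\<^sup>+H. indicator P (x(i := H)) \<partial>?g) \<le> 1"
      using G.emeasure_space_1 by simp
    then have "ennreal m * (\<integral>\<^sup>+H. indicator P (x(i := H)) \<partial>?g) \<le> ennreal m * 1"
      by (intro mult_left_mono) simp_all
    then have "ennreal m * (\<integral>\<^sup>+H. indicator P (x(i := H)) \<partial>?g) \<le> ennreal m" by simp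
    ultimately show ?thesis by (rule order_trans[rotated])
  qed
  have meas_P: "(\<lambda>x. \<integral>\<^sup>+H. indicator P (x(i := H)) \<partial>?g) \<in> borel_measurable ?MI"
  proof -
    have "(\<lambda>p. (fst p)(i := snd p)) \<in> ?MI \<Otimes>\<^sub>M ?g \<rightarrow>\<^sub>M PiM (insert i ?I) (\<lambda>j. gaussian_mat (n j) (n (j - 1)))"
      using measurable_add_dim[of i ?I "\<lambda>j. gaussian_mat (n j) (n (j - 1))"] by (simp add: case_prod_beta')
    moreover have "insert i ?I = {1..N}" using i by auto
    ultimately have "(\<lambda>p. (fst p)(i := snd p)) \<in> ?MI \<Otimes>\<^sub>M ?g \<rightarrow>\<^sub>M fading"
      unfolding multihop_fading_def by simp
    from measurable_compose[OF this borel_measurable_indicator[OF P]]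
    have "(\<lambda>(x, H). indicator P (x(i := H)) :: ennreal) \<in> borel_measurable (?MI \<Otimes>\<^sub>M ?g)"
      by (simp add: case_prod_beta')
    then show ?thesis by (rule G.borel_measurable_nn_integral)
  qed
  have "ennreal m * emeasure fading P = ennreal m * (\<integral>\<^sup>+h. indicator P h \<partial>fading)"
    using P by simp
  also have "\<dots> = ennreal m * (\<integral>\<^sup>+x. \<integral>\<^sup>+H. indicator P (x(i := H)) \<partial>?g \<partial>?MI)"
    using P by (subst nn_integral_multihop_fading_split[OF i]) simp_all
  also have "\<dots> = (\<integral>\<^sup>+x. ennreal m * (\<integral>\<^sup>+H. indicator P (x(i := H)) \<partial>?g) \<partial>?MI)"
    by (rule nn_integral_cmult[symmetric, OF meas_P])
  also have "\<dots> \<le> (\<integral>\<^sup>+x. \<integral>\<^sup>+H. indicator E (x(i := H)) \<partial>?g \<partial>?MI)"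
    by (intro nn_integral_mono section_le)
  also have "\<dots> = (\<integral>\<^sup>+h. indicator E h \<partial>fading)"
    using E by (subst nn_integral_multihop_fading_split[OF i]) simp_all
  also have "\<dots> = emeasure fading E" using E by simp
  finally have "m * F.prob P \<le> F.prob E"
    using m0 by (simp add: F.emeasure_eq_measure flip: ennreal_mult)
  moreover have "m * (1 / 2) \<le> m * F.prob P" using half m0 by (intro mult_left_mono)
  ultimately show ?thesis by (simp add: m_def end_to_end_outage_def E_def)
qed

end

section \<open>Passing to the limit and the minimum over the hops\<close>

lemma dmt_mimo_outage:
  assumes "has_dmt (mimo_outage nt nr) R0 r (ereal c)"
  shows "dmt (mimo_outage nt nr) R0 r = ereal c"
  using assms unfolding has_dmt_def dmt_def by (intro tendsto_Lim) simp_all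

text \<open>The outage inequality holds for each pair of snr and rate separately, so the strategy
  may change with both. At \<open>r = 0\<close> the comparison gain is 0 itself; for
  \<open>r > 0\<close> every gain below \<open>r\<close> is admissible, and \<open>r\<close> is
  reached by left continuity.\<close>

lemma multihop_dmt_le_hop:
  fixes n :: "nat \<Rightarrow> nat" and T :: "real \<Rightarrow> real \<Rightarrow> strategy"
  assumes i: "i \<in> {1..N}" and R0: "0 < R0" and r: "0 \<le> r"
    and mimo: "\<And>r. 0 \<le> r \<Longrightarrow> has_dmt (mimo_outage (n (i - 1)) (n i)) R0 r (ereal (mimo_dmt_curve (n (i - 1)) (n i) r))"
    and T: "\<And>snr R. 0 < snr \<Longrightarrow> 0 < R \<Longrightarrow> relaying_strategy N n snr (T snr R)"
    and d: "has_dmt (\<lambda>snr R. end_to_end_outage N n (T snr R) R) R0 r d"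
  shows "d \<le> ereal (mimo_dmt_curve (n (i - 1)) (n i) r)"
proof -
  have le: "d \<le> ereal (mimo_dmt_curve (n (i - 1)) (n i) r')"
    if r': "r' = 0 \<and> r = 0 \<or> 0 < r' \<and> r' < r" for r'
  proof (rule dmt_le_of_outage_ge[OF _ mimo_outage_nonneg mimo d R0 r'])
    fix snr R R' :: real assume "1 < snr" "0 < R'" "R' \<le> R"
    then interpret multihop_strategy N n snr "T snr R"
      using i T by unfold_locales auto
    show "mimo_outage (n (i - 1)) (n i) (2 * snr) R' \<le> 2 * end_to_end_outage N n (T snr R) R"
      using \<open>1 < snr\<close> \<open>R' \<le> R\<close> by (intro mimo_outage_le_end_to_end_outage i) auto
  qed (use r' in auto)
  show ?thesis
  proof (cases "r = 0")
    case False
    with r have "0 < r" by simp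
    have "((\<lambda>s. ereal (mimo_dmt_curve (n (i - 1)) (n i) s)) \<longlongrightarrow> ereal (mimo_dmt_curve (n (i - 1)) (n i) r)) (at_left r)"
      by (intro tendsto_intros mimo_dmt_curve_tendsto_left \<open>0 < r\<close>)
    moreover have "\<forall>\<^sub>F s in at_left r. d \<le> ereal (mimo_dmt_curve (n (i - 1)) (n i) s)"
      using eventually_at_left_real[OF \<open>0 < r\<close>] by eventually_elim (use le in auto)
    ultimately show ?thesis by (rule tendsto_lowerbound) simp
  qed (use le in simp)
qed

theorem mainTheorem1:
  fixes N :: nat and n :: "nat \<Rightarrow> nat" and R0 :: real
  assumes "1 \<le> N"
    and "\<And>i. i \<le> N \<Longrightarrow> 1 \<le> n i"
    and "0 < R0"
    and known_mimo_dmt: "\<And>nt nr r. 1 \<le> nt \<Longrightarrow> 1 \<le> nr \<Longrightarrow> 0 \<le> r \<Longrightarrow>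
           has_dmt (mimo_outage nt nr) R0 r (ereal (mimo_dmt_curve nt nr r))"
  shows "(\<forall>T :: real \<Rightarrow> real \<Rightarrow> strategy.
            (\<forall>snr>0. \<forall>R>0. relaying_strategy N n snr (T snr R)) \<longrightarrow>
            (\<forall>r\<ge>0. \<forall>d. has_dmt (\<lambda>snr R. end_to_end_outage N n (T snr R) R) R0 r d
                        \<longrightarrow> d \<le> hop_dmt_min N n R0 r))
       \<and> hop_dmt_min N n R0 0 = ereal (real (MIN i\<in>{1..N}. n (i - 1) * n i))
       \<and> (SUP r\<in>{r. 0 \<le> r \<and> 0 < hop_dmt_min N n R0 r}. ereal r)
           = ereal (real (MIN i\<in>{0..N}. n i))"
proof -
  have ne: "{1..N} \<noteq> {}" "finite {1..N}" using assms(1) by auto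
  have pos: "1 \<le> n (i - 1)" "1 \<le> n i" if "i \<in> {1..N}" for i
    using that assms(2) by (auto simp: le_diff_conv)
  have hop: "has_dmt (mimo_outage (n (i - 1)) (n i)) R0 r (ereal (mimo_dmt_curve (n (i - 1)) (n i) r))"
    if "i \<in> {1..N}" "0 \<le> r" for i r
    using known_mimo_dmt pos that by blast
  have min: "hop_dmt_min N n R0 r = ereal (MIN i\<in>{1..N}. mimo_dmt_curve (n (i - 1)) (n i) r)" if "0 \<le> r" for r
  proof -
    have "hop_dmt_min N n R0 r = (MIN i\<in>{1..N}. ereal (mimo_dmt_curve (n (i - 1)) (n i) r))"
      unfolding hop_dmt_min_def
      by (intro arg_cong[where f=Min] image_cong refl dmt_mimo_outage hop that)
    then show ?thesis using ne by (simp add: ereal_Min)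
  qed
  have part1: "d \<le> hop_dmt_min N n R0 r"
    if T: "\<forall>snr>0. \<forall>R>0. relaying_strategy N n snr (T snr R)" and r: "0 \<le> r"
      and d: "has_dmt (\<lambda>snr R. end_to_end_outage N n (T snr R) R) R0 r d" for T r d
  proof -
    have "d \<le> dmt (mimo_outage (n (i - 1)) (n i)) R0 r" if i: "i \<in> {1..N}" for i
      unfolding dmt_mimo_outage[OF hop[OF i r]]
      using T by (intro multihop_dmt_le_hop[OF i assms(3) r hop[OF i] _ d]) auto
    then show ?thesis unfolding hop_dmt_min_def using ne by simp
  qed
  have part2: "hop_dmt_min N n R0 0 = ereal (real (MIN i\<in>{1..N}. n (i - 1) * n i))"
  proof -
    have "(MIN i\<in>{1..N}. mimo_dmt_curve (n (i - 1)) (n i) 0) = (MIN i\<in>{1..N}. real (n (i - 1) * n i))"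
      using pos by (intro arg_cong[where f=Min] image_cong refl mimo_dmt_curve_at_0) auto
    then show ?thesis using ne real_Min[of "{1..N}" "\<lambda>i. n (i - 1) * n i"] by (simp add: min)
  qed
  define m where "m = (MIN i\<in>{0..N}. n i)"
  have "1 \<le> m" unfolding m_def using assms(2) by simp
  have less_m: "(\<forall>i\<in>{1..N}. r < real (min (n (i - 1)) (n i))) \<longleftrightarrow> r < real m" for r
  proof -
    have "(\<forall>i\<in>{1..N}. r < real (min (n (i - 1)) (n i))) \<longleftrightarrow> (\<forall>i\<in>{0..N}. r < real (n i))"
    proof safe
      fix j assume *: "\<forall>i\<in>{1..N}. r < real (min (n (i - 1)) (n i))" and j: "j \<in> {0..N}"
      show "r < real (n j)"
      \<comment> \<open>Layer 0 is an end of hop 1, which exists since \<open>1 <= N\<close>. Every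
        other layer \<open>j\<close> is the receiving end of hop \<open>j\<close>.\<close>
      proof (cases "j = 0")
        case True
        then show ?thesis using bspec[OF *, of 1] assms(1) by (simp add: min_def split: if_splits)
      next
        case False
        then show ?thesis using bspec[OF *, of j] j by (simp add: min_def split: if_splits)
      qed
    next
      fix i assume *: "\<forall>i\<in>{0..N}. r < real (n i)" and i: "i \<in> {1..N}"
      then show "r < real (min (n (i - 1)) (n i))" by (auto simp: min_def)
    qed
    also have "\<dots> \<longleftrightarrow> r < (MIN i\<in>{0..N}. real (n i))" by simp
    finally show ?thesis by (simp add: real_Min m_def)
  qed
  have set_eq: "{r. 0 \<le> r \<and> 0 < hop_dmt_min N n R0 r} = {0..<real m}"
  proof -
    have "0 < hop_dmt_min N n R0 r \<longleftrightarrow> r < real m" if "0 \<le> r" for r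
      using ne by (simp add: min that mimo_dmt_curve_pos_iff less_m[symmetric])
    then show ?thesis by auto
  qed
  have part3: "(SUP r\<in>{r. 0 \<le> r \<and> 0 < hop_dmt_min N n R0 r}. ereal r) = ereal (real m)"
    unfolding set_eq
  proof (rule antisym)
    show "(SUP r\<in>{0..<real m}. ereal r) \<le> ereal (real m)" by (intro SUP_least) auto
    show "ereal (real m) \<le> (SUP r\<in>{0..<real m}. ereal r)"
    proof (rule dense_le)
      fix y assume y: "y < ereal (real m)"
      \<comment> \<open>The bound \<open>y\<close> may be negative; comparing with
        \<open>max y 0\<close> keeps \<open>s\<close> in the index set, and \<open>1 <= m\<close>
        leaves room for it below \<open>m\<close>.\<close>
      obtain s where s: "max y 0 < ereal s" "s < real m"
        using ereal_dense2[of "max y 0" "ereal (real m)"] y \<open>1 \<le> m\<close> by auto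
      then have "ereal s \<le> (SUP r\<in>{0..<real m}. ereal r)" by (intro SUP_upper) auto
      with s show "y \<le> (SUP r\<in>{0..<real m}. ereal r)" by (auto intro: order_trans less_imp_le)
    qed
  qed
  show ?thesis using part1 part2 part3 unfolding m_def by blast
qed

end
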